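(* Any quantum algorithm which, given query access to an $n$-qubit unitary $U$, distinguishes with constant probability whether (a) $U$ is Haar random, or (b) $U$ is the square of a Haar-random unitary, requires $2^{\Omega(n)}$ queries to $U$.
   Context: Haar random means distributed according to the Haar measure on $\mathrm U(2^n)$; in case (b), $U=V^2$ with $V$ Haar random on $\mathrm U(2^n)$. A $T$-query quantum algorithm may apply the black-box unitary $U$ (or $U^\dagger$) $T$ times adaptively, interleaved with arbitrary fixed quantum operations on the $n$ qubits and any number of ancilla qubits, followed by a two-outcome (accept/reject) measurement. It distinguishes the two cases with constant probability if the absolute difference between its expected acceptance probabilities in cases (a) and (b) is at least some fixed positive constant independent of $n$. *)

theory Defs
  imports "HOL-Probability.Probability" "Jordan_Normal_Form.Schur_Decomposition"
begin

hide_const (open) Finite_Cartesian_Product.mat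

definition unitary_group :: "nat \<Rightarrow> complex mat set" where
  "unitary_group N = {U \<in> carrier_mat N N. mat_adjoint U * U = 1\<^sub>m N}"

text \<open>The type of matrices carries no topology. The Borel sets of the unitary group, regarded as a
  subspace of the Euclidean space of complex matrices, are those generated by the entries.\<close>

definition unitary_borel :: "nat \<Rightarrow> complex mat measure" where
  "unitary_borel N = sigma (unitary_group N)
     {{U \<in> unitary_group N. U $$ (i, j) \<in> B} | i j B. i < N \<and> j < N \<and> B \<in> sets borel}"

text \<open>Left invariance together with total mass one determines the Haar measure uniquely
  (and implies right invariance, the group being compact).\<close>

definition haar_unitary :: "nat \<Rightarrow> complex mat measure \<Rightarrow> bool" where
  "haar_unitary N \<mu> \<longleftrightarrow> prob_space \<mu> \<and> space \<mu> = unitary_group N \<and> sets \<mu> = sets (unitary_borel N) \<and>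
     (\<forall>W \<in> unitary_group N. distr \<mu> \<mu> (\<lambda>U. W * U) = \<mu>)"

text \<open>The distribution of the square of a random unitary with distribution \<open>\<mu>\<close>.\<close>

definition square_distr :: "complex mat measure \<Rightarrow> complex mat measure" where
  "square_distr \<mu> = distr \<mu> \<mu> (\<lambda>V. V * V)"

definition kronecker :: "complex mat \<Rightarrow> complex mat \<Rightarrow> complex mat" where
  "kronecker A B = Matrix.mat (dim_row A * dim_row B) (dim_col A * dim_col B)
     (\<lambda>(i, j). A $$ (i div dim_row B, j div dim_col B) * B $$ (i mod dim_row B, j mod dim_col B))"

definition mat_trace :: "complex mat \<Rightarrow> complex" where
  "mat_trace A = (\<Sum>i<dim_row A. A $$ (i, i))"

definition list_sum_mat :: "nat \<Rightarrow> complex mat list \<Rightarrow> complex mat" where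
  "list_sum_mat N As = foldr (+) As (0\<^sub>m N N)"

text \<open>Quantum operations are given in operator-sum form by a finite list of Kraus operators.
  The same completeness relation characterises the measurement operators of a measurement.\<close>

definition kraus_complete :: "nat \<Rightarrow> complex mat list \<Rightarrow> bool" where
  "kraus_complete N Ks \<longleftrightarrow> set Ks \<subseteq> carrier_mat N N \<and>
     list_sum_mat N (map (\<lambda>K. mat_adjoint K * K) Ks) = 1\<^sub>m N"

definition apply_kraus :: "nat \<Rightarrow> complex mat list \<Rightarrow> complex mat \<Rightarrow> complex mat" where
  "apply_kraus N Ks \<rho> = list_sum_mat N (map (\<lambda>K. K * \<rho> * mat_adjoint K) Ks)"

datatype direction = Forward | Inverse

text \<open>Each element of \<open>rounds\<close> is the operation performed before one query. Its Kraus operators are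
  labelled by the direction of that query, so the choice between \<open>U\<close> and its adjoint may depend
  on the outcome of a measurement; a query in a predetermined direction has constant labels.
  The ancillas can store earlier outcomes. After the last query come the operation \<open>final_op\<close> and a
  measurement with measurement operators \<open>accept_op\<close> and \<open>reject_op\<close>.\<close>

record query_algorithm =
  ancillas :: nat
  rounds :: "(direction \<times> complex mat) list list"
  final_op :: "complex mat list"
  accept_op :: "complex mat"
  reject_op :: "complex mat"

definition total_dim :: "nat \<Rightarrow> query_algorithm \<Rightarrow> nat" where
  "total_dim n A = 2 ^ n * 2 ^ ancillas A"

definition valid_algorithm :: "nat \<Rightarrow> query_algorithm \<Rightarrow> bool" where
  "valid_algorithm n A \<longleftrightarrow>
     (\<forall>R \<in> set (rounds A). kraus_complete (total_dim n A) (map snd R)) \<and>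
     kraus_complete (total_dim n A) (final_op A) \<and>
     kraus_complete (total_dim n A) [accept_op A, reject_op A]"

definition num_queries :: "query_algorithm \<Rightarrow> nat" where
  "num_queries A = length (rounds A)"

definition query_op :: "query_algorithm \<Rightarrow> complex mat \<Rightarrow> direction \<Rightarrow> complex mat" where
  "query_op A U d =
     kronecker (case d of Forward \<Rightarrow> U | Inverse \<Rightarrow> mat_adjoint U) (1\<^sub>m (2 ^ ancillas A))"

definition run_round ::
  "nat \<Rightarrow> query_algorithm \<Rightarrow> complex mat \<Rightarrow> (direction \<times> complex mat) list \<Rightarrow> complex mat \<Rightarrow> complex mat"
where
  "run_round n A U R = apply_kraus (total_dim n A) (map (\<lambda>(d, K). query_op A U d * K) R)"

text \<open>All qubits start in the state zero.\<close>

definition initial_state :: "nat \<Rightarrow> complex mat" where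
  "initial_state N = Matrix.mat N N (\<lambda>(i, j). if i = 0 \<and> j = 0 then 1 else 0)"

definition final_state :: "nat \<Rightarrow> query_algorithm \<Rightarrow> complex mat \<Rightarrow> complex mat" where
  "final_state n A U = apply_kraus (total_dim n A) (final_op A)
     (fold (run_round n A U) (rounds A) (initial_state (total_dim n A)))"

definition accept_prob :: "nat \<Rightarrow> query_algorithm \<Rightarrow> complex mat \<Rightarrow> real" where
  "accept_prob n A U =
     Re (mat_trace (accept_op A * final_state n A U * mat_adjoint (accept_op A)))"

end

theory Submission
  imports Defs "Jordan_Normal_Form.Spectral_Radius" "HOL-Combinatorics.Combinatorics"
begin

text \<open>
  Conjugating by an independent Haar unitary turns the acceptance probability into a class function
  \<open>F\<close>, so that the advantage is the expectation of \<open>F U - F (U\<^sup>2)\<close>, with the same Haar unitary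
  \<open>U\<close> in both places. As \<open>F\<close> only sees the multiset of eigenvalues, the hybrid argument bounds the
  difference by twice the number of queries times the distance between the eigenvalues of \<open>U\<close> and
  those of \<open>U\<^sup>2\<close>, optimally matched. Both spectra are close to an evenly spaced grid: by a Fejer
  kernel estimate, the discrepancy is controlled by the traces of the powers of \<open>U\<close>, and these have
  second moment at most \<open>2 k\<close>. The moment bound follows from the loop equations, which express the
  invariance of the Haar measure under infinitesimal rotations: they are a linear system in the
  joint moments whose diagonal entry, the dimension, dominates. With \<open>N = 2\<^sup>n\<close>, the resulting
  distance is of order \<open>N powr (-1/7)\<close>.
\<close>

unbundle no vec_syntax

section \<open>Matrices, the unitary group and the Euclidean norm\<close>

text \<open>The obstacle is that an eigenvalue z of \<open>U\<close> is not close to the eigenvalue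
  z^2 of its square with the same eigenvector: the spectra are close only as sets. Being a class
  function licenses two unrelated reorderings, one of each spectrum. No joint law of the two spectra
  enters, since each is compared with the same deterministic grid 2 pi k / N. The exponent 1/7 comes
  from three errors. With K grid points and resolution \<eta>, the tails of the kernel cost 1 / (K
  \<eta>^2) and blurred arc ends cost \<eta>; the choice K = m^3, \<eta> = 1/m makes both of order
  1/m. The traces of order below 2 K contribute K^2 / N = m^6 / N in expectation, because each is
  only bounded linearly in its order. This is again of order 1/m once m^7 \<le> N. The loop
  equations preserve the total degree k. For a fixed k they therefore close up on the lists of
  positive numbers with sum k; the off-diagonal weights add up to k - 1, against the diagonal entry
  N.\<close>

lemma mat_adjoint_carrier [simp]:
  "A \<in> carrier_mat n m \<Longrightarrow> mat_adjoint A \<in> carrier_mat m n"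
  by (auto simp: mat_adjoint_def mat_of_rows_def)

lemma mat_adjoint_dim [simp]:
  "dim_row (mat_adjoint A) = dim_col A" "dim_col (mat_adjoint A) = dim_row A"
  by (auto simp: mat_adjoint_def mat_of_rows_def)

lemma mat_adjoint_index [simp]:
  fixes A :: "complex mat"
  shows "i < dim_col A \<Longrightarrow> j < dim_row A \<Longrightarrow> mat_adjoint A $$ (i, j) = cnj (A $$ (j, i))"
  by (simp add: mat_adjoint_def mat_of_rows_def)

lemma times_index:
  assumes "A \<in> carrier_mat n m" "B \<in> carrier_mat m l" "i < n" "j < l"
  shows "(A * B) $$ (i, j) = (\<Sum>k<m. A $$ (i, k) * B $$ (k, j))"
  using assms by (simp add: scalar_prod_def atLeast0LessThan)

lemma mult_vec_index:
  assumes "A \<in> carrier_mat n m" "v \<in> carrier_vec m" "i < n"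
  shows "(A *\<^sub>v v) $ i = (\<Sum>k<m. A $$ (i, k) * v $ k)"
  using assms by (simp add: scalar_prod_def atLeast0LessThan)

lemma mat_adjoint_mult:
  fixes A B :: "complex mat"
  assumes "A \<in> carrier_mat n m" "B \<in> carrier_mat m l"
  shows "mat_adjoint (A * B) = mat_adjoint B * mat_adjoint A"
proof (rule eq_matI)
  fix i j assume "i < dim_row (mat_adjoint B * mat_adjoint A)" "j < dim_col (mat_adjoint B * mat_adjoint A)"
  then have ij: "i < l" "j < n" using assms by auto
  have "mat_adjoint (A * B) $$ (i, j) = (\<Sum>k<m. cnj (A $$ (j, k)) * cnj (B $$ (k, i)))"
    using assms ij by (subst mat_adjoint_index) (auto simp: times_index[OF assms] simp del: index_mult_mat(1))
  also have "\<dots> = (mat_adjoint B * mat_adjoint A) $$ (i, j)"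
    using assms ij by (subst times_index[of _ l m _ n]) (auto intro!: sum.cong)
  finally show "mat_adjoint (A * B) $$ (i, j) = (mat_adjoint B * mat_adjoint A) $$ (i, j)" .
qed (use assms in auto)

lemma mat_adjoint_adjoint [simp]: "mat_adjoint (mat_adjoint A) = (A :: complex mat)"
  by (rule eq_matI) auto

lemma mat_adjoint_one [simp]: "mat_adjoint (1\<^sub>m n) = (1\<^sub>m n :: complex mat)"
  by (rule eq_matI) auto

lemma unitary_groupD:
  assumes "U \<in> unitary_group N"
  shows "U \<in> carrier_mat N N" "mat_adjoint U * U = 1\<^sub>m N" "U * mat_adjoint U = 1\<^sub>m N"
  using assms mat_mult_left_right_inverse[of "mat_adjoint U" N U] by (auto simp: unitary_group_def)

lemma unitary_group_one: "1\<^sub>m N \<in> unitary_group N"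
  by (simp add: unitary_group_def)

lemma unitary_group_adjoint:
  assumes "U \<in> unitary_group N"
  shows "mat_adjoint U \<in> unitary_group N"
  using unitary_groupD[OF assms] by (simp add: unitary_group_def)

lemma unitary_group_mult:
  assumes "U \<in> unitary_group N" "V \<in> unitary_group N"
  shows "U * V \<in> unitary_group N"
proof -
  note U = unitary_groupD[OF assms(1)] and V = unitary_groupD[OF assms(2)]
  have "mat_adjoint (U * V) * (U * V) = mat_adjoint V * (mat_adjoint U * (U * V))"
    using U(1) V(1) by (subst mat_adjoint_mult[of U N N V N]) (auto intro!: assoc_mult_mat[of _ N N _ N _ N])
  also have "mat_adjoint U * (U * V) = V"
    using U V by (subst assoc_mult_mat[symmetric, of _ N N _ N _ N]) auto
  finally show ?thesis using U V by (auto simp: unitary_group_def)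
qed

section \<open>Squared norms and bounds for their differences\<close>

definition sqn :: "complex vec \<Rightarrow> real" where
  "sqn v = (\<Sum>i<dim_vec v. (cmod (v $ i))\<^sup>2)"

lemma sqn_nonneg [simp]: "sqn v \<ge> 0"
  by (simp add: sqn_def sum_nonneg)

lemma of_real_sqn: "complex_of_real (sqn v) = (\<Sum>i<dim_vec v. cnj (v $ i) * v $ i)"
  unfolding sqn_def by (auto simp: complex_norm_square mult.commute intro!: sum.cong simp del: of_real_power)

text \<open>Writing the squared norm as a quadratic form in B^* B lets unitarity and the Kraus
  completeness relation be applied entry by entry.\<close>

lemma of_real_sqn_mult:
  assumes "B \<in> carrier_mat m n" "v \<in> carrier_vec n"
  shows "complex_of_real (sqn (B *\<^sub>v v)) =
    (\<Sum>i<n. \<Sum>j<n. cnj (v $ i) * (mat_adjoint B * B) $$ (i, j) * v $ j)"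
proof -
  have "complex_of_real (sqn (B *\<^sub>v v)) =
      (\<Sum>k<m. cnj (\<Sum>i<n. B $$ (k, i) * v $ i) * (\<Sum>j<n. B $$ (k, j) * v $ j))"
    using assms unfolding of_real_sqn by (auto simp: mult_vec_index[OF assms] simp del: index_mult_mat_vec intro!: sum.cong)
  also have "\<dots> = (\<Sum>k<m. \<Sum>i<n. \<Sum>j<n. cnj (v $ i) * (cnj (B $$ (k, i)) * B $$ (k, j)) * v $ j)"
    by (intro sum.cong refl, subst cnj_sum, subst sum_product) (intro sum.cong refl, simp add: mult_ac)
  also have "\<dots> = (\<Sum>i<n. \<Sum>j<n. \<Sum>k<m. cnj (v $ i) * (cnj (B $$ (k, i)) * B $$ (k, j)) * v $ j)"
    by (subst sum.swap, rule sum.cong[OF refl], subst sum.swap, rule refl)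
  also have "\<dots> = (\<Sum>i<n. \<Sum>j<n. cnj (v $ i) * (mat_adjoint B * B) $$ (i, j) * v $ j)"
    using assms
    by (intro sum.cong refl) (simp add: times_index[of _ n m _ n] sum_distrib_left sum_distrib_right del: index_mult_mat(1))
  finally show ?thesis .
qed

lemma sqn_unitary:
  assumes "U \<in> unitary_group N" "v \<in> carrier_vec N"
  shows "sqn (U *\<^sub>v v) = sqn v"
proof -
  have "complex_of_real (sqn (U *\<^sub>v v)) = (\<Sum>i<N. \<Sum>j<N. cnj (v $ i) * (1\<^sub>m N) $$ (i, j) * v $ j)"
    using unitary_groupD[OF assms(1)] assms(2) by (subst of_real_sqn_mult) auto
  also have "\<dots> = (\<Sum>i<N. \<Sum>j<N. if i = j then cnj (v $ i) * v $ j else 0)"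
    by (intro sum.cong) auto
  also have "\<dots> = complex_of_real (sqn v)" using assms(2) by (simp add: of_real_sqn)
  finally show ?thesis using of_real_eq_iff by blast
qed

lemma sqn_smult: "sqn (c \<cdot>\<^sub>v v) = (cmod c)\<^sup>2 * sqn v"
  by (simp add: sqn_def sum_distrib_left norm_mult power_mult_distrib)

lemma parallelogram:
  assumes "a \<in> carrier_vec n" "b \<in> carrier_vec n"
  shows "sqn (a + b) \<le> 2 * (sqn a + sqn b)"
proof -
  have "(cmod (x + y))\<^sup>2 \<le> 2 * ((cmod x)\<^sup>2 + (cmod y)\<^sup>2)" for x y
  proof -
    have "(cmod (x + y))\<^sup>2 \<le> (cmod x + cmod y)\<^sup>2" by (intro power_mono norm_triangle_ineq) auto
    also have "\<dots> \<le> 2 * ((cmod x)\<^sup>2 + (cmod y)\<^sup>2)"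
      using sum_squares_bound[of "cmod x" "cmod y"] by (simp add: power2_eq_square algebra_simps)
    finally show ?thesis .
  qed
  then have "(\<Sum>i<n. (cmod (a $ i + b $ i))\<^sup>2) \<le> (\<Sum>i<n. 2 * ((cmod (a $ i))\<^sup>2 + (cmod (b $ i))\<^sup>2))"
    by (intro sum_mono)
  also have "\<dots> = 2 * (sqn a + sqn b)"
    using assms unfolding sqn_def by (subst sum_distrib_left[symmetric]) (simp add: sum.distrib)
  finally show ?thesis using assms by (simp add: sqn_def)
qed

text \<open>The difference of the squares is the real part of (x - y) times the conjugate of x + y;
  the inequality of arithmetic and geometric means with weight \<open>s\<close> then separates the
  two factors.\<close>

lemma cmod_sq_diff_le:
  assumes "s > 0"
  shows "\<bar>(cmod x)\<^sup>2 - (cmod y)\<^sup>2\<bar> \<le> (s * (cmod (x - y))\<^sup>2 + (cmod (x + y))\<^sup>2 / s) / 2"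
proof -
  have "(cmod x)\<^sup>2 - (cmod y)\<^sup>2 = Re ((x - y) * cnj (x + y))"
    unfolding cmod_power2 by (simp add: power2_eq_square algebra_simps)
  then have "\<bar>(cmod x)\<^sup>2 - (cmod y)\<^sup>2\<bar> \<le> cmod (x - y) * cmod (x + y)"
    by (metis abs_Re_le_cmod complex_mod_cnj norm_mult)
  also have "2 * (cmod (x - y) * cmod (x + y)) \<le> s * (cmod (x - y))\<^sup>2 + (cmod (x + y))\<^sup>2 / s"
  proof -
    have "0 \<le> (s * cmod (x - y) - cmod (x + y))\<^sup>2 / s" using assms by simp
    also have "\<dots> = s * (cmod (x - y))\<^sup>2 + (cmod (x + y))\<^sup>2 / s - 2 * (cmod (x - y) * cmod (x + y))"
      using assms by (simp add: power2_eq_square field_simps)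
    finally show ?thesis by simp
  qed
  finally show ?thesis by simp
qed

abbreviation polar_bound :: "real \<Rightarrow> complex vec \<Rightarrow> complex vec \<Rightarrow> real" where
  "polar_bound s a b \<equiv> (s * sqn (a - b) + sqn (a + b) / s) / 2"

lemma sqn_diff_le:
  assumes "s > 0" "a \<in> carrier_vec n" "b \<in> carrier_vec n"
  shows "\<bar>sqn a - sqn b\<bar> \<le> polar_bound s a b"
proof -
  have "\<bar>sqn a - sqn b\<bar> \<le> (\<Sum>i<n. \<bar>(cmod (a $ i))\<^sup>2 - (cmod (b $ i))\<^sup>2\<bar>)"
    using assms unfolding sqn_def by (simp add: sum_subtractf[symmetric] sum_abs)
  also have "\<dots> \<le> (\<Sum>i<n. (s * (cmod (a $ i - b $ i))\<^sup>2 + (cmod (a $ i + b $ i))\<^sup>2 / s) / 2)"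
    by (intro sum_mono cmod_sq_diff_le assms)
  also have "\<dots> = polar_bound s a b"
    using assms unfolding sqn_def
    by (subst sum_divide_distrib[symmetric], subst sum.distrib,
        subst sum_distrib_left[symmetric], subst sum_divide_distrib[symmetric]) simp
  finally show ?thesis .
qed

text \<open>By linearity the contraction acts on \<open>a - b\<close> and on \<open>a + b\<close>
  separately, so neither queries nor the accepting measurement operator can increase the
  bound.\<close>

lemma polar_bound_contraction:
  assumes M: "M \<in> carrier_mat n n" "\<And>x. x \<in> carrier_vec n \<Longrightarrow> sqn (M *\<^sub>v x) \<le> sqn x"
    and s: "s > 0" and ab: "a \<in> carrier_vec n" "b \<in> carrier_vec n"
  shows "polar_bound s (M *\<^sub>v a) (M *\<^sub>v b) \<le> polar_bound s a b"
proof -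
  have "polar_bound s (M *\<^sub>v a) (M *\<^sub>v b) = (s * sqn (M *\<^sub>v (a - b)) + sqn (M *\<^sub>v (a + b)) / s) / 2"
    using ab by (simp add: mult_minus_distrib_mat_vec[OF M(1)] mult_add_distrib_mat_vec[OF M(1)])
  also have "\<dots> \<le> polar_bound s a b"
    using ab s by (intro divide_right_mono add_mono mult_left_mono M(2)) auto
  finally show ?thesis .
qed

section \<open>Stability of the acceptance probability\<close>

text \<open>The unnormalised pure state of \<open>v\<close>. Kraus operators send pure states to
  sums of pure states, so all estimates can be made on vectors and positivity of density matrices
  never has to be discussed.\<close>

definition outer :: "complex vec \<Rightarrow> complex mat" where
  "outer v = Matrix.mat (dim_vec v) (dim_vec v) (\<lambda>(i, j). v $ i * cnj (v $ j))"

lemma outer_carrier [simp]: "v \<in> carrier_vec n \<Longrightarrow> outer v \<in> carrier_mat n n"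
  by (simp add: outer_def)

lemma conj_outer:
  assumes "B \<in> carrier_mat m n" "v \<in> carrier_vec n"
  shows "B * outer v * mat_adjoint B = outer (B *\<^sub>v v)"
proof (rule eq_matI)
  fix i j assume "i < dim_row (outer (B *\<^sub>v v))" "j < dim_col (outer (B *\<^sub>v v))"
  then have ij: "i < m" "j < m" using assms by (auto simp: outer_def)
  have "(B * outer v * mat_adjoint B) $$ (i, j)
      = (\<Sum>l<n. (\<Sum>k<n. B $$ (i, k) * (v $ k * cnj (v $ l))) * cnj (B $$ (j, l)))"
    using assms ij
    by (subst times_index[of _ m n _ m])
      (auto simp: times_index[of _ m n _ n] outer_def simp del: index_mult_mat(1) intro!: sum.cong)
  also have "\<dots> = (\<Sum>k<n. B $$ (i, k) * v $ k) * (\<Sum>l<n. cnj (B $$ (j, l)) * cnj (v $ l))"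
    by (subst sum_product, subst sum_distrib_right, subst sum.swap) (intro sum.cong refl, simp add: mult_ac)
  also have "\<dots> = outer (B *\<^sub>v v) $$ (i, j)"
    using assms ij by (simp add: outer_def mult_vec_index[OF assms] del: index_mult_mat_vec)
  finally show "(B * outer v * mat_adjoint B) $$ (i, j) = outer (B *\<^sub>v v) $$ (i, j)" .
qed (use assms in \<open>auto simp: outer_def\<close>)

lemma mat_trace_outer: "mat_trace (outer v) = complex_of_real (sqn v)"
  by (simp add: mat_trace_def outer_def of_real_sqn mult.commute)

lemma mat_trace_add:
  "A \<in> carrier_mat n n \<Longrightarrow> B \<in> carrier_mat n n \<Longrightarrow> mat_trace (A + B) = mat_trace A + mat_trace B"
  by (simp add: mat_trace_def sum.distrib)

lemma mat_trace_zero [simp]: "mat_trace (0\<^sub>m n n) = 0"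
  by (simp add: mat_trace_def)

lemma list_sum_mat_Nil [simp]: "list_sum_mat n [] = 0\<^sub>m n n"
  and list_sum_mat_Cons [simp]: "list_sum_mat n (A # As) = A + list_sum_mat n As"
  by (simp_all add: list_sum_mat_def)

lemma list_sum_mat_carrier [simp]:
  "set As \<subseteq> carrier_mat n n \<Longrightarrow> list_sum_mat n As \<in> carrier_mat n n"
  by (induction As) auto

lemma list_sum_mat_index:
  assumes "set As \<subseteq> carrier_mat n n" "i < n" "j < n"
  shows "list_sum_mat n As $$ (i, j) = (\<Sum>A\<leftarrow>As. A $$ (i, j))"
  using assms
proof (induction As)
  case (Cons A As)
  have "list_sum_mat n As \<in> carrier_mat n n" using Cons.prems by simp
  then have "dim_row (list_sum_mat n As) = n" "dim_col (list_sum_mat n As) = n" by auto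
  then show ?case using Cons by (simp del: list_sum_mat_carrier)
qed simp

text \<open>Completeness says that the quadratic forms of the Kraus operators add up to the
  identity: the total weight of the branches is conserved.\<close>

lemma kraus_sqn:
  assumes K: "kraus_complete n Ks" and v: "v \<in> carrier_vec n"
  shows "(\<Sum>K\<leftarrow>Ks. sqn (K *\<^sub>v v)) = sqn v"
proof -
  have carr: "set Ks \<subseteq> carrier_mat n n"
    and one: "list_sum_mat n (map (\<lambda>K. mat_adjoint K * K) Ks) = 1\<^sub>m n"
    using K by (auto simp: kraus_complete_def)
  have carr': "set (map (\<lambda>K. mat_adjoint K * K) Ks) \<subseteq> carrier_mat n n"
    using carr by (auto intro!: mult_carrier_mat)
  have entry: "(\<Sum>K\<leftarrow>Ks. (mat_adjoint K * K) $$ (i, j)) = (if i = j then 1 else 0)" if "i < n" "j < n" for i j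
    using list_sum_mat_index[OF carr' that] that unfolding one by (simp add: o_def)
  have "complex_of_real (\<Sum>K\<leftarrow>Ks. sqn (K *\<^sub>v v)) = (\<Sum>K\<leftarrow>Ks. complex_of_real (sqn (K *\<^sub>v v)))"
    by (induction Ks) auto
  also have "\<dots> = (\<Sum>K\<leftarrow>Ks. \<Sum>i<n. \<Sum>j<n. cnj (v $ i) * (mat_adjoint K * K) $$ (i, j) * v $ j)"
    using carr v by (intro arg_cong[of _ _ sum_list] map_cong refl of_real_sqn_mult) auto
  also have "\<dots> = (\<Sum>i<n. \<Sum>j<n. cnj (v $ i) * (\<Sum>K\<leftarrow>Ks. (mat_adjoint K * K) $$ (i, j)) * v $ j)"
    by (induction Ks) (simp_all add: sum.distrib algebra_simps)
  also have "\<dots> = (\<Sum>i<n. \<Sum>j<n. if i = j then cnj (v $ i) * v $ j else 0)"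
    by (intro sum.cong refl) (simp add: entry)
  also have "\<dots> = complex_of_real (sqn v)" using v by (simp add: of_real_sqn)
  finally show ?thesis using of_real_eq_iff by blast
qed

lemma apply_kraus_carrier [simp]:
  "set Ks \<subseteq> carrier_mat n n \<Longrightarrow> \<rho> \<in> carrier_mat n n \<Longrightarrow> apply_kraus n Ks \<rho> \<in> carrier_mat n n"
  unfolding apply_kraus_def by (rule list_sum_mat_carrier) (auto intro!: mult_carrier_mat[of _ n n])

lemma conj_add:
  assumes "A \<in> carrier_mat n n" "\<rho> \<in> carrier_mat n n" "\<sigma> \<in> carrier_mat n n"
  shows "A * (\<rho> + \<sigma>) * mat_adjoint A = A * \<rho> * mat_adjoint A + A * \<sigma> * mat_adjoint A"
proof -
  have "A * (\<rho> + \<sigma>) = A * \<rho> + A * \<sigma>" using assms by (rule mult_add_distrib_mat)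
  then show ?thesis using assms
    by (simp add: add_mult_distrib_mat[of "A * \<rho>" n n "A * \<sigma>" "mat_adjoint A" n])
qed

lemma apply_kraus_add:
  assumes "set Ks \<subseteq> carrier_mat n n" "\<rho> \<in> carrier_mat n n" "\<sigma> \<in> carrier_mat n n"
  shows "apply_kraus n Ks (\<rho> + \<sigma>) = apply_kraus n Ks \<rho> + apply_kraus n Ks \<sigma>"
  using assms(1)
proof (induction Ks)
  case Nil
  then show ?case by (simp add: apply_kraus_def)
next
  case (Cons K Ks)
  have K: "K \<in> carrier_mat n n" and IH: "apply_kraus n Ks (\<rho> + \<sigma>) = apply_kraus n Ks \<rho> + apply_kraus n Ks \<sigma>"
    using Cons by auto
  have c: "apply_kraus n Ks \<rho> \<in> carrier_mat n n" "apply_kraus n Ks \<sigma> \<in> carrier_mat n n"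
    using Cons.prems assms by auto
  have d: "K * \<rho> * mat_adjoint K \<in> carrier_mat n n" "K * \<sigma> * mat_adjoint K \<in> carrier_mat n n"
    using K assms by (auto intro!: mult_carrier_mat[of _ n n])
  have step: "apply_kraus n (K # Ks) \<tau> = K * \<tau> * mat_adjoint K + apply_kraus n Ks \<tau>" for \<tau>
    by (simp add: apply_kraus_def)
  show ?case unfolding step IH conj_add[OF K assms(2,3)]
    by (rule eq_matI) (use c d in auto)
qed

lemma apply_kraus_zero:
  "set Ks \<subseteq> carrier_mat n n \<Longrightarrow> apply_kraus n Ks (0\<^sub>m n n) = 0\<^sub>m n n"
  by (induction Ks) (auto simp: apply_kraus_def)

lemma apply_kraus_outer:
  assumes "set Ks \<subseteq> carrier_mat n n" "v \<in> carrier_vec n"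
  shows "apply_kraus n Ks (outer v) = list_sum_mat n (map (\<lambda>K. outer (K *\<^sub>v v)) Ks)"
  unfolding apply_kraus_def using assms
  by (intro arg_cong[of _ _ "list_sum_mat n"] map_cong refl conj_outer) auto

section \<open>Operators tensored with the identity on the ancillas\<close>

lemma kronecker_one_carrier:
  "B \<in> carrier_mat N N \<Longrightarrow> kronecker B (1\<^sub>m M) \<in> carrier_mat (N * M) (N * M)"
  by (simp add: kronecker_def)

lemma bij_betw_digits:
  "bij_betw (\<lambda>(a, b). a * M + b) ({..<N} \<times> {..<M}) {..<N * M :: nat}"
proof (intro bij_betwI[where g = "\<lambda>i. (i div M, i mod M)"])
  show "(\<lambda>(a, b). a * M + b) \<in> {..<N} \<times> {..<M} \<rightarrow> {..<N * M}"
  proof clarsimp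
    fix a b assume "a < N" "b < M"
    then have "a * M + b < Suc a * M" by simp
    also have "\<dots> \<le> N * M" using \<open>a < N\<close> by (intro mult_right_mono) auto
    finally show "a * M + b < N * M" .
  qed
  show "(\<lambda>i. (i div M, i mod M)) \<in> {..<N * M} \<rightarrow> {..<N} \<times> {..<M}"
    by (cases "M = 0") (auto simp: less_mult_imp_div_less)
qed auto

lemma sum_digits:
  fixes f :: "nat \<Rightarrow> 'a :: comm_monoid_add"
  shows "(\<Sum>i<N * M. f i) = (\<Sum>b<M. \<Sum>a<N. f (a * M + b))"
  unfolding sum.reindex_bij_betw[OF bij_betw_digits, symmetric] 
  by (subst sum.swap, subst sum.cartesian_product) (simp add: case_prod_unfold)

lemma digit_less: "a < N \<Longrightarrow> b < M \<Longrightarrow> a * M + b < N * (M :: nat)"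
  using bij_betwE[OF bij_betw_digits[of M N]] by force

text \<open>The component of \<open>v\<close> in which the ancillas are in basis state
  \<open>b\<close>. In \<open>kronecker B (1\<^sub>m M)\<close> the ancilla index is the low-order
  digit, hence the stride \<open>M\<close>.\<close>

definition register_slice :: "nat \<Rightarrow> nat \<Rightarrow> complex vec \<Rightarrow> nat \<Rightarrow> complex vec" where
  "register_slice N M v b = Matrix.vec N (\<lambda>a. v $ (a * M + b))"

lemma register_slice_carrier [simp]: "register_slice N M v b \<in> carrier_vec N"
  by (simp add: register_slice_def)

lemma sqn_slices:
  assumes "v \<in> carrier_vec (N * M)"
  shows "sqn v = (\<Sum>b<M. sqn (register_slice N M v b))"
  using assms by (simp add: sqn_def sum_digits register_slice_def)

lemma kronecker_one_slice:
  assumes "B \<in> carrier_mat N N" "v \<in> carrier_vec (N * M)" "b < M"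
  shows "register_slice N M (kronecker B (1\<^sub>m M) *\<^sub>v v) b = B *\<^sub>v register_slice N M v b"
proof (rule eq_vecI)
  fix a assume "a < dim_vec (B *\<^sub>v register_slice N M v b)"
  then have a: "a < N" using assms by auto
  have "register_slice N M (kronecker B (1\<^sub>m M) *\<^sub>v v) b $ a
      = (\<Sum>k<N * M. kronecker B (1\<^sub>m M) $$ (a * M + b, k) * v $ k)"
    using a digit_less[OF a assms(3)] mult_vec_index[OF kronecker_one_carrier[OF assms(1)] assms(2)]
    by (simp add: register_slice_def del: index_mult_mat_vec)
  also have "\<dots> = (\<Sum>c<M. \<Sum>d<N. if c = b then B $$ (a, d) * v $ (d * M + b) else 0)"
    unfolding sum_digits using assms a digit_less[OF a assms(3)]
    by (intro sum.cong refl) (auto simp: kronecker_def digit_less)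
  also have "\<dots> = (\<Sum>d<N. B $$ (a, d) * v $ (d * M + b))"
    using assms(3) by (subst sum.swap) simp
  also have "\<dots> = (B *\<^sub>v register_slice N M v b) $ a"
    by (subst mult_vec_index[OF assms(1) register_slice_carrier a]) (simp add: register_slice_def)
  finally show "register_slice N M (kronecker B (1\<^sub>m M) *\<^sub>v v) b $ a = (B *\<^sub>v register_slice N M v b) $ a" .
qed (use assms in \<open>simp add: register_slice_def\<close>)

text \<open>The operator acts as \<open>B\<close> on each slice, and the squared norm is the sum
  over the slices. Operator norms are expressed throughout by such inequalities for all vectors,
  with \<open>c\<close> the square of the norm.\<close>

lemma sqn_kronecker_one_le:
  assumes "B \<in> carrier_mat N N" "v \<in> carrier_vec (N * M)"
    and "\<And>y. y \<in> carrier_vec N \<Longrightarrow> sqn (B *\<^sub>v y) \<le> c * sqn y"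
  shows "sqn (kronecker B (1\<^sub>m M) *\<^sub>v v) \<le> c * sqn v"
proof -
  have "sqn (kronecker B (1\<^sub>m M) *\<^sub>v v) = (\<Sum>b<M. sqn (B *\<^sub>v register_slice N M v b))"
    using assms(1,2) kronecker_one_carrier[OF assms(1), of M]
    by (subst sqn_slices[of _ N M]) (auto simp: kronecker_one_slice intro!: mult_mat_vec_carrier)
  also have "\<dots> \<le> (\<Sum>b<M. c * sqn (register_slice N M v b))"
    by (intro sum_mono assms) simp
  also have "\<dots> = c * sqn v" unfolding sqn_slices[OF assms(2)] by (simp add: sum_distrib_left)
  finally show ?thesis .
qed


section \<open>Acceptance as a function of the intermediate state\<close>

text \<open>The start matrix and the remaining rounds are left free, so that inductions can peel off
  the earliest round. Additivity in the start matrix then allows each branch of that round to be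
  treated alone.\<close>

definition accept_from ::
  "nat \<Rightarrow> query_algorithm \<Rightarrow> complex mat \<Rightarrow> (direction \<times> complex mat) list list \<Rightarrow> complex mat \<Rightarrow> real"
where
  "accept_from n A U Rs \<rho> = Re (mat_trace (accept_op A *
     apply_kraus (total_dim n A) (final_op A) (fold (run_round n A U) Rs \<rho>) * mat_adjoint (accept_op A)))"

lemma query_op_carrier:
  "U \<in> carrier_mat (2 ^ n) (2 ^ n) \<Longrightarrow> query_op A U d \<in> carrier_mat (total_dim n A) (total_dim n A)"
  unfolding query_op_def total_dim_def by (cases d) (auto intro!: kronecker_one_carrier)

lemma sqn_query_op:
  assumes "U \<in> unitary_group (2 ^ n)" "v \<in> carrier_vec (total_dim n A)"
  shows "sqn (query_op A U d *\<^sub>v v) \<le> sqn v"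
proof -
  let ?B = "case d of Forward \<Rightarrow> U | Inverse \<Rightarrow> mat_adjoint U"
  have B: "?B \<in> unitary_group (2 ^ n)"
    using assms(1) unitary_group_adjoint by (cases d) auto
  have "sqn (kronecker ?B (1\<^sub>m (2 ^ ancillas A)) *\<^sub>v v) \<le> 1 * sqn v"
    using assms(2) unitary_groupD(1)[OF B]
    by (intro sqn_kronecker_one_le[of _ "2 ^ n"]) (auto simp: total_dim_def sqn_unitary[OF B])
  then show ?thesis by (simp add: query_op_def)
qed

lemma kronecker_diff:
  assumes "A \<in> carrier_mat N N" "B \<in> carrier_mat N N"
  shows "kronecker A (1\<^sub>m M) - kronecker B (1\<^sub>m M) = kronecker (A - B) (1\<^sub>m M)"
  using assms by (intro eq_matI) (auto simp: kronecker_def less_mult_imp_div_less algebra_simps)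

locale valid_query_algorithm =
  fixes n :: nat and A :: query_algorithm
  assumes valid: "valid_algorithm n A"
begin

abbreviation "D \<equiv> total_dim n A"

abbreviation "valid_rounds Rs \<equiv> \<forall>R \<in> set Rs. kraus_complete D (map snd R)"

lemma accept_carrier: "accept_op A \<in> carrier_mat D D"
  and final_carrier: "set (final_op A) \<subseteq> carrier_mat D D"
  using valid by (auto simp: valid_algorithm_def kraus_complete_def)

lemma sqn_accept: "v \<in> carrier_vec D \<Longrightarrow> sqn (accept_op A *\<^sub>v v) \<le> sqn v"
  using kraus_sqn[of D "[accept_op A, reject_op A]" v] valid sqn_nonneg[of "reject_op A *\<^sub>v v"]
  by (simp add: valid_algorithm_def del: sqn_nonneg)

lemma round_carrier:
  assumes "U \<in> carrier_mat (2 ^ n) (2 ^ n)" "kraus_complete D (map snd R)"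
  shows "set (map (\<lambda>(d, K). query_op A U d * K) R) \<subseteq> carrier_mat D D"
  using assms query_op_carrier[OF assms(1)]
  by (auto simp: kraus_complete_def intro!: mult_carrier_mat[of _ D D])

lemma run_round_carrier:
  assumes "U \<in> carrier_mat (2 ^ n) (2 ^ n)" "kraus_complete D (map snd R)" "\<rho> \<in> carrier_mat D D"
  shows "run_round n A U R \<rho> \<in> carrier_mat D D"
  unfolding run_round_def using round_carrier[OF assms(1,2)] assms(3) by (intro apply_kraus_carrier)

lemma fold_carrier:
  assumes "U \<in> carrier_mat (2 ^ n) (2 ^ n)" "valid_rounds Rs" "\<rho> \<in> carrier_mat D D"
  shows "fold (run_round n A U) Rs \<rho> \<in> carrier_mat D D"
  using assms by (induction Rs arbitrary: \<rho>) (auto simp: run_round_carrier)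

lemma fold_add:
  assumes "U \<in> carrier_mat (2 ^ n) (2 ^ n)" "valid_rounds Rs" "\<rho> \<in> carrier_mat D D" "\<sigma> \<in> carrier_mat D D"
  shows "fold (run_round n A U) Rs (\<rho> + \<sigma>) = fold (run_round n A U) Rs \<rho> + fold (run_round n A U) Rs \<sigma>"
  using assms
proof (induction Rs arbitrary: \<rho> \<sigma>)
  case (Cons R Rs)
  have "run_round n A U R (\<rho> + \<sigma>) = run_round n A U R \<rho> + run_round n A U R \<sigma>"
    unfolding run_round_def using round_carrier[of U R] Cons.prems by (intro apply_kraus_add) auto
  then show ?case using Cons by (simp add: run_round_carrier)
qed simp

lemma fold_zero:
  assumes "U \<in> carrier_mat (2 ^ n) (2 ^ n)" "valid_rounds Rs"
  shows "fold (run_round n A U) Rs (0\<^sub>m D D) = 0\<^sub>m D D"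
  using assms
proof (induction Rs)
  case (Cons R Rs)
  have "run_round n A U R (0\<^sub>m D D) = 0\<^sub>m D D"
    unfolding run_round_def using round_carrier[of U R] Cons.prems by (intro apply_kraus_zero) auto
  then show ?case using Cons by simp
qed simp

lemma accept_from_add:
  assumes "U \<in> carrier_mat (2 ^ n) (2 ^ n)" "valid_rounds Rs" "\<rho> \<in> carrier_mat D D" "\<sigma> \<in> carrier_mat D D"
  shows "accept_from n A U Rs (\<rho> + \<sigma>) = accept_from n A U Rs \<rho> + accept_from n A U Rs \<sigma>"
proof -
  have c: "apply_kraus D (final_op A) (fold (run_round n A U) Rs \<tau>) \<in> carrier_mat D D"
    if "\<tau> \<in> carrier_mat D D" for \<tau>
    using fold_carrier[OF assms(1,2) that] final_carrier by simp
  show ?thesis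
    unfolding accept_from_def fold_add[OF assms]
      apply_kraus_add[OF final_carrier fold_carrier[OF assms(1-3)] fold_carrier[OF assms(1,2,4)]]
      conj_add[OF accept_carrier c[OF assms(3)] c[OF assms(4)]]
    using accept_carrier c[OF assms(3)] c[OF assms(4)]
    by (subst mat_trace_add[of _ D]) (auto intro!: mult_carrier_mat[of _ D D])
qed

lemma accept_from_zero:
  assumes "U \<in> carrier_mat (2 ^ n) (2 ^ n)" "valid_rounds Rs"
  shows "accept_from n A U Rs (0\<^sub>m D D) = 0"
  unfolding accept_from_def fold_zero[OF assms] apply_kraus_zero[OF final_carrier]
  using accept_carrier by simp

lemma accept_from_list_sum:
  assumes "U \<in> carrier_mat (2 ^ n) (2 ^ n)" "valid_rounds Rs" "set Ms \<subseteq> carrier_mat D D"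
  shows "accept_from n A U Rs (list_sum_mat D Ms) = (\<Sum>M\<leftarrow>Ms. accept_from n A U Rs M)"
  using assms(3)
  by (induction Ms) (simp_all add: accept_from_zero[OF assms(1,2)] accept_from_add[OF assms(1,2)])

text \<open>A round splits a pure state into one pure branch per Kraus operator, each with its own
  query direction. This replaces the evolution of density matrices by a tree of vectors.\<close>

lemma accept_from_Cons:
  assumes "U \<in> carrier_mat (2 ^ n) (2 ^ n)" "valid_rounds (R # Rs)" "v \<in> carrier_vec D"
  shows "accept_from n A U (R # Rs) (outer v) =
    (\<Sum>(d, K)\<leftarrow>R. accept_from n A U Rs (outer (query_op A U d *\<^sub>v (K *\<^sub>v v))))"
proof -
  have K: "K \<in> carrier_mat D D" if "(d, K) \<in> set R" for d K
    using that assms(2) by (force simp: kraus_complete_def)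
  have "run_round n A U R (outer v) = list_sum_mat D (map (\<lambda>K. outer (K *\<^sub>v v)) (map (\<lambda>(d, K). query_op A U d * K) R))"
    unfolding run_round_def using assms by (intro apply_kraus_outer round_carrier) auto
  also have "map (\<lambda>K. outer (K *\<^sub>v v)) (map (\<lambda>(d, K). query_op A U d * K) R)
      = map (\<lambda>(d, K). outer (query_op A U d *\<^sub>v (K *\<^sub>v v))) R"
    using K query_op_carrier[OF assms(1)] assms(3)
    by (auto simp: assoc_mult_mat_vec[of _ D D _ D])
  finally have run: "run_round n A U R (outer v)
      = list_sum_mat D (map (\<lambda>(d, K). outer (query_op A U d *\<^sub>v (K *\<^sub>v v))) R)" .
  have "accept_from n A U (R # Rs) (outer v) = accept_from n A U Rs (run_round n A U R (outer v))"
    by (simp add: accept_from_def)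
  also have "\<dots> = (\<Sum>M\<leftarrow>map (\<lambda>(d, K). outer (query_op A U d *\<^sub>v (K *\<^sub>v v))) R. accept_from n A U Rs M)"
    unfolding run using assms K query_op_carrier[OF assms(1)]
    by (intro accept_from_list_sum) (auto intro!: outer_carrier mult_mat_vec_carrier[of _ D D])
  finally show ?thesis by (simp add: o_def case_prod_unfold)
qed

lemma accept_from_Nil:
  assumes "v \<in> carrier_vec D"
  shows "accept_from n A U [] (outer v) = (\<Sum>K\<leftarrow>final_op A. sqn (accept_op A *\<^sub>v (K *\<^sub>v v)))"
proof -
  have "mat_trace (accept_op A * list_sum_mat D (map (\<lambda>K. outer (K *\<^sub>v v)) Ks) * mat_adjoint (accept_op A))
      = complex_of_real (\<Sum>K\<leftarrow>Ks. sqn (accept_op A *\<^sub>v (K *\<^sub>v v)))"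
    if "set Ks \<subseteq> carrier_mat D D" for Ks
    using that
  proof (induction Ks)
    case Nil
    then show ?case using accept_carrier by simp
  next
    case (Cons K Ks)
    have Kv: "K *\<^sub>v v \<in> carrier_vec D" using Cons.prems assms by auto
    have c: "list_sum_mat D (map (\<lambda>K. outer (K *\<^sub>v v)) Ks) \<in> carrier_mat D D"
      using Cons.prems assms by (intro list_sum_mat_carrier) (auto intro!: outer_carrier mult_mat_vec_carrier[of _ D D])
    have "accept_op A * (outer (K *\<^sub>v v) + list_sum_mat D (map (\<lambda>K. outer (K *\<^sub>v v)) Ks)) * mat_adjoint (accept_op A)
        = outer (accept_op A *\<^sub>v (K *\<^sub>v v)) + accept_op A * list_sum_mat D (map (\<lambda>K. outer (K *\<^sub>v v)) Ks) * mat_adjoint (accept_op A)"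
      using conj_add[OF accept_carrier outer_carrier[OF Kv] c] conj_outer[OF accept_carrier Kv] by simp
    then show ?case using Cons accept_carrier Kv c
      by (simp add: mat_trace_outer,
          subst mat_trace_add[of _ D]) (auto simp: mat_trace_outer intro!: mult_carrier_mat[of _ D D] outer_carrier mult_mat_vec_carrier[of _ D D])
  qed
  from this[OF final_carrier] show ?thesis
    by (simp add: accept_from_def apply_kraus_outer[OF final_carrier assms])
qed

lemma sum_list_diff_le:
  fixes f g h :: "'a \<Rightarrow> real"
  assumes "\<And>x. x \<in> set xs \<Longrightarrow> \<bar>f x - g x\<bar> \<le> h x"
  shows "\<bar>(\<Sum>x\<leftarrow>xs. f x) - (\<Sum>x\<leftarrow>xs. g x)\<bar> \<le> (\<Sum>x\<leftarrow>xs. h x)"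
  using assms
proof (induction xs)
  case (Cons x xs)
  have "\<bar>f x - g x\<bar> \<le> h x" "\<bar>(\<Sum>x\<leftarrow>xs. f x) - (\<Sum>x\<leftarrow>xs. g x)\<bar> \<le> (\<Sum>x\<leftarrow>xs. h x)"
    using Cons by auto
  then show ?case unfolding list.map sum_list.Cons abs_le_iff by linarith
qed simp

lemma kraus_quadratic:
  assumes K: "kraus_complete D (map snd R)" and ab: "a \<in> carrier_vec D" "b \<in> carrier_vec D"
  shows "(\<Sum>(d, K)\<leftarrow>R. polar_bound s (K *\<^sub>v a) (K *\<^sub>v b))
    = polar_bound s a b"
proof -
  have carr: "K \<in> carrier_mat D D" if "(d, K) \<in> set R" for d K
    using that K by (force simp: kraus_complete_def)
  have "(\<Sum>(d, K)\<leftarrow>R. polar_bound s (K *\<^sub>v a) (K *\<^sub>v b))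
     = (\<Sum>(d, K)\<leftarrow>R. (s * sqn (K *\<^sub>v (a - b)) + sqn (K *\<^sub>v (a + b)) / s) / 2)"
    using ab carr
    by (intro arg_cong[of _ _ sum_list] map_cong refl)
      (auto simp: mult_minus_distrib_mat_vec[of _ D D] mult_add_distrib_mat_vec[of _ D D])
  also have "\<dots> = (s * (\<Sum>K\<leftarrow>map snd R. sqn (K *\<^sub>v (a - b))) + (\<Sum>K\<leftarrow>map snd R. sqn (K *\<^sub>v (a + b))) / s) / 2"
    by (induction R) (auto simp: add_divide_distrib distrib_left)
  also have "\<dots> = polar_bound s a b"
    using kraus_sqn[OF K, of "a - b"] kraus_sqn[OF K, of "a + b"] ab by simp
  finally show ?thesis .
qed

text \<open>
  A Cauchy-Schwarz estimate with a free scale \<open>s\<close>: in this form it is linear in squared norms, so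
  that summation over Kraus operators preserves it without loss.
\<close>

lemma accept_from_quadratic:
  assumes U: "U \<in> unitary_group (2 ^ n)" and "valid_rounds Rs" and s: "s > 0"
    and "a \<in> carrier_vec D" "b \<in> carrier_vec D"
  shows "\<bar>accept_from n A U Rs (outer a) - accept_from n A U Rs (outer b)\<bar>
    \<le> polar_bound s a b"
  using assms(2,4,5)
proof (induction Rs arbitrary: a b)
  case Nil
  \<comment> \<open>The labels are dummies: they give the final operation the format of a round, so
    that \<open>kraus_quadratic\<close> covers it too.\<close>
  let ?R = "map (Pair Forward) (final_op A)"
  have R: "map snd ?R = final_op A" by (simp add: o_def)
  have "\<bar>accept_from n A U [] (outer a) - accept_from n A U [] (outer b)\<bar>
      \<le> (\<Sum>K\<leftarrow>final_op A. polar_bound s (K *\<^sub>v a) (K *\<^sub>v b))"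
    unfolding accept_from_Nil[OF Nil(2)] accept_from_Nil[OF Nil(3)]
  proof (rule sum_list_diff_le)
    fix K assume "K \<in> set (final_op A)"
    then have K: "K *\<^sub>v a \<in> carrier_vec D" "K *\<^sub>v b \<in> carrier_vec D"
      using final_carrier Nil by auto
    let ?M = "accept_op A"
    have "\<bar>sqn (?M *\<^sub>v (K *\<^sub>v a)) - sqn (?M *\<^sub>v (K *\<^sub>v b))\<bar>
        \<le> polar_bound s (?M *\<^sub>v (K *\<^sub>v a)) (?M *\<^sub>v (K *\<^sub>v b))"
      using s accept_carrier K by (intro sqn_diff_le[of _ _ D]) auto
    also have "\<dots> \<le> polar_bound s (K *\<^sub>v a) (K *\<^sub>v b)"
      using K s by (intro polar_bound_contraction[OF accept_carrier sqn_accept]) auto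
    finally show "\<bar>sqn (?M *\<^sub>v (K *\<^sub>v a)) - sqn (?M *\<^sub>v (K *\<^sub>v b))\<bar>
        \<le> polar_bound s (K *\<^sub>v a) (K *\<^sub>v b)" .
  qed
  also have "\<dots> = polar_bound s a b"
    using kraus_quadratic[of ?R a b s] Nil valid unfolding R by (simp add: o_def valid_algorithm_def)
  finally show ?case .
next
  case (Cons R Rs)
  note Uc = unitary_groupD(1)[OF U]
  have R: "kraus_complete D (map snd R)" using Cons.prems by simp
  have "\<bar>accept_from n A U (R # Rs) (outer a) - accept_from n A U (R # Rs) (outer b)\<bar>
      \<le> (\<Sum>(d, K)\<leftarrow>R. polar_bound s (K *\<^sub>v a) (K *\<^sub>v b))"
    unfolding accept_from_Cons[OF Uc Cons.prems(1,2)] accept_from_Cons[OF Uc Cons.prems(1,3)]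
  proof (rule sum_list_diff_le, clarify)
    fix d K assume "(d, K) \<in> set R"
    then have "K \<in> carrier_mat D D" using R by (force simp: kraus_complete_def)
    then have K: "K *\<^sub>v a \<in> carrier_vec D" "K *\<^sub>v b \<in> carrier_vec D"
      using Cons.prems by auto
    let ?Q = "query_op A U d"
    have Q: "?Q \<in> carrier_mat D D" by (rule query_op_carrier[OF Uc])
    have "\<bar>accept_from n A U Rs (outer (?Q *\<^sub>v (K *\<^sub>v a))) - accept_from n A U Rs (outer (?Q *\<^sub>v (K *\<^sub>v b)))\<bar>
        \<le> polar_bound s (?Q *\<^sub>v (K *\<^sub>v a)) (?Q *\<^sub>v (K *\<^sub>v b))"
      using Cons.prems K Q by (intro Cons.IH) auto
    also have "\<dots> \<le> polar_bound s (K *\<^sub>v a) (K *\<^sub>v b)"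
      using K s by (intro polar_bound_contraction[OF Q sqn_query_op[OF U]]) auto
    finally show "\<bar>accept_from n A U Rs (outer (?Q *\<^sub>v (K *\<^sub>v a))) - accept_from n A U Rs (outer (?Q *\<^sub>v (K *\<^sub>v b)))\<bar>
        \<le> polar_bound s (K *\<^sub>v a) (K *\<^sub>v b)" .
  qed
  also have "\<dots> = polar_bound s a b"
    by (rule kraus_quadratic[OF R Cons.prems(2,3)])
  finally show ?case .
qed

text \<open>The hybrid argument: exchanging \<open>U\<close> for \<open>U'\<close> one query at a
  time costs at most 2 \<delta> times the weight of the state per query. Closeness of the adjoints
  is a separate assumption because the label of a branch decides which of the two operators is
  applied.\<close>

lemma accept_from_hybrid:
  assumes U: "U \<in> unitary_group (2 ^ n)" and U': "U' \<in> unitary_group (2 ^ n)"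
    and \<delta>: "\<delta> > 0"
    and near: "\<And>y. y \<in> carrier_vec (2 ^ n) \<Longrightarrow> sqn ((U - U') *\<^sub>v y) \<le> \<delta>\<^sup>2 * sqn y"
    and near': "\<And>y. y \<in> carrier_vec (2 ^ n) \<Longrightarrow> sqn ((mat_adjoint U - mat_adjoint U') *\<^sub>v y) \<le> \<delta>\<^sup>2 * sqn y"
    and "valid_rounds Rs" "v \<in> carrier_vec D"
  shows "\<bar>accept_from n A U Rs (outer v) - accept_from n A U' Rs (outer v)\<bar> \<le> 2 * \<delta> * length Rs * sqn v"
  using assms(6,7)
proof (induction Rs arbitrary: v)
  case Nil
  then show ?case by (simp add: accept_from_Nil)
next
  case (Cons R Rs)
  note Uc = unitary_groupD(1)[OF U] and Uc' = unitary_groupD(1)[OF U']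
  have R: "kraus_complete D (map snd R)" using Cons.prems by simp
  have query_near: "sqn (query_op A U d *\<^sub>v w - query_op A U' d *\<^sub>v w) \<le> \<delta>\<^sup>2 * sqn w"
    if w: "w \<in> carrier_vec D" for d w
  proof -
    let ?B = "\<lambda>U. case d of Forward \<Rightarrow> U | Inverse \<Rightarrow> mat_adjoint U"
    have B: "?B U \<in> carrier_mat (2 ^ n) (2 ^ n)" "?B U' \<in> carrier_mat (2 ^ n) (2 ^ n)"
      using Uc Uc' by (cases d; simp)+
    have "query_op A U d *\<^sub>v w - query_op A U' d *\<^sub>v w = (query_op A U d - query_op A U' d) *\<^sub>v w"
      using w by (intro minus_mult_distrib_mat_vec[symmetric, of _ D D] query_op_carrier Uc Uc')
    also have "\<dots> = kronecker (?B U - ?B U') (1\<^sub>m (2 ^ ancillas A)) *\<^sub>v w"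
      unfolding query_op_def kronecker_diff[OF B] ..
    also have "sqn \<dots> \<le> \<delta>\<^sup>2 * sqn w"
    proof (rule sqn_kronecker_one_le[of _ "2 ^ n"])
      show "w \<in> carrier_vec (2 ^ n * 2 ^ ancillas A)" using w by (simp add: total_dim_def)
      show "?B U - ?B U' \<in> carrier_mat (2 ^ n) (2 ^ n)" by (rule minus_carrier_mat[OF B(2)])
      show "sqn ((?B U - ?B U') *\<^sub>v y) \<le> \<delta>\<^sup>2 * sqn y" if "y \<in> carrier_vec (2 ^ n)" for y
        using near[OF that] near'[OF that] by (cases d) auto
    qed
    finally show ?thesis .
  qed
  have "\<bar>accept_from n A U (R # Rs) (outer v) - accept_from n A U' (R # Rs) (outer v)\<bar>
      \<le> (\<Sum>(d, K)\<leftarrow>R. 2 * \<delta> * length (R # Rs) * sqn (K *\<^sub>v v))"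
    unfolding accept_from_Cons[OF Uc Cons.prems] accept_from_Cons[OF Uc' Cons.prems]
  proof (rule sum_list_diff_le, clarify)
    fix d K assume "(d, K) \<in> set R"
    then have "K \<in> carrier_mat D D" using R by (force simp: kraus_complete_def)
    then have K: "K *\<^sub>v v \<in> carrier_vec D" using Cons.prems by auto
    define w where "w = K *\<^sub>v v"
    define a where "a = query_op A U d *\<^sub>v w"
    define b where "b = query_op A U' d *\<^sub>v w"
    have a: "a \<in> carrier_vec D" and b: "b \<in> carrier_vec D"
      unfolding a_def b_def w_def
      by (rule mult_mat_vec_carrier[OF query_op_carrier[OF Uc] K], rule mult_mat_vec_carrier[OF query_op_carrier[OF Uc'] K])
    have aw: "sqn a \<le> sqn w" and bw: "sqn b \<le> sqn w"
      using sqn_query_op[OF U] sqn_query_op[OF U'] K by (auto simp: a_def b_def w_def)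
    \<comment> \<open>The intermediate hybrid makes the present query with \<open>U\<close> and all
      later ones with \<open>U'\<close>. The induction hypothesis handles the later queries;
      replacing \<open>a\<close> by \<open>b\<close> under \<open>U'\<close> handles the present
      one.\<close>
    have "\<bar>accept_from n A U Rs (outer a) - accept_from n A U' Rs (outer a)\<bar> \<le> 2 * \<delta> * length Rs * sqn a"
      using Cons.prems a by (intro Cons.IH) auto
    also have "\<dots> \<le> 2 * \<delta> * length Rs * sqn w"
      using \<delta> aw by (intro mult_left_mono) auto
    finally have 1: "\<bar>accept_from n A U Rs (outer a) - accept_from n A U' Rs (outer a)\<bar> \<le> 2 * \<delta> * length Rs * sqn w" .
    \<comment> \<open>The scale 2 / \<delta> balances the two terms: with norms \<delta> for the
      difference and 2 for the sum, each contributes \<delta> times the weight of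
      \<open>w\<close>.\<close>
    have "\<bar>accept_from n A U' Rs (outer a) - accept_from n A U' Rs (outer b)\<bar>
        \<le> ((2 / \<delta>) * sqn (a - b) + sqn (a + b) / (2 / \<delta>)) / 2"
      using Cons.prems a b \<delta> by (intro accept_from_quadratic U') auto
    also have "\<dots> \<le> ((2 / \<delta>) * (\<delta>\<^sup>2 * sqn w) + (4 * sqn w) / (2 / \<delta>)) / 2"
      using parallelogram[OF a b] aw bw \<delta> query_near[OF K, of d]
      by (intro divide_right_mono add_mono mult_left_mono) (auto simp: a_def b_def w_def)
    also have "\<dots> = 2 * \<delta> * sqn w" using \<delta> by (simp add: field_simps power2_eq_square)
    finally have 2: "\<bar>accept_from n A U' Rs (outer a) - accept_from n A U' Rs (outer b)\<bar> \<le> 2 * \<delta> * sqn w" .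
    have "2 * \<delta> * length (R # Rs) * sqn w = 2 * \<delta> * length Rs * sqn w + 2 * \<delta> * sqn w"
      by (simp add: algebra_simps)
    with 1 2 have "\<bar>accept_from n A U Rs (outer a) - accept_from n A U' Rs (outer b)\<bar> \<le> 2 * \<delta> * length (R # Rs) * sqn w"
      by linarith
    then show "\<bar>accept_from n A U Rs (outer (query_op A U d *\<^sub>v (K *\<^sub>v v)))
        - accept_from n A U' Rs (outer (query_op A U' d *\<^sub>v (K *\<^sub>v v)))\<bar> \<le> 2 * \<delta> * length (R # Rs) * sqn (K *\<^sub>v v)"
      by (simp only: a_def b_def w_def)
  qed
  also have "\<dots> = 2 * \<delta> * length (R # Rs) * (\<Sum>K\<leftarrow>map snd R. sqn (K *\<^sub>v v))"
    by (induction R) (auto simp: distrib_left)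
  also have "\<dots> = 2 * \<delta> * length (R # Rs) * sqn v"
    using kraus_sqn[OF R Cons.prems(2)] by simp
  finally show ?case .
qed

lemma D_pos: "D > 0"
  by (simp add: total_dim_def)

lemma accept_prob_eq: "accept_prob n A U = accept_from n A U (rounds A) (outer (unit_vec D 0))"
proof -
  have "initial_state D = outer (unit_vec D 0)"
    by (rule eq_matI) (auto simp: initial_state_def outer_def)
  then show ?thesis by (simp add: accept_prob_def final_state_def accept_from_def)
qed

lemma sqn_unit_vec: "sqn (unit_vec D 0) = 1"
proof -
  have "sqn (unit_vec D 0) = (\<Sum>i<D. if i = 0 then 1 else 0)"
    unfolding sqn_def by (rule sum.cong) auto
  also have "\<dots> = 1" using D_pos by (subst sum.delta) auto
  finally show ?thesis .
qed

lemma valid_all_rounds: "valid_rounds (rounds A)"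
  using valid by (simp add: valid_algorithm_def)

text \<open>This is the quadratic estimate against the zero vector at scale 1, where sum and
  difference both have squared norm 1.\<close>

lemma accept_prob_bounded:
  assumes "U \<in> unitary_group (2 ^ n)"
  shows "\<bar>accept_prob n A U\<bar> \<le> 1"
proof -
  have "outer (0\<^sub>v D) = 0\<^sub>m D D" by (intro eq_matI) (auto simp: outer_def)
  then have "accept_from n A U (rounds A) (outer (0\<^sub>v D)) = 0"
    using accept_from_zero[OF unitary_groupD(1)[OF assms] valid_all_rounds] by simp
  moreover have "unit_vec D 0 - 0\<^sub>v D = (unit_vec D 0 :: complex Matrix.vec)" "unit_vec D 0 + 0\<^sub>v D = (unit_vec D 0 :: complex Matrix.vec)"
    by (auto intro!: eq_vecI)
  ultimately show ?thesis
    using accept_from_quadratic[OF assms valid_all_rounds, of 1 "unit_vec D 0" "0\<^sub>v D"]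
    by (simp add: accept_prob_eq sqn_unit_vec)
qed

theorem accept_prob_hybrid:
  assumes "U \<in> unitary_group (2 ^ n)" "U' \<in> unitary_group (2 ^ n)" "\<delta> > 0"
    and "\<And>y. y \<in> carrier_vec (2 ^ n) \<Longrightarrow> sqn ((U - U') *\<^sub>v y) \<le> \<delta>\<^sup>2 * sqn y"
    and "\<And>y. y \<in> carrier_vec (2 ^ n) \<Longrightarrow> sqn ((mat_adjoint U - mat_adjoint U') *\<^sub>v y) \<le> \<delta>\<^sup>2 * sqn y"
  shows "\<bar>accept_prob n A U - accept_prob n A U'\<bar> \<le> 2 * \<delta> * num_queries A"
  using accept_from_hybrid[OF assms valid_all_rounds, of "unit_vec D 0"]
  by (simp add: accept_prob_eq sqn_unit_vec num_queries_def)

end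

section \<open>Haar integration\<close>

text \<open>Intermediate matrices such as states and Kraus products are not unitary, so they do not
  map into the measure space of the group. The dimensions are included because the entries of a
  product are polynomials only once they are fixed.\<close>

definition measurable_mat :: "'a measure \<Rightarrow> nat \<Rightarrow> nat \<Rightarrow> ('a \<Rightarrow> complex mat) \<Rightarrow> bool" where
  "measurable_mat M n m f \<longleftrightarrow> (\<forall>x \<in> space M. f x \<in> carrier_mat n m) \<and>
     (\<forall>i<n. \<forall>j<m. (\<lambda>x. f x $$ (i, j)) \<in> borel_measurable M)"

lemma measurable_matI:
  assumes "\<And>x. x \<in> space M \<Longrightarrow> f x \<in> carrier_mat n m"
    and "\<And>i j. i < n \<Longrightarrow> j < m \<Longrightarrow> g i j \<in> borel_measurable M"
    and "\<And>i j x. i < n \<Longrightarrow> j < m \<Longrightarrow> x \<in> space M \<Longrightarrow> f x $$ (i, j) = g i j x"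
  shows "measurable_mat M n m f"
  unfolding measurable_mat_def using assms by (auto cong: measurable_cong_simp)

lemma measurable_matD:
  assumes "measurable_mat M n m f"
  shows "x \<in> space M \<Longrightarrow> f x \<in> carrier_mat n m"
    and "i < n \<Longrightarrow> j < m \<Longrightarrow> (\<lambda>x. f x $$ (i, j)) \<in> borel_measurable M"
  using assms by (auto simp: measurable_mat_def)

lemma measurable_mat_const: "A \<in> carrier_mat n m \<Longrightarrow> measurable_mat M n m (\<lambda>_. A)"
  by (simp add: measurable_mat_def)

lemma measurable_mat_mult:
  assumes f: "measurable_mat M n m f" and g: "measurable_mat M m l g"
  shows "measurable_mat M n l (\<lambda>x. f x * g x)"
proof (rule measurable_matI[where g = "\<lambda>i j x. \<Sum>k<m. f x $$ (i, k) * g x $$ (k, j)"])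
  show "f x * g x \<in> carrier_mat n l" if "x \<in> space M" for x
    using measurable_matD(1)[OF f that] measurable_matD(1)[OF g that] by simp
  show "(f x * g x) $$ (i, j) = (\<Sum>k<m. f x $$ (i, k) * g x $$ (k, j))" if "i < n" "j < l" "x \<in> space M" for i j x
    using measurable_matD(1)[OF f that(3)] measurable_matD(1)[OF g that(3)] that(1,2) by (rule times_index)
  show "(\<lambda>x. \<Sum>k<m. f x $$ (i, k) * g x $$ (k, j)) \<in> borel_measurable M" if "i < n" "j < l" for i j
    using that measurable_matD(2)[OF f] measurable_matD(2)[OF g]
    by (intro borel_measurable_sum borel_measurable_times) auto
qed

lemma measurable_mat_add:
  assumes f: "measurable_mat M n m f" and g: "measurable_mat M n m g"
  shows "measurable_mat M n m (\<lambda>x. f x + g x)"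
proof (rule measurable_matI[where g = "\<lambda>i j x. f x $$ (i, j) + g x $$ (i, j)"])
  show "f x + g x \<in> carrier_mat n m" if "x \<in> space M" for x
    using measurable_matD(1)[OF f that] measurable_matD(1)[OF g that] by simp
  show "(f x + g x) $$ (i, j) = f x $$ (i, j) + g x $$ (i, j)" if "i < n" "j < m" "x \<in> space M" for i j x
    using measurable_matD(1)[OF f that(3)] measurable_matD(1)[OF g that(3)] that by auto
  show "(\<lambda>x. f x $$ (i, j) + g x $$ (i, j)) \<in> borel_measurable M" if "i < n" "j < m" for i j
    using that measurable_matD(2)[OF f] measurable_matD(2)[OF g] by (intro borel_measurable_add)
qed

lemma measurable_mat_adjoint:
  assumes f: "measurable_mat M n m f"
  shows "measurable_mat M m n (\<lambda>x. mat_adjoint (f x))"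
proof (rule measurable_matI[where g = "\<lambda>i j x. cnj (f x $$ (j, i))"])
  show "mat_adjoint (f x) \<in> carrier_mat m n" if "x \<in> space M" for x
    using measurable_matD(1)[OF f that] by simp
  show "mat_adjoint (f x) $$ (i, j) = cnj (f x $$ (j, i))" if "i < m" "j < n" "x \<in> space M" for i j x
    using measurable_matD(1)[OF f that(3)] that by (intro mat_adjoint_index) auto
  show "(\<lambda>x. cnj (f x $$ (j, i))) \<in> borel_measurable M" if "i < m" "j < n" for i j
    by (rule measurable_compose[OF measurable_matD(2)[OF f that(2,1)]
          borel_measurable_continuous_onI[OF continuous_on_cnj[OF continuous_on_id]]])
qed

lemma measurable_mat_kronecker:
  assumes f: "measurable_mat M n n f"
  shows "measurable_mat M (n * k) (n * k) (\<lambda>x. kronecker (f x) (1\<^sub>m k))"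
proof (rule measurable_matI[where g = "\<lambda>i j x. f x $$ (i div k, j div k) * (1\<^sub>m k) $$ (i mod k, j mod k)"])
  show "kronecker (f x) (1\<^sub>m k) \<in> carrier_mat (n * k) (n * k)" if "x \<in> space M" for x
    using measurable_matD(1)[OF f that] by (simp add: kronecker_def)
  show "kronecker (f x) (1\<^sub>m k) $$ (i, j) = f x $$ (i div k, j div k) * (1\<^sub>m k) $$ (i mod k, j mod k)"
    if "i < n * k" "j < n * k" "x \<in> space M" for i j x
    using measurable_matD(1)[OF f that(3)] that by (simp add: kronecker_def)
  show "(\<lambda>x. f x $$ (i div k, j div k) * (1\<^sub>m k) $$ (i mod k, j mod k)) \<in> borel_measurable M"
    if "i < n * k" "j < n * k" for i j
    using that measurable_matD(2)[OF f, of "i div k" "j div k"] by (simp add: less_mult_imp_div_less)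
qed

lemma measurable_mat_apply_kraus:
  assumes "\<And>K. K \<in> set Ks \<Longrightarrow> measurable_mat M n n K" "measurable_mat M n n \<rho>"
  shows "measurable_mat M n n (\<lambda>x. apply_kraus n (map (\<lambda>K. K x) Ks) (\<rho> x))"
  using assms(1)
proof (induction Ks)
  case Nil
  then show ?case by (simp add: apply_kraus_def list_sum_mat_def measurable_mat_const)
next
  case (Cons K Ks)
  have "measurable_mat M n n (\<lambda>x. K x * \<rho> x * mat_adjoint (K x) + apply_kraus n (map (\<lambda>K. K x) Ks) (\<rho> x))"
    using Cons assms(2) by (intro measurable_mat_add measurable_mat_mult[of _ n n] measurable_mat_adjoint) auto
  then show ?case by (simp add: apply_kraus_def list_sum_mat_def)
qed

lemma measurable_mat_trace:
  assumes f: "measurable_mat M n n f"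
  shows "(\<lambda>x. mat_trace (f x)) \<in> borel_measurable M"
proof -
  have "(\<lambda>x. \<Sum>i<n. f x $$ (i, i)) \<in> borel_measurable M"
    using measurable_matD(2)[OF f] by (intro borel_measurable_sum) auto
  moreover have "mat_trace (f x) = (\<Sum>i<n. f x $$ (i, i))" if "x \<in> space M" for x
    using measurable_matD(1)[OF f that] by (simp add: mat_trace_def)
  ultimately show ?thesis by (simp cong: measurable_cong_simp)
qed

lemma measurable_mat_pow:
  assumes f: "measurable_mat M n n f"
  shows "measurable_mat M n n (\<lambda>x. f x ^\<^sub>m k)"
proof (induction k)
  case 0
  show ?case
    by (rule measurable_matI[where g = "\<lambda>i j x. if i = j then 1 else 0"])
      (auto dest!: measurable_matD(1)[OF f])
next
  case (Suc k)
  then show ?case using f by (auto intro!: measurable_mat_mult[of _ n n])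
qed

section \<open>Invariance of Haar integrals\<close>

locale haar =
  fixes N :: nat and \<mu> :: "complex mat measure"
  assumes haar: "haar_unitary N \<mu>"
begin

lemma space_haar [simp]: "space \<mu> = unitary_group N"
  and sets_haar: "sets \<mu> = sets (unitary_borel N)"
  and haar_invariant: "W \<in> unitary_group N \<Longrightarrow> distr \<mu> \<mu> (\<lambda>U. W * U) = \<mu>"
  using haar by (auto simp: haar_unitary_def)

sublocale prob_space \<mu>
  using haar by (simp add: haar_unitary_def)

sublocale pair: pair_prob_space \<mu> \<mu> ..

lemma measurable_mat_id: "measurable_mat \<mu> N N (\<lambda>U. U)"
  unfolding measurable_mat_def
proof (intro conjI allI impI ballI)
  fix i j assume ij: "i < N" "j < N"
  let ?G = "{{U \<in> unitary_group N. U $$ (i, j) \<in> B} | i j B. i < N \<and> j < N \<and> B \<in> sets borel}"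
  show "(\<lambda>U. U $$ (i, j)) \<in> borel_measurable \<mu>"
  proof (rule measurableI)
    fix B :: "complex set" assume B: "B \<in> sets borel"
    have "{U \<in> unitary_group N. U $$ (i, j) \<in> B} \<in> sigma_sets (unitary_group N) ?G"
      using ij B by (intro sigma_sets.Basic) blast
    moreover have "sets (unitary_borel N) = sigma_sets (unitary_group N) ?G"
      unfolding unitary_borel_def by (rule sets_measure_of) auto
    moreover have "(\<lambda>U. U $$ (i, j)) -` B \<inter> space \<mu> = {U \<in> unitary_group N. U $$ (i, j) \<in> B}" by auto
    ultimately show "(\<lambda>U. U $$ (i, j)) -` B \<inter> space \<mu> \<in> sets \<mu>" by (simp add: sets_haar)
  qed simp
qed (use unitary_groupD(1) in auto)

lemma measurable_haarI:
  assumes "measurable_mat M N N f" "\<And>x. x \<in> space M \<Longrightarrow> f x \<in> unitary_group N"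
  shows "f \<in> measurable M \<mu>"
proof -
  have "f \<in> measurable M (unitary_borel N)"
    unfolding unitary_borel_def
  proof (rule measurable_measure_of)
    fix y assume "y \<in> {{U \<in> unitary_group N. U $$ (i, j) \<in> B} | i j B. i < N \<and> j < N \<and> B \<in> sets borel}"
    then obtain i j B where y: "y = {U \<in> unitary_group N. U $$ (i, j) \<in> B}" "i < N" "j < N" "B \<in> sets borel"
      by blast
    have "f -` y \<inter> space M = (\<lambda>x. f x $$ (i, j)) -` B \<inter> space M"
      using assms(2) y by auto
    also have "\<dots> \<in> sets M"
      using measurable_matD(2)[OF assms(1) y(2,3)] y(4) by (rule measurable_sets)
    finally show "f -` y \<inter> space M \<in> sets M" .
  qed (use assms(2) in auto)
  then show ?thesis by (simp add: measurable_cong_sets[OF refl sets_haar])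
qed

lemma measurable_mat_comp:
  assumes "f \<in> measurable M \<mu>"
  shows "measurable_mat M N N f"
  unfolding measurable_mat_def
proof (intro conjI allI impI ballI)
  show "f x \<in> carrier_mat N N" if "x \<in> space M" for x
    using measurable_space[OF assms that] unitary_groupD(1) by auto
  show "(\<lambda>x. f x $$ (i, j)) \<in> borel_measurable M" if "i < N" "j < N" for i j
    using measurable_compose[OF assms measurable_matD(2)[OF measurable_mat_id that]] .
qed

lemma measurable_haar_mult:
  assumes "f \<in> measurable M \<mu>" "g \<in> measurable M \<mu>"
  shows "(\<lambda>x. f x * g x) \<in> measurable M \<mu>"
  using assms measurable_space[OF assms(1)] measurable_space[OF assms(2)]
  by (intro measurable_haarI[OF measurable_mat_mult[OF measurable_mat_comp measurable_mat_comp]] unitary_group_mult) auto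

lemma measurable_haar_adjoint:
  assumes "f \<in> measurable M \<mu>"
  shows "(\<lambda>x. mat_adjoint (f x)) \<in> measurable M \<mu>"
  using assms measurable_space[OF assms]
  by (intro measurable_haarI[OF measurable_mat_adjoint[OF measurable_mat_comp]] unitary_group_adjoint) auto

lemma measurable_haar_const: "W \<in> unitary_group N \<Longrightarrow> (\<lambda>_. W) \<in> measurable M \<mu>"
  by simp

lemma haar_integral_left:
  fixes h :: "complex mat \<Rightarrow> 'b :: {banach, second_countable_topology}"
  assumes "W \<in> unitary_group N" "h \<in> borel_measurable \<mu>"
  shows "(LINT U|\<mu>. h (W * U)) = (LINT U|\<mu>. h U)"
proof -
  have "(\<lambda>U. W * U) \<in> measurable \<mu> \<mu>"
    using assms(1) by (intro measurable_haar_mult measurable_haar_const measurable_ident_sets[OF refl])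
  then have "(LINT U|distr \<mu> \<mu> (\<lambda>U. W * U). h U) = (LINT U|\<mu>. h (W * U))"
    using assms(2) by (intro integral_distr)
  then show ?thesis by (simp add: haar_invariant[OF assms(1)])
qed

text \<open>Only left invariance is used. For fixed \<open>W\<close>, left translation by its
  adjoint turns the argument into U W; after exchanging the integrals, left translation by
  \<open>U\<close> turns this into \<open>W\<close>. Boundedness makes both integrands integrable on
  the product, as Fubini requires.\<close>

lemma haar_integral_conj:
  fixes h :: "complex mat \<Rightarrow> real"
  assumes h: "h \<in> borel_measurable \<mu>" and bound: "\<And>U. U \<in> unitary_group N \<Longrightarrow> \<bar>h U\<bar> \<le> C"
  shows "(LINT U|\<mu>. LINT W|\<mu>. h (mat_adjoint W * U * W)) = (LINT U|\<mu>. h U)"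
proof -
  have fst: "fst \<in> measurable (\<mu> \<Otimes>\<^sub>M \<mu>) \<mu>" and snd: "snd \<in> measurable (\<mu> \<Otimes>\<^sub>M \<mu>) \<mu>" by simp_all
  have int1: "integrable (\<mu> \<Otimes>\<^sub>M \<mu>) (\<lambda>(U, W). h (mat_adjoint W * U * W))"
  proof (rule pair.integrable_const_bound[where B = C])
    show "AE x in \<mu> \<Otimes>\<^sub>M \<mu>. norm (case x of (U, W) \<Rightarrow> h (mat_adjoint W * U * W)) \<le> C"
      by (intro AE_I2) (auto simp: space_pair_measure intro!: bound unitary_group_mult unitary_group_adjoint)
    show "(\<lambda>(U, W). h (mat_adjoint W * U * W)) \<in> borel_measurable (\<mu> \<Otimes>\<^sub>M \<mu>)"
      unfolding case_prod_unfold
      by (rule measurable_compose[OF _ h]) (intro measurable_haar_mult measurable_haar_adjoint fst snd)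
  qed
  have int2: "integrable (\<mu> \<Otimes>\<^sub>M \<mu>) (\<lambda>(U, W). h (U * W))"
  proof (rule pair.integrable_const_bound[where B = C])
    show "AE x in \<mu> \<Otimes>\<^sub>M \<mu>. norm (case x of (U, W) \<Rightarrow> h (U * W)) \<le> C"
      by (intro AE_I2) (auto simp: space_pair_measure intro!: bound unitary_group_mult)
    show "(\<lambda>(U, W). h (U * W)) \<in> borel_measurable (\<mu> \<Otimes>\<^sub>M \<mu>)"
      unfolding case_prod_unfold
      by (rule measurable_compose[OF _ h]) (intro measurable_haar_mult fst snd)
  qed
  have "(LINT U|\<mu>. LINT W|\<mu>. h (mat_adjoint W * U * W)) = (LINT W|\<mu>. LINT U|\<mu>. h (mat_adjoint W * U * W))"
    by (rule pair.Fubini_integral[symmetric, OF int1])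
  also have "\<dots> = (LINT W|\<mu>. LINT U|\<mu>. h (U * W))"
  proof (rule Bochner_Integration.integral_cong[OF refl])
    fix W assume "W \<in> space \<mu>"
    then have W: "W \<in> unitary_group N" by simp
    show "(LINT U|\<mu>. h (mat_adjoint W * U * W)) = (LINT U|\<mu>. h (U * W))"
      using unitary_group_adjoint[OF W]
    proof (rule haar_integral_left)
      show "(\<lambda>U. h (U * W)) \<in> borel_measurable \<mu>"
        by (rule measurable_compose[OF _ h]) (intro measurable_haar_mult measurable_ident_sets[OF refl] measurable_haar_const W)
    qed
  qed
  also have "\<dots> = (LINT U|\<mu>. LINT W|\<mu>. h (U * W))"
    by (rule pair.Fubini_integral[OF int2])
  also have "\<dots> = (LINT U|\<mu>. LINT W|\<mu>. h W)"
    by (rule Bochner_Integration.integral_cong[OF refl]) (simp add: haar_integral_left h)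
  also have "\<dots> = (LINT U|\<mu>. h U)" using prob_space by simp
  finally show ?thesis .
qed

text \<open>The conjugation by \<open>Q\<close> is absorbed into the integration variable:
  \<open>W\<close> is replaced by its left translate under the adjoint of \<open>Q\<close>.\<close>

lemma haar_conj_class_function:
  fixes h :: "complex mat \<Rightarrow> real"
  assumes h: "h \<in> borel_measurable \<mu>" and Q: "Q \<in> unitary_group N" and U: "U \<in> unitary_group N"
  shows "(LINT W|\<mu>. h (mat_adjoint W * (Q * U * mat_adjoint Q) * W)) = (LINT W|\<mu>. h (mat_adjoint W * U * W))"
proof -
  have "(LINT W|\<mu>. h (mat_adjoint W * (Q * U * mat_adjoint Q) * W))
      = (LINT W|\<mu>. h (mat_adjoint (mat_adjoint Q * W) * U * (mat_adjoint Q * W)))"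
  proof (intro Bochner_Integration.integral_cong[OF refl] arg_cong[of _ _ h])
    fix W assume "W \<in> space \<mu>"
    then have W: "W \<in> carrier_mat N N" using unitary_groupD(1) by auto
    have c: "W \<in> carrier_mat N N" "Q \<in> carrier_mat N N" "U \<in> carrier_mat N N" "Q * U \<in> carrier_mat N N"
      using W unitary_groupD(1)[OF Q] unitary_groupD(1)[OF U] by (auto intro: mult_carrier_mat)
    show "mat_adjoint W * (Q * U * mat_adjoint Q) * W = mat_adjoint (mat_adjoint Q * W) * U * (mat_adjoint Q * W)"
      using c by (simp add: mat_adjoint_mult[of "mat_adjoint Q" N N W N] assoc_mult_mat[of _ N N _ N _ N]
          mult_carrier_mat[of _ N N _ N])
  qed
  also have "\<dots> = (LINT W|\<mu>. h (mat_adjoint W * U * W))"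
    using unitary_group_adjoint[OF Q]
  proof (rule haar_integral_left)
    show "(\<lambda>W. h (mat_adjoint W * U * W)) \<in> borel_measurable \<mu>"
      by (rule measurable_compose[OF _ h])
        (intro measurable_haar_mult measurable_haar_adjoint measurable_ident_sets[OF refl] measurable_haar_const U)
  qed
  finally show ?thesis .
qed

end

section \<open>Diagonalization of unitary matrices\<close>

definition diag_of :: "nat \<Rightarrow> (nat \<Rightarrow> complex) \<Rightarrow> complex mat" where
  "diag_of n z = Matrix.mat n n (\<lambda>(i, j). if i = j then z i else 0)"

text \<open>The block diagonal matrix with blocks \<open>c\<close> and \<open>A\<close>, used to
  deflate one eigenvalue at a time.\<close>

definition border :: "nat \<Rightarrow> complex \<Rightarrow> complex mat \<Rightarrow> complex mat" where
  "border n c A = Matrix.mat (Suc n) (Suc n) (\<lambda>(i, j). case (i, j) of (0, 0) \<Rightarrow> c | (Suc i, Suc j) \<Rightarrow> A $$ (i, j) | _ \<Rightarrow> 0)"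

lemma diag_of_carrier [simp]: "diag_of n z \<in> carrier_mat n n"
  and border_carrier [simp]: "border n c A \<in> carrier_mat (Suc n) (Suc n)"
  by (simp_all add: diag_of_def border_def)

lemma border_index:
  "border n c A $$ (0, 0) = c"
  "j < n \<Longrightarrow> border n c A $$ (0, Suc j) = 0"
  "i < n \<Longrightarrow> border n c A $$ (Suc i, 0) = 0"
  "i < n \<Longrightarrow> j < n \<Longrightarrow> border n c A $$ (Suc i, Suc j) = A $$ (i, j)"
  by (simp_all add: border_def)

lemma border_eqI:
  assumes "B \<in> carrier_mat (Suc n) (Suc n)" "B $$ (0, 0) = c"
    "\<And>j. j < n \<Longrightarrow> B $$ (0, Suc j) = 0" "\<And>i. i < n \<Longrightarrow> B $$ (Suc i, 0) = 0"
    "\<And>i j. i < n \<Longrightarrow> j < n \<Longrightarrow> B $$ (Suc i, Suc j) = A $$ (i, j)"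
  shows "B = border n c A"
proof (rule eq_matI)
  fix i j assume "i < dim_row (border n c A)" "j < dim_col (border n c A)"
  then show "B $$ (i, j) = border n c A $$ (i, j)"
    using assms by (cases i; cases j) (auto simp: border_def)
qed (use assms in \<open>auto simp: border_def\<close>)

lemma border_mult:
  assumes "A \<in> carrier_mat n n" "B \<in> carrier_mat n n"
  shows "border n a A * border n b B = border n (a * b) (A * B)"
  by (rule border_eqI, rule mult_carrier_mat[OF border_carrier border_carrier])
    (use assms in \<open>simp_all add: times_index[of _ "Suc n" "Suc n" _ "Suc n"] times_index[of A n n B n]
       sum.lessThan_Suc_shift border_index del: index_mult_mat(1) sum.lessThan_Suc\<close>)

lemma border_adjoint:
  assumes "A \<in> carrier_mat n n"
  shows "mat_adjoint (border n a A) = border n (cnj a) (mat_adjoint A)"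
proof (rule border_eqI)
  have d: "dim_row (border n a A) = Suc n" "dim_col (border n a A) = Suc n"
    by (simp_all add: border_def)
  show "mat_adjoint (border n a A) $$ (0, 0) = cnj a" by (simp add: d border_index)
  show "mat_adjoint (border n a A) $$ (0, Suc j) = 0" if "j < n" for j using that by (simp add: d border_index)
  show "mat_adjoint (border n a A) $$ (Suc i, 0) = 0" if "i < n" for i using that by (simp add: d border_index)
  show "mat_adjoint (border n a A) $$ (Suc i, Suc j) = mat_adjoint A $$ (i, j)" if "i < n" "j < n" for i j
    using that assms by (simp add: d border_index)
qed simp

lemma border_one: "border n 1 (1\<^sub>m n) = 1\<^sub>m (Suc n)"
  by (rule border_eqI[symmetric]) auto

lemma border_inj:
  assumes "border n a A = border n b B" "A \<in> carrier_mat n n" "B \<in> carrier_mat n n"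
  shows "A = B"
proof (rule eq_matI)
  fix i j assume "i < dim_row B" "j < dim_col B"
  then have "i < n" "j < n" using assms by auto
  then show "A $$ (i, j) = B $$ (i, j)"
    using border_index(4)[of i n j a A] border_index(4)[of i n j b B] assms(1) by simp
qed (use assms in auto)

lemma mult_unit_vec:
  fixes A :: "complex mat"
  assumes "A \<in> carrier_mat n m" "j < m"
  shows "A *\<^sub>v unit_vec m j = col A j"
proof (rule eq_vecI)
  fix i assume "i < dim_vec (col A j)"
  then have "i < n" using assms by simp
  then have "(A *\<^sub>v unit_vec m j) $ i = (\<Sum>k<m. A $$ (i, k) * unit_vec m j $ k)"
    using assms by (intro mult_vec_index) auto
  also have "\<dots> = (\<Sum>k<m. if k = j then A $$ (i, k) else 0)"
    using assms by (intro sum.cong refl) auto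
  finally show "(A *\<^sub>v unit_vec m j) $ i = col A j $ i"
    using assms \<open>i < n\<close> by simp
qed (use assms in simp)

text \<open>Complete \<open>v\<close> to a basis and orthogonalise; Gram-Schmidt leaves the first
  vector unchanged, and the normalised vectors are the columns of \<open>W\<close>.\<close>

lemma unitary_with_first_column:
  fixes v :: "complex Matrix.vec"
  assumes v: "v \<in> carrier_vec n" "v \<noteq> 0\<^sub>v n"
  shows "\<exists>W \<in> unitary_group n. \<exists>c. c \<noteq> 0 \<and> col W 0 = c \<cdot>\<^sub>v v"
proof -
  interpret cof_vec_space n "TYPE(complex)" .
  have n: "n > 0"
  proof (rule ccontr)
    assume "\<not> n > 0"
    then have "v = 0\<^sub>v n" using v by (intro eq_vecI) auto
    then show False using v by simp
  qed
  define b where "b = basis_completion v"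
  define ws where "ws = gram_schmidt n b"
  from basis_completion[OF v, folded b_def]
  have b: "distinct b" "\<not> lin_dep (set b)" "set b \<subseteq> carrier_vec n" "hd b = v" "length b = n"
    by auto
  from b(4,5) n obtain vs where bv: "b = v # vs" by (cases b) auto
  from gram_schmidt_result[OF b(3,1,2) refl, folded ws_def]
  have ws: "set ws \<subseteq> carrier_vec n" "corthogonal ws" "length ws = n" by (auto simp: b(5))
  have hd: "hd ws = v" using gram_schmidt_hd[OF v(1), of vs, folded bv] by (simp add: ws_def)
  have wsi: "ws ! i \<in> carrier_vec n" if "i < n" for i using ws that by auto
  \<comment> \<open>\<open>corthogonal\<close> gives pairwise orthogonality and nonzero norms but no
    normalisation, hence the division.\<close>
  define W where "W = Matrix.mat n n (\<lambda>(i, j). ws ! j $ i / sqrt (sqn (ws ! j)))"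
  have W: "W \<in> carrier_mat n n" by (simp add: W_def)
  have prod: "ws ! j \<bullet>c ws ! i = (\<Sum>k<n. cnj (ws ! i $ k) * ws ! j $ k)" if "i < n" "j < n" for i j
    using wsi[OF that(1)] wsi[OF that(2)]
    by (auto simp: scalar_prod_def atLeast0LessThan mult.commute intro!: sum.cong)
  have sq: "ws ! i \<bullet>c ws ! i = complex_of_real (sqn (ws ! i))" if "i < n" for i
    using wsi[OF that] by (simp add: prod that of_real_sqn)
  have pos: "sqn (ws ! i) > 0" if "i < n" for i
    using corthogonalD[OF ws(2), of i i] that ws(3) sq[OF that] sqn_nonneg[of "ws ! i"]
    by (auto simp: less_le)
  have "mat_adjoint W * W = 1\<^sub>m n"
  proof (rule eq_matI)
    fix i j assume "i < dim_row (1\<^sub>m n :: complex mat)" "j < dim_col (1\<^sub>m n :: complex mat)"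
    then have ij: "i < n" "j < n" by auto
    have "(mat_adjoint W * W) $$ (i, j) =
        (\<Sum>k<n. cnj (ws ! i $ k) * ws ! j $ k) / (sqrt (sqn (ws ! i)) * sqrt (sqn (ws ! j)))"
      using ij W unfolding sum_divide_distrib
      by (subst times_index[of _ n n _ n]) (auto simp: W_def intro!: sum.cong)
    also have "\<dots> = (ws ! j \<bullet>c ws ! i) / (sqrt (sqn (ws ! i)) * sqrt (sqn (ws ! j)))"
      by (simp add: prod ij)
    also have "\<dots> = 1\<^sub>m n $$ (i, j)"
    proof (cases "i = j")
      case True
      then show ?thesis using ij pos[OF ij(1)]
        by (simp add: sq[OF ij(2)] flip: of_real_mult)
    next
      case False
      then show ?thesis using ij corthogonalD[OF ws(2), of j i] ws(3) by simp
    qed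
    finally show "(mat_adjoint W * W) $$ (i, j) = 1\<^sub>m n $$ (i, j)" .
  qed (use W in auto)
  then have "W \<in> unitary_group n" using W by (simp add: unitary_group_def)
  moreover have "col W 0 = complex_of_real (1 / sqrt (sqn v)) \<cdot>\<^sub>v v"
  proof -
    have "ws ! 0 = v" using hd ws(3) n by (metis hd_conv_nth list.size(3) not_less0)
    then show ?thesis using v n by (intro eq_vecI) (auto simp: W_def)
  qed
  moreover have "complex_of_real (1 / sqrt (sqn v)) \<noteq> 0"
    using pos[OF n] hd ws(3) n by (metis hd_conv_nth list.size(3) not_less0 of_real_eq_0_iff
        divide_eq_0_iff real_sqrt_eq_zero_cancel_iff less_irrefl zero_neq_one)
  ultimately show ?thesis by blast
qed

lemma unitary_eigenvector:
  assumes U: "U \<in> unitary_group n" and n: "n > 0"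
  obtains v e where "v \<in> carrier_vec n" "v \<noteq> 0\<^sub>v n" "U *\<^sub>v v = e \<cdot>\<^sub>v v"
proof -
  obtain e where "eigenvalue U e"
    using spectrum_non_empty[OF unitary_groupD(1)[OF U]] n by (auto simp: spectrum_def)
  then show ?thesis using that unitary_groupD(1)[OF U]
    by (auto simp: eigenvalue_def eigenvector_def)
qed

lemma unitary_row_norm:
  assumes U: "U \<in> unitary_group n" and i: "i < n"
  shows "(\<Sum>j<n. (cmod (U $$ (i, j)))\<^sup>2) = 1"
proof -
  have "(U * mat_adjoint U) $$ (i, i) = (\<Sum>j<n. U $$ (i, j) * cnj (U $$ (i, j)))"
    using unitary_groupD(1)[OF U] i by (subst times_index[of _ n n _ n]) auto
  also have "\<dots> = complex_of_real (\<Sum>j<n. (cmod (U $$ (i, j)))\<^sup>2)"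
    by (simp add: complex_norm_square[symmetric])
  finally show ?thesis using unitary_groupD(3)[OF U] i by (simp add: complex_eq_iff)
qed

lemma unitary_entry_le:
  assumes U: "U \<in> unitary_group n" and i: "i < n" and j: "j < n"
  shows "cmod (U $$ (i, j)) \<le> 1"
proof -
  have "(cmod (U $$ (i, j)))\<^sup>2 \<le> (\<Sum>j<n. (cmod (U $$ (i, j)))\<^sup>2)"
    by (rule member_le_sum) (use j in auto)
  then show ?thesis using unitary_row_norm[OF U i] by (simp add: power_le_one_iff abs_square_le_1)
qed

lemma conj_conj:
  assumes "W \<in> unitary_group n" "U \<in> carrier_mat n n"
  shows "W * (mat_adjoint W * U * W) * mat_adjoint W = U"
proof -
  note W = unitary_groupD[OF assms(1)]
  have "W * (mat_adjoint W * U * W) = W * (mat_adjoint W * (U * W))"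
    using W(1) assms(2) by (subst assoc_mult_mat[of _ n n _ n _ n]) auto
  also have "\<dots> = U * W"
    using W assms(2) by (subst assoc_mult_mat[symmetric, of _ n n _ n _ n]) auto
  finally show ?thesis
    using W assms(2) by (simp add: assoc_mult_mat[of U n n W n "mat_adjoint W" n])
qed

text \<open>Deflation: in a unitary basis that starts with an eigenvector, the first column is a
  multiple of a unit vector. Unitarity forces the first row to have the same shape, and the
  remaining block is a smaller unitary.\<close>

theorem unitary_diagonalization:
  assumes "U \<in> unitary_group n"
  shows "\<exists>Q \<in> unitary_group n. \<exists>z. (\<forall>i<n. cmod (z i) = 1) \<and> U = Q * diag_of n z * mat_adjoint Q"
  using assms
proof (induction n arbitrary: U)
  case 0
  have "U = 1\<^sub>m 0 * diag_of 0 (\<lambda>_. 1) * mat_adjoint (1\<^sub>m 0)"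
    using unitary_groupD(1)[OF 0] by (intro eq_matI) auto
  then show ?case using unitary_group_one by blast
next
  case (Suc n)
  note U = unitary_groupD[OF Suc.prems]
  obtain v e where v: "v \<in> carrier_vec (Suc n)" "v \<noteq> 0\<^sub>v (Suc n)" "U *\<^sub>v v = e \<cdot>\<^sub>v v"
    using unitary_eigenvector[OF Suc.prems] by auto
  obtain W c where Wu: "W \<in> unitary_group (Suc n)" and c: "c \<noteq> 0" "col W 0 = c \<cdot>\<^sub>v v"
    using unitary_with_first_column[OF v(1,2)] by auto
  note W = unitary_groupD[OF Wu]
  define X where "X = mat_adjoint W * U * W"
  have Xu: "X \<in> unitary_group (Suc n)"
    unfolding X_def by (intro unitary_group_mult unitary_group_adjoint Wu Suc.prems)
  note X = unitary_groupD[OF Xu]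
  have Ucol: "U *\<^sub>v col W 0 = e \<cdot>\<^sub>v col W 0"
    using U(1) v unfolding c(2) by (simp add: mult_mat_vec smult_smult_assoc mult.commute)
  have "X *\<^sub>v unit_vec (Suc n) 0 = e \<cdot>\<^sub>v unit_vec (Suc n) 0"
  proof -
    have "W *\<^sub>v unit_vec (Suc n) 0 = col W 0" by (rule mult_unit_vec[OF W(1)]) simp
    moreover have "col W 0 \<in> carrier_vec (Suc n)" by (rule col_carrier_vec[OF _ W(1)]) simp
    ultimately have "X *\<^sub>v unit_vec (Suc n) 0 = mat_adjoint W *\<^sub>v (e \<cdot>\<^sub>v (W *\<^sub>v unit_vec (Suc n) 0))"
      using U(1) W(1) Ucol unfolding X_def
      by (simp add: assoc_mult_mat_vec[of _ "Suc n" "Suc n" _ "Suc n"] mult_carrier_mat[of _ "Suc n" "Suc n" _ "Suc n"])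
    also have "\<dots> = e \<cdot>\<^sub>v ((mat_adjoint W * W) *\<^sub>v unit_vec (Suc n) 0)"
      using W(1) by (subst mult_mat_vec[of _ "Suc n" "Suc n"])
        (auto simp: assoc_mult_mat_vec[of _ "Suc n" "Suc n" _ "Suc n"] intro!: mult_mat_vec_carrier)
    finally show ?thesis using W by simp
  qed
  then have "col X 0 = e \<cdot>\<^sub>v unit_vec (Suc n) 0"
    using mult_unit_vec[OF X(1), of 0] by simp
  then have col: "X $$ (i, 0) = (if i = 0 then e else 0)" if "i < Suc n" for i
    using X(1) that by (auto simp: vec_eq_iff)
  have "sqn (X *\<^sub>v unit_vec (Suc n) 0) = sqn (unit_vec (Suc n) 0)"
    by (rule sqn_unitary[OF Xu]) simp
  moreover have "sqn (unit_vec (Suc n) 0) = 1"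
    by (simp add: sqn_def unit_vec_def sum.lessThan_Suc_shift del: sum.lessThan_Suc)
  ultimately have "(cmod e)\<^sup>2 = 1"
    unfolding \<open>X *\<^sub>v unit_vec (Suc n) 0 = _\<close> sqn_smult by simp
  moreover have "0 \<le> cmod e" by (rule norm_ge_zero)
  ultimately have e: "cmod e = 1" unfolding power2_eq_1_iff by linarith
  \<comment> \<open>The first row has norm 1, and its leading entry \<open>e\<close> of modulus 1
    already exhausts it.\<close>
  have row: "X $$ (0, Suc j) = 0" if "j < n" for j
  proof -
    have "(\<Sum>j<n. (cmod (X $$ (0, Suc j)))\<^sup>2) = 0"
      using unitary_row_norm[OF Xu, of 0] col[of 0] e
      by (simp add: sum.lessThan_Suc_shift del: sum.lessThan_Suc)
    then show ?thesis using that by (simp add: sum_nonneg_eq_0_iff)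
  qed
  define Y where "Y = Matrix.mat n n (\<lambda>(i, j). X $$ (Suc i, Suc j))"
  have Y: "Y \<in> carrier_mat n n" by (simp add: Y_def)
  have XY: "X = border n e Y"
    by (rule border_eqI) (use X(1) col row in \<open>auto simp: Y_def\<close>)
  have "border n (cnj e * e) (mat_adjoint Y * Y) = border n 1 (1\<^sub>m n)"
    using X(2) Y unfolding XY by (simp add: border_adjoint border_mult border_one)
  then have "mat_adjoint Y * Y = 1\<^sub>m n"
    by (rule border_inj) (use Y in \<open>auto intro!: mult_carrier_mat[of _ n n]\<close>)
  then have "Y \<in> unitary_group n" using Y by (simp add: unitary_group_def)
  from Suc.IH[OF this] obtain Q z where Qu: "Q \<in> unitary_group n" and z: "\<forall>i<n. cmod (z i) = 1"
    and YQ: "Y = Q * diag_of n z * mat_adjoint Q" by auto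
  note Q = unitary_groupD[OF Qu]
  define z' where "z' = case_nat e z"
  have D: "diag_of (Suc n) z' = border n e (diag_of n z)"
    by (rule border_eqI) (auto simp: diag_of_def z'_def)
  define Q' where "Q' = border n 1 Q"
  have Q'u: "Q' \<in> unitary_group (Suc n)"
    using Q unfolding Q'_def unitary_group_def by (simp add: border_adjoint border_mult border_one)
  note Q' = unitary_groupD[OF Q'u]
  have "X = Q' * diag_of (Suc n) z' * mat_adjoint Q'"
    unfolding XY YQ D Q'_def using Q(1) by (simp add: border_adjoint border_mult)
  then have "U = W * (Q' * diag_of (Suc n) z' * mat_adjoint Q') * mat_adjoint W"
    using conj_conj[OF Wu U(1)] by (simp add: X_def)
  also have "\<dots> = (W * Q') * diag_of (Suc n) z' * mat_adjoint (W * Q')"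
    using W(1) Q'(1)
    by (simp add: mat_adjoint_mult[OF W(1) Q'(1)] assoc_mult_mat[of _ "Suc n" "Suc n" _ "Suc n" _ "Suc n"]
        mult_carrier_mat[of _ "Suc n" "Suc n" _ "Suc n"])
  finally show ?case
    using unitary_group_mult[OF Wu Q'u] z e
    by (intro bexI[of _ "W * Q'"] exI[of _ z']) (auto simp: z'_def less_Suc_eq_0_disj)
qed

section \<open>Infinitesimal invariance of the Haar measure\<close>

definition projection :: "nat \<Rightarrow> complex mat \<Rightarrow> bool" where
  "projection N P \<longleftrightarrow> P \<in> carrier_mat N N \<and> mat_adjoint P = P \<and> P * P = P"

text \<open>For a projection \<open>P\<close> this is the one-parameter group exp(i t P):
  idempotence collapses the exponential series to this closed form.\<close>

definition rotation :: "nat \<Rightarrow> complex mat \<Rightarrow> real \<Rightarrow> complex mat" where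
  "rotation N P t = 1\<^sub>m N + (cis t - 1) \<cdot>\<^sub>m P"

lemma rotation_unitary:
  assumes "projection N P"
  shows "rotation N P t \<in> unitary_group N"
proof -
  define c where "c = cis t - 1"
  have P: "P \<in> carrier_mat N N" "mat_adjoint P = P" "P * P = P" using assms by (auto simp: projection_def)
  have Pij: "cnj (P $$ (j, i)) = P $$ (i, j)" if "i < N" "j < N" for i j
    using mat_adjoint_index[of i P j] P that by auto
  have adj: "mat_adjoint (1\<^sub>m N + c \<cdot>\<^sub>m P) = 1\<^sub>m N + cnj c \<cdot>\<^sub>m P"
    by (rule eq_matI) (use P(1) Pij in auto)
  have c: "cnj c + c + cnj c * c = 0"
    by (simp add: c_def algebra_simps cis_mult cis_cnj)
  have "(1\<^sub>m N + cnj c \<cdot>\<^sub>m P) * (1\<^sub>m N + c \<cdot>\<^sub>m P)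
      = 1\<^sub>m N * (1\<^sub>m N + c \<cdot>\<^sub>m P) + (cnj c \<cdot>\<^sub>m P) * (1\<^sub>m N + c \<cdot>\<^sub>m P)"
    using P by (intro add_mult_distrib_mat[of _ N N]) auto
  also have "(cnj c \<cdot>\<^sub>m P) * (1\<^sub>m N + c \<cdot>\<^sub>m P) = (cnj c \<cdot>\<^sub>m P) * 1\<^sub>m N + (cnj c \<cdot>\<^sub>m P) * (c \<cdot>\<^sub>m P)"
    using P by (intro mult_add_distrib_mat[of _ N N]) auto
  also have "(cnj c \<cdot>\<^sub>m P) * (c \<cdot>\<^sub>m P) = (cnj c * c) \<cdot>\<^sub>m P"
    using P by (simp add: mult_smult_assoc_mat[of _ N N] mult_smult_distrib[of _ N N])
      (intro eq_matI, auto)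
  also have "1\<^sub>m N * (1\<^sub>m N + c \<cdot>\<^sub>m P) + ((cnj c \<cdot>\<^sub>m P) * 1\<^sub>m N + (cnj c * c) \<cdot>\<^sub>m P) = 1\<^sub>m N"
  proof (rule eq_matI)
    fix i j assume ij: "i < dim_row (1\<^sub>m N :: complex mat)" "j < dim_col (1\<^sub>m N :: complex mat)"
    have "c * P $$ (i, j) + (cnj c * P $$ (i, j) + cnj c * c * P $$ (i, j)) = (cnj c + c + cnj c * c) * P $$ (i, j)"
      by (simp add: algebra_simps)
    then show "(1\<^sub>m N * (1\<^sub>m N + c \<cdot>\<^sub>m P) + ((cnj c \<cdot>\<^sub>m P) * 1\<^sub>m N + (cnj c * c) \<cdot>\<^sub>m P)) $$ (i, j) = 1\<^sub>m N $$ (i, j)"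
      using P(1) ij c by simp
  qed (use P in auto)
  finally show ?thesis
    using P by (simp add: unitary_group_def rotation_def adj flip: c_def)
qed

lemma rotation_index:
  assumes "P \<in> carrier_mat N N" "U \<in> carrier_mat N N" "a < N" "b < N"
  shows "(rotation N P t * U) $$ (a, b) = U $$ (a, b) + (cis t - 1) * (\<Sum>j<N. P $$ (a, j) * U $$ (j, b))"
proof -
  have "(rotation N P t * U) $$ (a, b) = (\<Sum>j<N. rotation N P t $$ (a, j) * U $$ (j, b))"
    using assms by (intro times_index[of _ N N]) (auto simp: rotation_def)
  also have "\<dots> = (\<Sum>j<N. (if a = j then U $$ (j, b) else 0) + (cis t - 1) * (P $$ (a, j) * U $$ (j, b)))"
    using assms by (intro sum.cong refl) (auto simp: rotation_def algebra_simps)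
  finally show ?thesis using assms by (simp add: sum.distrib sum_distrib_left)
qed

section \<open>Derivatives along rotations, with uniform remainders\<close>

lemma cis_taylor: "cmod (cis t - 1 - \<i> * t) \<le> t\<^sup>2"
proof -
  have "cmod (iexp t - (\<Sum>k\<le>1. (\<i> * t) ^ k / fact k)) \<le> \<bar>t\<bar> ^ Suc 1 / fact (Suc 1)"
    by (rule iexp_approx1)
  then have "cmod (cis t - (1 + \<i> * t)) \<le> t\<^sup>2 / 2"
    by (simp add: cis_conv_exp power2_eq_square)
  also have "\<dots> \<le> t\<^sup>2" by simp
  finally show ?thesis by (simp add: algebra_simps)
qed

text \<open>
  The function \<open>g\<close> below is the derivative divided by \<open>\<i>\<close>, which makes it complex linear in the
  projection \<open>P\<close>.
\<close>

definition rot_deriv :: "nat \<Rightarrow> complex mat \<Rightarrow> (complex mat \<Rightarrow> complex) \<Rightarrow> (complex mat \<Rightarrow> complex) \<Rightarrow> bool" where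
  "rot_deriv N P f g \<longleftrightarrow> (\<exists>C. \<forall>U \<in> unitary_group N. cmod (f U) \<le> C \<and> cmod (g U) \<le> C \<and>
     (\<forall>t \<in> {0..1}. cmod (f (rotation N P t * U) - f U - \<i> * t * g U) \<le> C * t\<^sup>2))"

lemma rot_derivE:
  assumes "rot_deriv N P f g"
  obtains C where "C \<ge> 0" "\<And>U. U \<in> unitary_group N \<Longrightarrow> cmod (f U) \<le> C" "\<And>U. U \<in> unitary_group N \<Longrightarrow> cmod (g U) \<le> C"
    "\<And>U t. U \<in> unitary_group N \<Longrightarrow> 0 \<le> t \<Longrightarrow> t \<le> 1 \<Longrightarrow>
       cmod (f (rotation N P t * U) - f U - \<i> * t * g U) \<le> C * t\<^sup>2"
proof -
  obtain C where C: "\<forall>U \<in> unitary_group N. cmod (f U) \<le> C \<and> cmod (g U) \<le> C \<and>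
     (\<forall>t \<in> {0..1}. cmod (f (rotation N P t * U) - f U - \<i> * t * g U) \<le> C * t\<^sup>2)"
    using assms by (auto simp: rot_deriv_def)
  moreover have "C \<ge> 0" using C unitary_group_one[of N] norm_ge_zero order_trans by blast
  ultimately show ?thesis by (intro that[of C]) auto
qed

lemma rot_deriv_const: "rot_deriv N P (\<lambda>_. c) (\<lambda>_. 0)"
  unfolding rot_deriv_def by (rule exI[of _ "cmod c"]) auto

lemma rot_deriv_add:
  assumes "rot_deriv N P f f'" "rot_deriv N P g g'"
  shows "rot_deriv N P (\<lambda>U. f U + g U) (\<lambda>U. f' U + g' U)"
proof -
  obtain C where C: "C \<ge> 0" "\<And>U. U \<in> unitary_group N \<Longrightarrow> cmod (f U) \<le> C"
    "\<And>U. U \<in> unitary_group N \<Longrightarrow> cmod (f' U) \<le> C"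
    "\<And>U t. U \<in> unitary_group N \<Longrightarrow> 0 \<le> t \<Longrightarrow> t \<le> 1 \<Longrightarrow>
       cmod (f (rotation N P t * U) - f U - \<i> * t * f' U) \<le> C * t\<^sup>2"
    using assms(1) by (rule rot_derivE) blast
  obtain D where D: "D \<ge> 0" "\<And>U. U \<in> unitary_group N \<Longrightarrow> cmod (g U) \<le> D" "\<And>U. U \<in> unitary_group N \<Longrightarrow> cmod (g' U) \<le> D"
    "\<And>U t. U \<in> unitary_group N \<Longrightarrow> 0 \<le> t \<Longrightarrow> t \<le> 1 \<Longrightarrow>
       cmod (g (rotation N P t * U) - g U - \<i> * t * g' U) \<le> D * t\<^sup>2"
    using assms(2) by (rule rot_derivE) blast
  show ?thesis
    unfolding rot_deriv_def
  proof (intro exI[of _ "C + D"] ballI conjI)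
    fix U assume U: "U \<in> unitary_group N"
    show "cmod (f U + g U) \<le> C + D" using C(2)[OF U] D(2)[OF U] norm_triangle_mono by blast
    show "cmod (f' U + g' U) \<le> C + D" using C(3)[OF U] D(3)[OF U] norm_triangle_mono by blast
    fix t :: real assume t: "t \<in> {0..1}"
    let ?V = "rotation N P t * U"
    have "f ?V + g ?V - (f U + g U) - \<i> * t * (f' U + g' U) = (f ?V - f U - \<i> * t * f' U) + (g ?V - g U - \<i> * t * g' U)"
      by (simp add: algebra_simps)
    also have "cmod \<dots> \<le> C * t\<^sup>2 + D * t\<^sup>2"
      using C(4)[OF U] D(4)[OF U] t by (intro norm_triangle_mono) auto
    finally show "cmod (f ?V + g ?V - (f U + g U) - \<i> * t * (f' U + g' U)) \<le> (C + D) * t\<^sup>2"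
      by (simp add: algebra_simps)
  qed
qed

lemma rot_deriv_mult:
  assumes P: "projection N P" and "rot_deriv N P f f'" "rot_deriv N P g g'"
  shows "rot_deriv N P (\<lambda>U. f U * g U) (\<lambda>U. f' U * g U + f U * g' U)"
proof -
  obtain C where C: "C \<ge> 0" "\<And>U. U \<in> unitary_group N \<Longrightarrow> cmod (f U) \<le> C"
    "\<And>U. U \<in> unitary_group N \<Longrightarrow> cmod (f' U) \<le> C"
    "\<And>U t. U \<in> unitary_group N \<Longrightarrow> 0 \<le> t \<Longrightarrow> t \<le> 1 \<Longrightarrow>
       cmod (f (rotation N P t * U) - f U - \<i> * t * f' U) \<le> C * t\<^sup>2"
    using assms(2) by (rule rot_derivE) blast
  obtain D where D: "D \<ge> 0" "\<And>U. U \<in> unitary_group N \<Longrightarrow> cmod (g U) \<le> D" "\<And>U. U \<in> unitary_group N \<Longrightarrow> cmod (g' U) \<le> D"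
    "\<And>U t. U \<in> unitary_group N \<Longrightarrow> 0 \<le> t \<Longrightarrow> t \<le> 1 \<Longrightarrow>
       cmod (g (rotation N P t * U) - g U - \<i> * t * g' U) \<le> D * t\<^sup>2"
    using assms(3) by (rule rot_derivE) blast
  show ?thesis
    unfolding rot_deriv_def
  \<comment> \<open>The remainder of the product splits into three terms, with constants
    \<open>C * D\<close>, \<open>C * D\<close> and \<open>2 * C * D\<close>.\<close>
  proof (intro exI[of _ "4 * C * D"] ballI conjI)
    fix U assume U: "U \<in> unitary_group N"
    have CD: "0 \<le> C * D" using C D by simp
    have m: "cmod (x * y) \<le> C * D" if "cmod x \<le> C" "cmod y \<le> D" for x y
      unfolding norm_mult using that C(1) by (intro mult_mono) auto
    show "cmod (f U * g U) \<le> 4 * C * D" using m[OF C(2)[OF U] D(2)[OF U]] CD by linarith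
    have "cmod (f' U * g U + f U * g' U) \<le> C * D + C * D"
      by (intro norm_triangle_mono m C D U)
    then show "cmod (f' U * g U + f U * g' U) \<le> 4 * C * D" using CD by linarith
    fix t :: real assume t: "t \<in> {0..1}"
    then have t: "0 \<le> t" "t \<le> 1" by auto
    let ?V = "rotation N P t * U"
    have V: "?V \<in> unitary_group N" by (intro unitary_group_mult rotation_unitary P U)
    define r where "r = f ?V - f U - \<i> * t * f' U"
    define s where "s = g ?V - g U - \<i> * t * g' U"
    have r: "cmod r \<le> C * t\<^sup>2" and s: "cmod s \<le> D * t\<^sup>2"
      unfolding r_def s_def using C(4)[OF U t] D(4)[OF U t] by auto
    have "t\<^sup>2 \<le> t" using t by (simp add: power2_eq_square mult_left_le_one_le)
    have fd: "cmod (f ?V - f U) \<le> 2 * C * t"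
    proof -
      have "f ?V - f U = r + \<i> * t * f' U" by (simp add: r_def)
      also have "cmod \<dots> \<le> C * t\<^sup>2 + t * C"
        by (intro norm_triangle_mono r) (use t C(3)[OF U] in \<open>simp add: norm_mult mult_left_mono\<close>)
      also have "\<dots> \<le> C * t + t * C" using \<open>t\<^sup>2 \<le> t\<close> t C(1) by (intro add_mono mult_left_mono) auto
      finally show ?thesis by simp
    qed
    have "f ?V * g ?V - f U * g U - \<i> * t * (f' U * g U + f U * g' U)
        = f ?V * s + (r * g U + (f ?V - f U) * (\<i> * t * g' U))"
      by (simp add: r_def s_def algebra_simps)
    also have "cmod \<dots> \<le> C * (D * t\<^sup>2) + (C * t\<^sup>2 * D + 2 * C * t * (t * D))"
    proof (intro norm_triangle_mono)
      show "cmod (f ?V * s) \<le> C * (D * t\<^sup>2)"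
        unfolding norm_mult using C(2)[OF V] C(1) s by (intro mult_mono) auto
      show "cmod (r * g U) \<le> C * t\<^sup>2 * D"
        unfolding norm_mult using r C(1) D(2)[OF U] by (intro mult_mono) auto
      have "cmod (\<i> * t * g' U) \<le> t * D"
        using t D(3)[OF U] by (simp add: norm_mult mult_left_mono)
      then show "cmod ((f ?V - f U) * (\<i> * t * g' U)) \<le> 2 * C * t * (t * D)"
        unfolding norm_mult[of "f ?V - f U"] using fd C(1) t by (intro mult_mono) auto
    qed
    also have "\<dots> = 4 * C * D * t\<^sup>2" by (simp add: power2_eq_square algebra_simps)
    finally show "cmod (f ?V * g ?V - f U * g U - \<i> * t * (f' U * g U + f U * g' U)) \<le> 4 * C * D * t\<^sup>2" .
  qed
qed

text \<open>The sign appears because the derivative is recorded after division by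
  \<open>\<i>\<close>, and conjugation negates that factor.\<close>

lemma rot_deriv_cnj:
  assumes "rot_deriv N P f f'"
  shows "rot_deriv N P (\<lambda>U. cnj (f U)) (\<lambda>U. - cnj (f' U))"
proof -
  have "cnj x - cnj y - \<i> * complex_of_real t * - cnj z = cnj (x - y - \<i> * complex_of_real t * z)" for x y z t
    by simp
  then show ?thesis using assms unfolding rot_deriv_def
    by (simp only: complex_mod_cnj norm_minus_cancel)
qed

lemma rot_deriv_cong:
  assumes "projection N P" "rot_deriv N P f f'"
    "\<And>U. U \<in> unitary_group N \<Longrightarrow> f U = g U" "\<And>U. U \<in> unitary_group N \<Longrightarrow> f' U = g' U"
  shows "rot_deriv N P g g'"
  using assms(2) unfolding rot_deriv_def
  by (simp add: assms(3,4) unitary_group_mult rotation_unitary[OF assms(1)] cong: ball_cong)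

lemma rot_deriv_entry:
  assumes P: "projection N P" and ab: "a < N" "b < N"
  shows "rot_deriv N P (\<lambda>U. U $$ (a, b)) (\<lambda>U. \<Sum>j<N. P $$ (a, j) * U $$ (j, b))"
proof -
  let ?C = "1 + (\<Sum>j<N. cmod (P $$ (a, j)))"
  have S: "(\<Sum>j<N. cmod (P $$ (a, j))) \<ge> 0" by (simp add: sum_nonneg)
  show ?thesis
    unfolding rot_deriv_def
  proof (intro exI[of _ ?C] ballI conjI)
    fix U assume U: "U \<in> unitary_group N"
    show "cmod (U $$ (a, b)) \<le> ?C" using unitary_entry_le[OF U ab] S by linarith
    have "cmod (\<Sum>j<N. P $$ (a, j) * U $$ (j, b)) \<le> (\<Sum>j<N. cmod (P $$ (a, j)) * 1)"
      by (intro sum_norm_le) (simp only: norm_mult, intro mult_left_mono unitary_entry_le[OF U _ ab(2)], auto)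
    then show b: "cmod (\<Sum>j<N. P $$ (a, j) * U $$ (j, b)) \<le> ?C" by simp
    fix t :: real assume "t \<in> {0..1}"
    have "(rotation N P t * U) $$ (a, b) - U $$ (a, b) - \<i> * t * (\<Sum>j<N. P $$ (a, j) * U $$ (j, b))
      = (cis t - 1 - \<i> * t) * (\<Sum>j<N. P $$ (a, j) * U $$ (j, b))"
      using P unitary_groupD(1)[OF U] ab by (simp add: rotation_index projection_def algebra_simps del: index_mult_mat(1))
    also have "cmod \<dots> \<le> t\<^sup>2 * ?C"
      unfolding norm_mult using cis_taylor b by (intro mult_mono) auto
    finally show "cmod ((rotation N P t * U) $$ (a, b) - U $$ (a, b) - \<i> * t * (\<Sum>j<N. P $$ (a, j) * U $$ (j, b))) \<le> ?C * t\<^sup>2"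
      by (simp add: mult.commute)
  qed
qed

text \<open>The Hermitian projections span all complex matrices, so a complex linear functional that
  vanishes on them has all its coefficients zero. Rank one suffices: the projections onto basis
  vectors kill the diagonal, and those onto combinations of two basis vectors kill the rest.\<close>

lemma vanish_on_projections:
  assumes "\<And>P. projection N P \<Longrightarrow> (\<Sum>i<N. \<Sum>j<N. P $$ (i, j) * g i j) = (0 :: complex)"
    and "a < N" "b < N"
  shows "g a b = 0"
proof -
  \<comment> \<open>For a phase \<open>s\<close> and distinct \<open>a\<close>, \<open>b\<close>
    this is the projection onto the line through e_a + s e_b, a vector of squared norm 2.\<close>
  define Q where "Q s = Matrix.mat N N (\<lambda>(i, j). (of_bool (i = a) + s * of_bool (i = b)) * (of_bool (j = a) + cnj s * of_bool (j = b)) / 2)" for s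
  have diag: "g a a = 0" if "a < N" for a
  proof -
    define R where "R = Matrix.mat N N (\<lambda>(i, j). of_bool (i = a) * of_bool (j = a) :: complex)"
    have "projection N R"
      unfolding projection_def
    proof (intro conjI)
      show "R \<in> carrier_mat N N" by (simp add: R_def)
      show "mat_adjoint R = R" by (rule eq_matI) (auto simp: R_def)
      show "R * R = R"
      proof (rule eq_matI)
        fix i j assume "i < dim_row R" "j < dim_col R"
        then have ij: "i < N" "j < N" by (auto simp: R_def)
        have "(R * R) $$ (i, j) = (\<Sum>k<N. R $$ (i, k) * R $$ (k, j))"
          using ij by (intro times_index) (auto simp: R_def)
        also have "\<dots> = (\<Sum>k<N. if k = a then of_bool (i = a) * of_bool (j = a) else 0)"
          using ij that by (intro sum.cong refl) (auto simp: R_def)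
        finally show "(R * R) $$ (i, j) = R $$ (i, j)" using ij that by (simp add: R_def)
      qed (auto simp: R_def)
    qed
    from assms(1)[OF this] have "0 = (\<Sum>i<N. \<Sum>j<N. R $$ (i, j) * g i j)" by simp
    also have "\<dots> = (\<Sum>i<N. \<Sum>j<N. if j = a then (if i = a then g a a else 0) else 0)"
      by (intro sum.cong refl) (auto simp: R_def)
    finally show ?thesis using that by simp
  qed
  show ?thesis
  proof (cases "a = b")
    case True
    then show ?thesis using diag assms by simp
  next
    case False
    have *: "s * g b a + cnj s * g a b = 0" if s: "cmod s = 1" for s
    proof -
      have ss: "cnj s * s = 1" using s by (metis complex_norm_square mult.commute of_real_1 one_power2)
      have "projection N (Q s)"
        unfolding projection_def
      proof (intro conjI)
        show "Q s \<in> carrier_mat N N" by (simp add: Q_def)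
        show "mat_adjoint (Q s) = Q s" by (rule eq_matI) (auto simp: Q_def)
        show "Q s * Q s = Q s"
        proof (rule eq_matI)
          fix i j assume "i < dim_row (Q s)" "j < dim_col (Q s)"
          then have ij: "i < N" "j < N" by (auto simp: Q_def)
          let ?x = "\<lambda>i. of_bool (i = a) + s * of_bool (i = b)"
          let ?y = "\<lambda>j. of_bool (j = a) + cnj s * of_bool (j = b)"
          have "(Q s * Q s) $$ (i, j) = (\<Sum>k<N. Q s $$ (i, k) * Q s $$ (k, j))"
            using ij by (intro times_index) (auto simp: Q_def)
          also have "\<dots> = (\<Sum>k<N. ?x i * ?y j / 4 * (?y k * ?x k))"
            using ij by (intro sum.cong refl) (simp add: Q_def)
          also have "\<dots> = ?x i * ?y j / 4 * (\<Sum>k<N. (if k = a then 1 else 0) + (if k = b then 1 else 0))"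
            unfolding sum_distrib_left using ss False by (intro sum.cong refl) (auto simp: of_bool_def)
          also have "(\<Sum>k<N. (if k = a then 1 else 0) + (if k = b then 1 else 0)) = (2 :: complex)"
            using assms(2,3) by (simp add: sum.distrib)
          finally show "(Q s * Q s) $$ (i, j) = Q s $$ (i, j)" using ij by (simp add: Q_def)
        qed (auto simp: Q_def)
      qed
      from assms(1)[OF this] have "0 = 2 * (\<Sum>i<N. \<Sum>j<N. Q s $$ (i, j) * g i j)" by simp
      also have "\<dots> = (\<Sum>i<N. \<Sum>j<N. (if j = a then (of_bool (i = a) + s * of_bool (i = b)) * g i a else 0)
            + (if j = b then (of_bool (i = a) + s * of_bool (i = b)) * cnj s * g i b else 0))"
        unfolding sum_distrib_left using False by (intro sum.cong refl) (auto simp: Q_def)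
      also have "\<dots> = (\<Sum>i<N. (of_bool (i = a) + s * of_bool (i = b)) * g i a + (of_bool (i = a) + s * of_bool (i = b)) * cnj s * g i b)"
        using assms(2,3) by (simp add: sum.distrib)
      also have "\<dots> = (\<Sum>i<N. (if i = a then g a a + cnj s * g a b else 0) + (if i = b then s * g b a + cnj s * s * g b b else 0))"
        using False by (intro sum.cong refl) auto
      also have "\<dots> = s * g b a + cnj s * g a b"
        using assms(2,3) diag by (simp add: sum.distrib)
      finally show ?thesis by simp
    qed
    \<comment> \<open>The phase 1 gives the sum of the two off-diagonal coefficients and \<i> gives
      a multiple of their difference, so both vanish.\<close>
    from *[of 1] *[of \<i>] show ?thesis by (auto simp: complex_eq_iff)
  qed
qed

section \<open>Loop equations for traces of powers\<close>

lemma pow_mat_add: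
  assumes "(A :: 'a :: semiring_1 mat) \<in> carrier_mat n n"
  shows "A ^\<^sub>m k * A ^\<^sub>m l = A ^\<^sub>m (k + l)"
proof (induction l)
  case (Suc l)
  have "A ^\<^sub>m k * (A ^\<^sub>m l * A) = A ^\<^sub>m k * A ^\<^sub>m l * A"
    using assms by (intro assoc_mult_mat[symmetric, of _ n n _ n _ n] pow_carrier_mat)
  then show ?case using Suc by simp
qed (use assms in simp)

lemma unitary_group_pow: "U \<in> unitary_group N \<Longrightarrow> U ^\<^sub>m k \<in> unitary_group N"
  using unitary_groupD(1)[of U N]
  by (induction k) (auto intro: unitary_group_mult unitary_group_one)

definition power_trace :: "nat \<Rightarrow> complex mat \<Rightarrow> complex" where
  "power_trace k U = mat_trace (U ^\<^sub>m k)"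

definition power_trace_prod :: "nat list \<Rightarrow> complex mat \<Rightarrow> complex" where
  "power_trace_prod ms U = (\<Prod>m\<leftarrow>ms. power_trace m U)"

lemma power_trace_prod_simps [simp]:
  "power_trace_prod [] U = 1"
  "power_trace_prod (m # ms) U = power_trace m U * power_trace_prod ms U"
  by (simp_all add: power_trace_prod_def)

lemma power_trace_sum:
  "U \<in> carrier_mat N N \<Longrightarrow> power_trace k U = (\<Sum>a<N. (U ^\<^sub>m k) $$ (a, a))"
  by (simp add: power_trace_def mat_trace_def pow_mat_dim_square)

lemma cmod_power_trace_le:
  assumes "U \<in> unitary_group N"
  shows "cmod (power_trace k U) \<le> N"
proof -
  have "cmod (power_trace k U) \<le> (\<Sum>a<N. 1)"
    unfolding power_trace_sum[OF unitary_groupD(1)[OF assms]]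
    by (intro sum_norm_le unitary_entry_le[OF unitary_group_pow[OF assms]]) auto
  then show ?thesis by simp
qed

lemma power_trace_0: "U \<in> carrier_mat N N \<Longrightarrow> power_trace 0 U = of_nat N"
  by (simp add: power_trace_sum)

text \<open>The product rule for the derivative of a product of traces: the coefficient of the entry
  (i, j) of the direction, after division by \<open>\<i>\<close>.\<close>

primrec power_trace_prod_grad :: "nat list \<Rightarrow> nat \<Rightarrow> nat \<Rightarrow> complex mat \<Rightarrow> complex" where
  "power_trace_prod_grad [] i j U = 0"
| "power_trace_prod_grad (m # ms) i j U =
     of_nat m * (U ^\<^sub>m m) $$ (j, i) * power_trace_prod ms U + power_trace m U * power_trace_prod_grad ms i j U"

text \<open>The terms that arise when a derivative inserts U^m into a product of traces: a trace of
  order x turns into one of order m + x, with weight x from the power rule.\<close>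

primrec joins :: "nat \<Rightarrow> nat list \<Rightarrow> (nat \<times> nat list) list" where
  "joins m [] = []"
| "joins m (x # xs) = (x, (m + x) # xs) # map (\<lambda>(w, l). (w, x # l)) (joins m xs)"

context haar begin

section \<open>Gradients of bounded functions and their integrals\<close>

definition bdd_meas :: "(complex mat \<Rightarrow> complex) \<Rightarrow> bool" where
  "bdd_meas f \<longleftrightarrow> f \<in> borel_measurable \<mu> \<and> (\<exists>C. \<forall>U \<in> unitary_group N. cmod (f U) \<le> C)"

lemma bdd_meas_integrable: "bdd_meas f \<Longrightarrow> integrable \<mu> f"
  unfolding bdd_meas_def
  by (elim conjE exE, rule integrable_const_bound) (auto intro!: AE_I2)

lemma bdd_meas_const [intro]: "bdd_meas (\<lambda>_. c)"
  by (auto simp: bdd_meas_def)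

lemma bdd_meas_add [intro]:
  assumes "bdd_meas f" "bdd_meas g"
  shows "bdd_meas (\<lambda>U. f U + g U)"
proof -
  obtain C D where "\<forall>U \<in> unitary_group N. cmod (f U) \<le> C" "\<forall>U \<in> unitary_group N. cmod (g U) \<le> D"
    using assms by (auto simp: bdd_meas_def)
  then have "\<forall>U \<in> unitary_group N. cmod (f U + g U) \<le> C + D"
    using norm_triangle_mono by blast
  then show ?thesis using assms by (auto simp: bdd_meas_def)
qed

lemma bdd_meas_mult [intro]:
  assumes "bdd_meas f" "bdd_meas g"
  shows "bdd_meas (\<lambda>U. f U * g U)"
proof -
  obtain C D where CD: "\<forall>U \<in> unitary_group N. cmod (f U) \<le> C" "\<forall>U \<in> unitary_group N. cmod (g U) \<le> D"
    using assms by (auto simp: bdd_meas_def)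
  have "cmod (f U * g U) \<le> \<bar>C\<bar> * \<bar>D\<bar>" if "U \<in> unitary_group N" for U
    unfolding norm_mult using CD that by (intro mult_mono) force+
  then show ?thesis using assms by (auto simp: bdd_meas_def)
qed

lemma bdd_meas_cnj [intro]:
  assumes "bdd_meas f"
  shows "bdd_meas (\<lambda>U. cnj (f U))"
  using assms measurable_compose[OF _ borel_measurable_continuous_onI[OF continuous_on_cnj[OF continuous_on_id]], of f \<mu>]
  by (simp add: bdd_meas_def)

lemma bdd_meas_uminus [intro]:
  "bdd_meas f \<Longrightarrow> bdd_meas (\<lambda>U. - f U)"
  by (auto simp: bdd_meas_def)

lemma bdd_meas_sum [intro]:
  "(\<And>i. i \<in> I \<Longrightarrow> bdd_meas (f i)) \<Longrightarrow> bdd_meas (\<lambda>U. \<Sum>i\<in>I. f i U)"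
  by (induction I rule: infinite_finite_induct) auto

lemma bdd_meas_cong:
  assumes "\<And>U. U \<in> unitary_group N \<Longrightarrow> f U = g U"
  shows "bdd_meas f \<longleftrightarrow> bdd_meas g"
  unfolding bdd_meas_def using assms measurable_cong[of \<mu> f g borel] by simp

lemma bdd_meas_pow_entry [intro]:
  assumes "a < N" "b < N"
  shows "bdd_meas (\<lambda>U. (U ^\<^sub>m k) $$ (a, b))"
  unfolding bdd_meas_def
proof
  show "(\<lambda>U. (U ^\<^sub>m k) $$ (a, b)) \<in> borel_measurable \<mu>"
    by (rule measurable_matD(2)[OF measurable_mat_pow[OF measurable_mat_id] assms])
  show "\<exists>C. \<forall>U\<in>unitary_group N. cmod ((U ^\<^sub>m k) $$ (a, b)) \<le> C"
    using unitary_entry_le[OF unitary_group_pow assms] by blast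
qed

lemma bdd_meas_power_trace [intro]: "bdd_meas (power_trace k)"
  by (subst bdd_meas_cong[OF power_trace_sum[OF unitary_groupD(1)]])
    (auto intro!: bdd_meas_sum)

lemma bdd_meas_power_trace_prod [intro]: "bdd_meas (power_trace_prod ms)"
  by (induction ms) (auto simp: power_trace_prod_def[abs_def] intro!: bdd_meas_mult)

abbreviation along :: "complex mat \<Rightarrow> (nat \<Rightarrow> nat \<Rightarrow> complex mat \<Rightarrow> complex) \<Rightarrow> complex mat \<Rightarrow> complex" where
  "along P c U \<equiv> \<Sum>i<N. \<Sum>j<N. P $$ (i, j) * c i j U"

text \<open>Rotations exist only for projections, whereas the loop equations need one identity per
  matrix entry. Recording the coefficients \<open>c i j\<close> of a derivative that is linear in
  \<open>P\<close> bridges the two.\<close>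

definition gradient :: "(complex mat \<Rightarrow> complex) \<Rightarrow> (nat \<Rightarrow> nat \<Rightarrow> complex mat \<Rightarrow> complex) \<Rightarrow> bool" where
  "gradient f c \<longleftrightarrow> bdd_meas f \<and> (\<forall>i<N. \<forall>j<N. bdd_meas (c i j)) \<and>
     (\<forall>P. projection N P \<longrightarrow> rot_deriv N P f (along P c))"

lemma gradient_cong:
  assumes "gradient f c" "\<And>U. U \<in> unitary_group N \<Longrightarrow> f U = g U"
    "\<And>U i j. U \<in> unitary_group N \<Longrightarrow> i < N \<Longrightarrow> j < N \<Longrightarrow> c i j U = d i j U"
  shows "gradient g d"
  unfolding gradient_def
proof (intro conjI allI impI)
  show "bdd_meas g" using assms bdd_meas_cong[of f g] by (auto simp: gradient_def)
  show "bdd_meas (d i j)" if "i < N" "j < N" for i j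
    using assms that bdd_meas_cong[of "c i j" "d i j"] by (auto simp: gradient_def)
  fix P assume P: "projection N P"
  show "rot_deriv N P g (along P d)"
  proof (rule rot_deriv_cong[OF P _ assms(2)])
    show "rot_deriv N P f (along P c)"
      using assms(1) P by (auto simp: gradient_def)
  qed (auto intro!: sum.cong simp: assms(3))
qed

lemma gradient_const: "gradient (\<lambda>_. a) (\<lambda>_ _ _. 0)"
  by (auto simp: gradient_def rot_deriv_const)

lemma gradient_add:
  assumes "gradient f c" "gradient g d"
  shows "gradient (\<lambda>U. f U + g U) (\<lambda>i j U. c i j U + d i j U)"
  using assms rot_deriv_add
  unfolding gradient_def by (auto simp: distrib_left sum.distrib)

lemma gradient_sum:
  "(\<And>x. x < n \<Longrightarrow> gradient (f x) (c x)) \<Longrightarrow> gradient (\<lambda>U. \<Sum>x<n. f x U) (\<lambda>i j U. \<Sum>x<n. c x i j U)"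
  for n :: nat
  by (induction n) (auto intro: gradient_add gradient_const)

lemma gradient_mult:
  assumes f: "gradient f c" and g: "gradient g d"
  shows "gradient (\<lambda>U. f U * g U) (\<lambda>i j U. c i j U * g U + f U * d i j U)"
  unfolding gradient_def
proof (intro conjI allI impI)
  show "bdd_meas (\<lambda>U. f U * g U)" using f g by (auto simp: gradient_def)
  show "bdd_meas (\<lambda>U. c i j U * g U + f U * d i j U)" if "i < N" "j < N" for i j
    by (intro bdd_meas_add bdd_meas_mult) (use f g that in \<open>auto simp: gradient_def\<close>)
  fix P assume P: "projection N P"
  have "rot_deriv N P (\<lambda>U. f U * g U)
     (\<lambda>U. (along P c U) * g U + f U * (along P d U))"
    using f g P by (intro rot_deriv_mult) (auto simp: gradient_def)
  also have "(\<lambda>U. (along P c U) * g U + f U * (along P d U))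
      = (\<lambda>U. \<Sum>i<N. \<Sum>j<N. P $$ (i, j) * (c i j U * g U + f U * d i j U))"
    unfolding sum_distrib_left sum_distrib_right sum.distrib[symmetric] by (simp add: algebra_simps)
  finally show "rot_deriv N P (\<lambda>U. f U * g U) (\<lambda>U. \<Sum>i<N. \<Sum>j<N. P $$ (i, j) * (c i j U * g U + f U * d i j U))" .
qed

text \<open>The indices are exchanged because conjugating the entry (i, j) of the Hermitian matrix
  \<open>P\<close> gives its entry (j, i).\<close>

lemma gradient_cnj:
  assumes f: "gradient f c"
  shows "gradient (\<lambda>U. cnj (f U)) (\<lambda>i j U. - cnj (c j i U))"
  unfolding gradient_def
proof (intro conjI allI impI)
  show "bdd_meas (\<lambda>U. cnj (f U))" using f by (auto simp: gradient_def)
  show "bdd_meas (\<lambda>U. - cnj (c j i U))" if "i < N" "j < N" for i j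
    by (intro bdd_meas_uminus bdd_meas_cnj) (use f that in \<open>auto simp: gradient_def\<close>)
  fix P assume P: "projection N P"
  have "cnj (P $$ (i, j)) = P $$ (j, i)" if "i < N" "j < N" for i j
    using P that mat_adjoint_index[of j P i] by (auto simp: projection_def)
  then have eq: "(\<lambda>U. - cnj (along P c U)) = (\<lambda>U. \<Sum>j<N. \<Sum>i<N. P $$ (j, i) * - cnj (c i j U))"
    by (subst sum.swap) (simp add: sum_negf)
  have "rot_deriv N P f (along P c)"
    using f P by (simp add: gradient_def)
  from rot_deriv_cnj[OF this] show "rot_deriv N P (\<lambda>U. cnj (f U)) (\<lambda>U. \<Sum>i<N. \<Sum>j<N. P $$ (i, j) * - cnj (c j i U))"
    unfolding eq .
qed

lemma integral_double_sum:
  fixes h :: "nat \<Rightarrow> nat \<Rightarrow> complex mat \<Rightarrow> complex"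
  assumes "\<And>i j. i < N \<Longrightarrow> j < N \<Longrightarrow> integrable \<mu> (h i j)"
  shows "(LINT U|\<mu>. (\<Sum>i<N. \<Sum>j<N. h i j U)) = (\<Sum>i<N. \<Sum>j<N. LINT U|\<mu>. h i j U)"
proof -
  have "(LINT U|\<mu>. (\<Sum>i<N. \<Sum>j<N. h i j U)) = (\<Sum>i<N. LINT U|\<mu>. (\<Sum>j<N. h i j U))"
    by (rule Bochner_Integration.integral_sum) (auto intro!: Bochner_Integration.integrable_sum assms)
  also have "\<dots> = (\<Sum>i<N. \<Sum>j<N. LINT U|\<mu>. h i j U)"
  proof (rule sum.cong[OF refl])
    fix i assume "i \<in> {..<N}"
    then show "(LINT U|\<mu>. (\<Sum>j<N. h i j U)) = (\<Sum>j<N. LINT U|\<mu>. h i j U)"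
      by (intro Bochner_Integration.integral_sum assms) auto
  qed
  finally show ?thesis .
qed

text \<open>Invariance makes the zeroth order terms cancel in the integrated expansion, and the
  uniform remainder leaves t times the integral of the derivative bounded by C t^2. Letting t tend
  to 0 gives a vanishing integral for every projection, hence for every coefficient.\<close>

lemma gradient_integral_zero:
  assumes grad: "gradient f c" and ij: "i < N" "j < N"
  shows "(LINT U|\<mu>. c i j U) = 0"
  using _ ij
proof (rule vanish_on_projections)
  fix P assume P: "projection N P"
  define g where "g U = (along P c U)" for U
  have bc: "bdd_meas (c i j)" if "i < N" "j < N" for i j using grad that by (auto simp: gradient_def)
  have bf: "bdd_meas f" using grad by (auto simp: gradient_def)
  have bg: "bdd_meas g"
    unfolding g_def using bc by (intro bdd_meas_sum bdd_meas_mult bdd_meas_const) auto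
  have "rot_deriv N P f g"
    using grad P by (auto simp: gradient_def g_def[abs_def])
  then obtain C where C: "C \<ge> 0" "\<And>U t. U \<in> unitary_group N \<Longrightarrow> 0 \<le> t \<Longrightarrow> t \<le> 1 \<Longrightarrow>
       cmod (f (rotation N P t * U) - f U - \<i> * t * g U) \<le> C * t\<^sup>2"
    by (rule rot_derivE) blast
  have small: "cmod (LINT U|\<mu>. g U) \<le> C * t" if t: "0 < t" "t \<le> 1" for t
  proof -
    note R = rotation_unitary[OF P, of t]
    have fm: "f \<in> borel_measurable \<mu>" using bf by (simp add: bdd_meas_def)
    have fR: "bdd_meas (\<lambda>U. f (rotation N P t * U))"
      unfolding bdd_meas_def
    proof
      show "(\<lambda>U. f (rotation N P t * U)) \<in> borel_measurable \<mu>"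
        by (rule measurable_compose[OF _ fm])
          (intro measurable_haar_mult measurable_haar_const R measurable_ident_sets[OF refl])
      obtain B where "\<forall>U \<in> unitary_group N. cmod (f U) \<le> B" using bf by (auto simp: bdd_meas_def)
      then show "\<exists>C. \<forall>U\<in>unitary_group N. cmod (f (rotation N P t * U)) \<le> C"
        using unitary_group_mult[OF R] by blast
    qed
    have "(LINT U|\<mu>. f (rotation N P t * U) - f U - \<i> * t * g U)
        = (LINT U|\<mu>. f (rotation N P t * U)) - (LINT U|\<mu>. f U) - \<i> * t * (LINT U|\<mu>. g U)"
      using bdd_meas_integrable[OF fR] bdd_meas_integrable[OF bf] bdd_meas_integrable[OF bg]
      by simp
    also have "\<dots> = - (\<i> * t * (LINT U|\<mu>. g U))"
      by (simp add: haar_integral_left[OF R fm])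
    finally have "t * cmod (LINT U|\<mu>. g U) = cmod (LINT U|\<mu>. f (rotation N P t * U) - f U - \<i> * t * g U)"
      using t by (simp add: norm_mult)
    also have "\<dots> \<le> (LINT U|\<mu>. cmod (f (rotation N P t * U) - f U - \<i> * t * g U))"
      by (rule integral_norm_bound)
    also have "\<dots> \<le> C * t\<^sup>2"
      using t bdd_meas_integrable[OF fR] bdd_meas_integrable[OF bf] bdd_meas_integrable[OF bg]
      by (intro integral_le_const AE_I2 C(2)) auto
    finally show ?thesis using t by (simp add: power2_eq_square mult.left_commute)
  qed
  have "cmod (LINT U|\<mu>. g U) = 0"
  proof (rule ccontr)
    define x where "x = cmod (LINT U|\<mu>. g U)"
    assume "cmod (LINT U|\<mu>. g U) \<noteq> 0"
    then have x: "x > 0" by (simp add: x_def)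
    \<comment> \<open>Small enough for C t < x; the summand 1 keeps the denominator positive if
      \<open>C\<close> is 0.\<close>
    define t where "t = min 1 (x / (2 * (C + 1)))"
    have t: "0 < t" "t \<le> 1" "t \<le> x / (2 * (C + 1))" using x C(1) by (auto simp: t_def)
    have "x \<le> C * t" using small[OF t(1,2)] by (simp add: x_def)
    also have "\<dots> \<le> C * (x / (2 * (C + 1)))" using t C(1) by (intro mult_left_mono)
    also have "\<dots> < x" using x C(1) by (simp add: field_simps add_nonneg_pos)
    finally show False by simp
  qed
  moreover have "(LINT U|\<mu>. g U) = (\<Sum>i<N. \<Sum>j<N. P $$ (i, j) * (LINT U|\<mu>. c i j U))"
    unfolding g_def using bdd_meas_integrable[OF bc]
    by (subst integral_double_sum) auto
  ultimately show "(\<Sum>i<N. \<Sum>j<N. P $$ (i, j) * (LINT U|\<mu>. c i j U)) = 0" by simp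
qed

lemma gradient_entry:
  assumes ab: "a < N" "b < N"
  shows "gradient (\<lambda>U. U $$ (a, b)) (\<lambda>i j U. if i = a then U $$ (j, b) else 0)"
  unfolding gradient_def
proof (intro conjI allI impI)
  have *: "bdd_meas (\<lambda>U. U $$ (i, j))" if "i < N" "j < N" for i j
    using bdd_meas_pow_entry[OF that, of 1] that
    by (subst (asm) bdd_meas_cong[of _ "\<lambda>U. U $$ (i, j)"]) (auto dest: unitary_groupD(1))
  show "bdd_meas (\<lambda>U. U $$ (a, b))" by (rule *[OF ab])
  show "bdd_meas (\<lambda>U. if i = a then U $$ (j, b) else 0)" if "i < N" "j < N" for i j
    by (cases "i = a") (use *[OF that(2) ab(2)] in auto)
  fix P assume P: "projection N P"
  have "(\<Sum>i<N. \<Sum>j<N. P $$ (i, j) * (if i = a then U $$ (j, b) else 0)) = (\<Sum>j<N. P $$ (a, j) * U $$ (j, b))" for U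
    by (subst sum.swap, rule sum.cong[OF refl]) (use ab in \<open>simp add: if_distrib cong: if_cong\<close>)
  then show "rot_deriv N P (\<lambda>U. U $$ (a, b)) (\<lambda>U. \<Sum>i<N. \<Sum>j<N. P $$ (i, j) * (if i = a then U $$ (j, b) else 0))"
    using rot_deriv_entry[OF P ab] by simp
qed

text \<open>Rotation multiplies each factor \<open>U\<close> from the left, so the derivative of U^m
  is the sum of U^l P U^(m - l) over l < m. The power to the right of \<open>P\<close> is never
  trivial, while the one to its left is trivial for l = 0.\<close>

lemma gradient_pow_entry:
  assumes ab: "a < N" "b < N"
  shows "gradient (\<lambda>U. (U ^\<^sub>m m) $$ (a, b)) (\<lambda>i j U. \<Sum>l<m. (U ^\<^sub>m l) $$ (a, i) * (U ^\<^sub>m (m - l)) $$ (j, b))"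
  using ab
proof (induction m arbitrary: b)
  case 0
  show ?case
    by (rule gradient_cong[OF gradient_const[of "if a = b then 1 else 0"]])
      (use 0 in \<open>auto dest!: unitary_groupD(1)\<close>)
next
  case (Suc m)
  have step: "gradient (\<lambda>U. \<Sum>x<N. (U ^\<^sub>m m) $$ (a, x) * U $$ (x, b))
     (\<lambda>i j U. \<Sum>x<N. (\<Sum>l<m. (U ^\<^sub>m l) $$ (a, i) * (U ^\<^sub>m (m - l)) $$ (j, x)) * U $$ (x, b)
        + (U ^\<^sub>m m) $$ (a, x) * (if i = x then U $$ (j, b) else 0))"
    using Suc.prems by (intro gradient_sum gradient_mult Suc.IH gradient_entry)
  show ?case
  proof (rule gradient_cong[OF step])
    fix U assume "U \<in> unitary_group N"
    then have U: "U \<in> carrier_mat N N" by (rule unitary_groupD(1))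
    show "(\<Sum>x<N. (U ^\<^sub>m m) $$ (a, x) * U $$ (x, b)) = (U ^\<^sub>m Suc m) $$ (a, b)"
      using times_index[OF pow_carrier_mat[OF U] U Suc.prems] by simp
    fix i j assume ij: "i < N" "j < N"
    have "(\<Sum>x<N. (\<Sum>l<m. (U ^\<^sub>m l) $$ (a, i) * (U ^\<^sub>m (m - l)) $$ (j, x)) * U $$ (x, b)
        + (U ^\<^sub>m m) $$ (a, x) * (if i = x then U $$ (j, b) else 0))
      = (\<Sum>x<N. \<Sum>l<m. (U ^\<^sub>m l) $$ (a, i) * ((U ^\<^sub>m (m - l)) $$ (j, x) * U $$ (x, b)))
        + (\<Sum>x<N. if i = x then (U ^\<^sub>m m) $$ (a, x) * U $$ (j, b) else 0)"
      unfolding sum.distrib sum_distrib_right by (intro arg_cong2[of _ _ _ _ "(+)"] sum.cong refl) auto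
    also have "(\<Sum>x<N. \<Sum>l<m. (U ^\<^sub>m l) $$ (a, i) * ((U ^\<^sub>m (m - l)) $$ (j, x) * U $$ (x, b)))
        = (\<Sum>l<m. (U ^\<^sub>m l) $$ (a, i) * (U ^\<^sub>m (Suc m - l)) $$ (j, b))"
      using times_index[OF pow_carrier_mat[OF U] U ij(2) Suc.prems(2)]
      by (subst sum.swap) (auto simp: sum_distrib_left[symmetric] Suc_diff_le less_imp_le intro!: sum.cong)
    also have "(\<Sum>x<N. if i = x then (U ^\<^sub>m m) $$ (a, x) * U $$ (j, b) else 0) = (U ^\<^sub>m m) $$ (a, i) * (U ^\<^sub>m (Suc m - m)) $$ (j, b)"
      using ij U by simp
    finally show "(\<Sum>x<N. (\<Sum>l<m. (U ^\<^sub>m l) $$ (a, i) * (U ^\<^sub>m (m - l)) $$ (j, x)) * U $$ (x, b)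
        + (U ^\<^sub>m m) $$ (a, x) * (if i = x then U $$ (j, b) else 0))
      = (\<Sum>l<Suc m. (U ^\<^sub>m l) $$ (a, i) * (U ^\<^sub>m (Suc m - l)) $$ (j, b))"
      by simp
  qed
qed

text \<open>Under the trace the two powers around \<open>P\<close> recombine to U^m, so all m terms
  coincide.\<close>

lemma gradient_power_trace:
  "gradient (power_trace m) (\<lambda>i j U. of_nat m * (U ^\<^sub>m m) $$ (j, i))"
proof (rule gradient_cong)
  show "gradient (\<lambda>U. \<Sum>a<N. (U ^\<^sub>m m) $$ (a, a)) (\<lambda>i j U. \<Sum>a<N. \<Sum>l<m. (U ^\<^sub>m l) $$ (a, i) * (U ^\<^sub>m (m - l)) $$ (j, a))"
    by (intro gradient_sum gradient_pow_entry)
  fix U assume "U \<in> unitary_group N"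
  then have U: "U \<in> carrier_mat N N" by (rule unitary_groupD(1))
  show "(\<Sum>a<N. (U ^\<^sub>m m) $$ (a, a)) = power_trace m U" by (simp add: power_trace_sum[OF U])
  fix i j assume ij: "i < N" "j < N"
  have "(\<Sum>a<N. \<Sum>l<m. (U ^\<^sub>m l) $$ (a, i) * (U ^\<^sub>m (m - l)) $$ (j, a))
      = (\<Sum>l<m. \<Sum>a<N. (U ^\<^sub>m (m - l)) $$ (j, a) * (U ^\<^sub>m l) $$ (a, i))"
    by (subst sum.swap) (simp add: mult.commute)
  also have "\<dots> = (\<Sum>l<m. (U ^\<^sub>m m) $$ (j, i))"
  proof (intro sum.cong refl)
    fix l assume "l \<in> {..<m}"
    then show "(\<Sum>a<N. (U ^\<^sub>m (m - l)) $$ (j, a) * (U ^\<^sub>m l) $$ (a, i)) = (U ^\<^sub>m m) $$ (j, i)"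
      using times_index[OF pow_carrier_mat[OF U] pow_carrier_mat[OF U] ij(2,1), of "m - l" l] pow_mat_add[OF U, of "m - l" l]
      by simp
  qed
  finally show "(\<Sum>a<N. \<Sum>l<m. (U ^\<^sub>m l) $$ (a, i) * (U ^\<^sub>m (m - l)) $$ (j, a)) = of_nat m * (U ^\<^sub>m m) $$ (j, i)"
    by simp
qed

lemma gradient_power_trace_prod: "gradient (power_trace_prod ms) (power_trace_prod_grad ms)"
proof (induction ms)
  case Nil
  then show ?case by (rule gradient_cong[OF gradient_const[of 1]]) auto
next
  case (Cons m ms)
  show ?case by (rule gradient_cong[OF gradient_mult[OF gradient_power_trace[of m] Cons]]) auto
qed

lemma contract_power_trace_prod_grad:
  assumes "U \<in> carrier_mat N N"
  shows "(\<Sum>i<N. \<Sum>j<N. (U ^\<^sub>m m) $$ (i, j) * power_trace_prod_grad ms i j U)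
    = (\<Sum>(w, l)\<leftarrow>joins m ms. of_nat w * power_trace_prod l U)"
proof (induction ms)
  case (Cons x ms)
  have "(\<Sum>i<N. \<Sum>j<N. (U ^\<^sub>m m) $$ (i, j) * power_trace_prod_grad (x # ms) i j U)
      = of_nat x * (\<Sum>i<N. \<Sum>j<N. (U ^\<^sub>m m) $$ (i, j) * (U ^\<^sub>m x) $$ (j, i)) * power_trace_prod ms U
        + power_trace x U * (\<Sum>i<N. \<Sum>j<N. (U ^\<^sub>m m) $$ (i, j) * power_trace_prod_grad ms i j U)"
    by (simp add: sum_distrib_left sum_distrib_right sum.distrib distrib_left mult_ac)
  also have "(\<Sum>i<N. \<Sum>j<N. (U ^\<^sub>m m) $$ (i, j) * (U ^\<^sub>m x) $$ (j, i)) = power_trace (m + x) U"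
    unfolding power_trace_sum[OF assms] using times_index[OF pow_carrier_mat[OF assms] pow_carrier_mat[OF assms]]
    by (simp add: pow_mat_add[OF assms, symmetric] del: index_mult_mat(1))
  also note Cons.IH
  also have "power_trace x U * (\<Sum>(w, l)\<leftarrow>joins m ms. of_nat w * power_trace_prod l U)
      = (\<Sum>(w, l)\<leftarrow>joins m ms. of_nat w * power_trace_prod (x # l) U)"
    by (simp add: sum_list_const_mult[symmetric] case_prod_unfold mult.left_commute)
  finally show ?case by (simp add: o_def case_prod_unfold mult_ac)
qed simp

text \<open>Writing U^k as U^(k - m) U^m, unitarity cancels the two copies of U^m, which leaves the
  conjugated trace of U^(k - m).\<close>

lemma contract_pow_cnj:
  assumes U: "U \<in> unitary_group N" and mk: "m \<le> k"
  shows "(\<Sum>i<N. \<Sum>j<N. (U ^\<^sub>m m) $$ (i, j) * cnj ((U ^\<^sub>m k) $$ (i, j))) = cnj (power_trace (k - m) U)"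
proof -
  note Uc = unitary_groupD(1)[OF U]
  let ?A = "U ^\<^sub>m m" and ?Z = "U ^\<^sub>m (k - m)"
  note A = unitary_groupD[OF unitary_group_pow[OF U, of m]]
  have "(\<Sum>i<N. \<Sum>j<N. ?A $$ (i, j) * cnj ((U ^\<^sub>m k) $$ (i, j)))
      = (\<Sum>i<N. \<Sum>j<N. \<Sum>l<N. cnj (?Z $$ (i, l)) * (?A $$ (i, j) * cnj (?A $$ (l, j))))"
  proof (intro sum.cong refl)
    fix i j assume "i \<in> {..<N}" "j \<in> {..<N}"
    then have "(U ^\<^sub>m k) $$ (i, j) = (\<Sum>l<N. ?Z $$ (i, l) * ?A $$ (l, j))"
      using times_index[OF pow_carrier_mat[OF Uc] pow_carrier_mat[OF Uc], of i j "k - m" m] pow_mat_add[OF Uc, of "k - m" m] mk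
      by simp
    then show "?A $$ (i, j) * cnj ((U ^\<^sub>m k) $$ (i, j)) = (\<Sum>l<N. cnj (?Z $$ (i, l)) * (?A $$ (i, j) * cnj (?A $$ (l, j))))"
      by (simp add: sum_distrib_left mult_ac)
  qed
  also have "\<dots> = (\<Sum>i<N. \<Sum>l<N. cnj (?Z $$ (i, l)) * (\<Sum>j<N. ?A $$ (i, j) * cnj (?A $$ (l, j))))"
    unfolding sum_distrib_left by (rule sum.cong[OF refl], rule sum.swap)
  also have "\<dots> = (\<Sum>i<N. \<Sum>l<N. cnj (?Z $$ (i, l)) * (if i = l then 1 else 0))"
  proof (intro sum.cong refl arg_cong2[of _ _ _ _ "(*)"])
    fix i l assume il: "i \<in> {..<N}" "l \<in> {..<N}"
    have "(?A * mat_adjoint ?A) $$ (i, l) = (\<Sum>j<N. ?A $$ (i, j) * cnj (?A $$ (l, j)))"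
      using il A(1) Uc by (subst times_index[of _ N N _ N]) (auto intro!: sum.cong)
    then show "(\<Sum>j<N. ?A $$ (i, j) * cnj (?A $$ (l, j))) = (if i = l then 1 else 0)"
      using il A(3) by simp
  qed
  also have "\<dots> = (\<Sum>i<N. cnj (?Z $$ (i, i)))"
    by (simp add: if_distrib cong: if_cong)
  finally show ?thesis by (simp add: power_trace_sum[OF Uc])
qed

section \<open>Joint moments and the loop equation\<close>

definition trace_moment :: "nat list \<Rightarrow> nat \<Rightarrow> complex" where
  "trace_moment ms k = (LINT U|\<mu>. power_trace_prod ms U * cnj (power_trace k U))"

lemma bdd_meas_moment [intro]:
  "bdd_meas (\<lambda>U. power_trace_prod ms U * cnj (power_trace k U))"
  by (intro bdd_meas_mult bdd_meas_power_trace_prod bdd_meas_cnj bdd_meas_power_trace)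

lemma integral_sum_list:
  assumes "\<And>x. x \<in> set xs \<Longrightarrow> bdd_meas (f x)"
  shows "(LINT U|\<mu>. (\<Sum>x\<leftarrow>xs. f x U)) = (\<Sum>x\<leftarrow>xs. (LINT U|\<mu>. f x U))"
    and "bdd_meas (\<lambda>U. \<Sum>x\<leftarrow>xs. f x U)"
proof -
  have "(LINT U|\<mu>. (\<Sum>x\<leftarrow>xs. f x U)) = (\<Sum>x\<leftarrow>xs. (LINT U|\<mu>. f x U)) \<and> bdd_meas (\<lambda>U. \<Sum>x\<leftarrow>xs. f x U)"
    using assms
  proof (induction xs)
    case (Cons x xs)
    then show ?case using bdd_meas_integrable by auto
  qed auto
  then show "(LINT U|\<mu>. (\<Sum>x\<leftarrow>xs. f x U)) = (\<Sum>x\<leftarrow>xs. (LINT U|\<mu>. f x U))"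
    "bdd_meas (\<lambda>U. \<Sum>x\<leftarrow>xs. f x U)" by auto
qed

text \<open>The vanishing integral is applied to an entry of U^m times the product of traces times
  the conjugated trace of U^k. The three parts of the product rule give the three terms: U^m splits
  into two traces, it joins one of the other traces, or it cancels against U^k.\<close>

theorem loop_equation:
  assumes mk: "m \<le> k"
  shows "(\<Sum>l<m. trace_moment (l # (m - l) # ms) k) + (\<Sum>(w, l)\<leftarrow>joins m ms. of_nat w * trace_moment l k)
    = of_nat k * trace_moment ms (k - m)"
proof -
  let ?p = "\<lambda>l U. power_trace_prod l U * cnj (power_trace k U)"
  let ?q = "\<lambda>i j U. power_trace_prod_grad ms i j U * cnj (power_trace k U)
      + power_trace_prod ms U * - cnj (of_nat k * (U ^\<^sub>m k) $$ (i, j))"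
  let ?c = "\<lambda>a b i j U. (\<Sum>l<m. (U ^\<^sub>m l) $$ (a, i) * (U ^\<^sub>m (m - l)) $$ (j, b)) * ?p ms U + (U ^\<^sub>m m) $$ (a, b) * ?q i j U"
  have grad: "gradient (\<lambda>U. (U ^\<^sub>m m) $$ (a, b) * ?p ms U) (?c a b)" if "a < N" "b < N" for a b
    using that by (intro gradient_mult gradient_pow_entry gradient_power_trace_prod gradient_cnj[OF gradient_power_trace, of k])
  \<comment> \<open>For the entry (a, b) of U^m only the coefficient in direction (a, b) is used;
    summing over all entries then turns every factor into a trace.\<close>
  have "(LINT U|\<mu>. (\<Sum>i<N. \<Sum>j<N. ?c i j i j U)) = (\<Sum>i<N. \<Sum>j<N. LINT U|\<mu>. ?c i j i j U)"
  proof -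
    have int: "integrable \<mu> (?c i j i j)" if "i < N" "j < N" for i j
      using grad[OF that] that unfolding gradient_def by (auto intro: bdd_meas_integrable)
    show ?thesis by (rule integral_double_sum) (rule int)
  qed
  also have "\<dots> = 0"
    using gradient_integral_zero[OF grad] by simp
  finally have "(LINT U|\<mu>. (\<Sum>i<N. \<Sum>j<N. ?c i j i j U)) = 0" .
  moreover have "(LINT U|\<mu>. (\<Sum>i<N. \<Sum>j<N. ?c i j i j U))
      = (LINT U|\<mu>. ((\<Sum>l<m. ?p (l # (m - l) # ms) U) + (\<Sum>x\<leftarrow>joins m ms. of_nat (fst x) * ?p (snd x) U))
           - of_nat k * (power_trace_prod ms U * cnj (power_trace (k - m) U)))"
  proof (rule Bochner_Integration.integral_cong[OF refl])
    fix U assume "U \<in> space \<mu>"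
    then have U: "U \<in> unitary_group N" by simp
    note Uc = unitary_groupD(1)[OF U]
    have "(\<Sum>i<N. \<Sum>j<N. ?c i j i j U)
        = (\<Sum>i<N. \<Sum>j<N. \<Sum>l<m. (U ^\<^sub>m l) $$ (i, i) * (U ^\<^sub>m (m - l)) $$ (j, j)) * ?p ms U
        + (\<Sum>i<N. \<Sum>j<N. (U ^\<^sub>m m) $$ (i, j) * power_trace_prod_grad ms i j U) * cnj (power_trace k U)
        - of_nat k * (power_trace_prod ms U * (\<Sum>i<N. \<Sum>j<N. (U ^\<^sub>m m) $$ (i, j) * cnj ((U ^\<^sub>m k) $$ (i, j))))"
      unfolding sum_distrib_left sum_distrib_right sum.distrib[symmetric] sum_subtractf[symmetric]
      by (intro sum.cong refl) (simp add: algebra_simps sum_distrib_left sum_distrib_right)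
    also have "(\<Sum>i<N. \<Sum>j<N. \<Sum>l<m. (U ^\<^sub>m l) $$ (i, i) * (U ^\<^sub>m (m - l)) $$ (j, j))
        = (\<Sum>l<m. power_trace l U * power_trace (m - l) U)"
    proof -
      have "(\<Sum>i<N. \<Sum>j<N. \<Sum>l<m. (U ^\<^sub>m l) $$ (i, i) * (U ^\<^sub>m (m - l)) $$ (j, j))
          = (\<Sum>i<N. \<Sum>l<m. \<Sum>j<N. (U ^\<^sub>m l) $$ (i, i) * (U ^\<^sub>m (m - l)) $$ (j, j))"
        by (intro sum.cong refl sum.swap)
      also have "\<dots> = (\<Sum>l<m. \<Sum>i<N. \<Sum>j<N. (U ^\<^sub>m l) $$ (i, i) * (U ^\<^sub>m (m - l)) $$ (j, j))"
        by (rule sum.swap)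
      finally show ?thesis by (simp add: power_trace_sum[OF Uc] sum_product)
    qed
    finally show "(\<Sum>i<N. \<Sum>j<N. ?c i j i j U) = ((\<Sum>l<m. ?p (l # (m - l) # ms) U) + (\<Sum>x\<leftarrow>joins m ms. of_nat (fst x) * ?p (snd x) U))
           - of_nat k * (power_trace_prod ms U * cnj (power_trace (k - m) U))"
      unfolding contract_power_trace_prod_grad[OF Uc] contract_pow_cnj[OF U mk]
      by (simp add: sum_distrib_right mult.assoc sum_list_mult_const[symmetric] case_prod_unfold)
  qed
  moreover have "\<dots> = (\<Sum>l<m. trace_moment (l # (m - l) # ms) k) + (\<Sum>x\<leftarrow>joins m ms. of_nat (fst x) * trace_moment (snd x) k)
      - of_nat k * trace_moment ms (k - m)"
  proof -
    have b1: "bdd_meas (\<lambda>U. \<Sum>l<m. ?p (l # (m - l) # ms) U)"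
      by (intro bdd_meas_sum bdd_meas_moment)
    have b2: "bdd_meas (\<lambda>U. \<Sum>x\<leftarrow>joins m ms. of_nat (fst x) * ?p (snd x) U)"
      by (rule integral_sum_list(2)) (intro bdd_meas_mult[OF bdd_meas_const] bdd_meas_moment)
    have i2: "(LINT U|\<mu>. (\<Sum>x\<leftarrow>joins m ms. of_nat (fst x) * ?p (snd x) U))
        = (\<Sum>x\<leftarrow>joins m ms. of_nat (fst x) * trace_moment (snd x) k)"
      by (subst integral_sum_list(1))
        (auto intro!: bdd_meas_mult[OF bdd_meas_const] bdd_meas_moment simp: trace_moment_def)
    have i1: "(LINT U|\<mu>. (\<Sum>l<m. ?p (l # (m - l) # ms) U)) = (\<Sum>l<m. trace_moment (l # (m - l) # ms) k)"
      unfolding trace_moment_def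
      by (rule Bochner_Integration.integral_sum) (rule bdd_meas_integrable[OF bdd_meas_moment])
    show ?thesis
      unfolding i1[symmetric] i2[symmetric] unfolding trace_moment_def
      using bdd_meas_integrable[OF b1] bdd_meas_integrable[OF b2]
        bdd_meas_integrable[OF bdd_meas_moment[of ms "k - m"]]
      by simp
  qed
  ultimately show ?thesis by (simp add: case_prod_unfold)
qed

end

section \<open>Moments of traces of powers\<close>

lemma joins_sum: "(w, l) \<in> set (joins m ms) \<Longrightarrow> sum_list l = m + sum_list ms"
  by (induction ms arbitrary: w l) fastforce+

lemma joins_pos: "(w, l) \<in> set (joins m ms) \<Longrightarrow> 0 \<notin> set ms \<Longrightarrow> 0 \<notin> set l"
  by (induction ms arbitrary: w l) fastforce+

text \<open>Together with the m - 1 nontrivial splittings of m, these weights add up to k - 1 when m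
  and \<open>ms\<close> have total k: the off-diagonal row sum of the linear system.\<close>

lemma joins_weight: "(\<Sum>(w, l)\<leftarrow>joins m ms. w) = sum_list ms"
  by (induction ms) (simp_all add: o_def case_prod_unfold)

lemma norm_weighted_sum_list_le:
  fixes v :: "'a \<Rightarrow> complex"
  assumes "\<And>w l. (w, l) \<in> set xs \<Longrightarrow> cmod (v l) \<le> B"
  shows "cmod (\<Sum>(w, l)\<leftarrow>xs. of_nat w * v l) \<le> real (\<Sum>(w, l)\<leftarrow>xs. w) * B"
  using assms
proof (induction xs)
  case (Cons x xs)
  obtain w l where x: "x = (w, l)" by (cases x)
  have "cmod (of_nat w * v l) \<le> real w * B"
    using Cons.prems[of w l] unfolding norm_mult x by (simp add: mult_left_mono)
  moreover have "cmod (\<Sum>(w, l)\<leftarrow>xs. of_nat w * v l) \<le> real (\<Sum>(w, l)\<leftarrow>xs. w) * B"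
    using Cons by auto
  ultimately show ?case
    unfolding x using norm_triangle_mono[of "of_nat w * v l"] by (simp add: distrib_right)
qed simp

lemma length_le_sum_list: "0 \<notin> set ms \<Longrightarrow> length ms \<le> sum_list ms" for ms :: "nat list"
  by (induction ms) auto

lemma cmod_power_trace_prod_le:
  assumes "U \<in> unitary_group N"
  shows "cmod (power_trace_prod ms U) \<le> real N ^ length ms"
  using cmod_power_trace_le[OF assms]
  by (induction ms) (auto simp: norm_mult intro!: mult_mono)

context haar begin

lemma cmod_trace_moment_le:
  "cmod (trace_moment ms k) \<le> real N ^ Suc (length ms)"
proof -
  have "cmod (trace_moment ms k) \<le> (LINT U|\<mu>. cmod (power_trace_prod ms U * cnj (power_trace k U)))"
    unfolding trace_moment_def by (rule integral_norm_bound)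
  also have "\<dots> \<le> real N ^ Suc (length ms)"
  proof (intro integral_le_const AE_I2)
    show "integrable \<mu> (\<lambda>U. cmod (power_trace_prod ms U * cnj (power_trace k U)))"
      by (intro integrable_norm bdd_meas_integrable bdd_meas_moment)
    fix U assume "U \<in> space \<mu>"
    then have U: "U \<in> unitary_group N" by simp
    show "cmod (power_trace_prod ms U * cnj (power_trace k U)) \<le> real N ^ Suc (length ms)"
      using mult_mono[OF cmod_power_trace_prod_le[OF U, of ms] cmod_power_trace_le[OF U, of k]]
      by (simp add: norm_mult mult.commute)
  qed
  finally show ?thesis .
qed

lemma trace_moment_zero_part: "trace_moment (0 # ms) k = of_nat N * trace_moment ms k"
proof -
  have "trace_moment (0 # ms) k = (LINT U|\<mu>. of_nat N * (power_trace_prod ms U * cnj (power_trace k U)))"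
    unfolding trace_moment_def
    by (rule Bochner_Integration.integral_cong[OF refl]) (simp add: power_trace_0[OF unitary_groupD(1)])
  then show ?thesis by (simp add: trace_moment_def)
qed

lemma trace_moment_Nil_0: "trace_moment [] 0 = of_nat N"
proof -
  have "trace_moment [] 0 = (LINT U|\<mu>. of_nat N)"
    unfolding trace_moment_def
    by (rule Bochner_Integration.integral_cong[OF refl]) (simp add: power_trace_0[OF unitary_groupD(1)])
  then show ?thesis using prob_space by simp
qed

text \<open>Let \<open>B\<close> be the supremum of the moments over all lists of positive numbers
  with sum k. Solving the loop equation for its diagonal term gives N B \<le> (k - 1) B + k N. Since
  k - 1 is at most N / 2, the first term is absorbed and B \<le> 2 k remains.\<close>

theorem trace_moment_bound:
  assumes "1 \<le> k" "2 * k \<le> N" "0 \<notin> set ms" "sum_list ms = k"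
  shows "cmod (trace_moment ms k) \<le> 2 * real k"
  using assms
proof (induction k arbitrary: ms rule: less_induct)
  case (less k)
  define M where "M = {ms :: nat list. 0 \<notin> set ms \<and> sum_list ms = k}"
  define B where "B = (SUP ms\<in>M. cmod (trace_moment ms k))"
  have N: "N > 0" using less.prems by auto
  \<comment> \<open>The trivial bound N^(k + 1) makes the supremum finite; its size is irrelevant,
    as \<open>B\<close> is only moved to the other side of an inequality.\<close>
  have bdd: "bdd_above ((\<lambda>ms. cmod (trace_moment ms k)) ` M)"
  proof (rule bdd_aboveI2)
    fix ms assume "ms \<in> M"
    then have "length ms \<le> k" using length_le_sum_list by (auto simp: M_def)
    then have "real N ^ Suc (length ms) \<le> real N ^ Suc k" using N by (intro power_increasing) auto
    then show "cmod (trace_moment ms k) \<le> real N ^ Suc k" using cmod_trace_moment_le order_trans by blast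
  qed
  have leB: "cmod (trace_moment ms k) \<le> B" if "ms \<in> M" for ms
    unfolding B_def by (rule cSUP_upper[OF that bdd])
  have ne: "M \<noteq> {}" using less.prems by (auto simp: M_def)
  have B0: "B \<ge> 0" using leB ne norm_ge_zero order_trans by blast
  have step: "cmod (trace_moment ms k) \<le> ((real k - 1) * B + real k * real N) / real N" if "ms \<in> M" for ms
  proof -
    note msM = that
    obtain m ms' where ms: "ms = m # ms'" using msM less.prems(1) by (cases ms) (auto simp: M_def)
    have m: "m > 0" "m \<le> k" "m + sum_list ms' = k" "0 \<notin> set ms'" using that by (auto simp: M_def ms)
    \<comment> \<open>If no traces are left, then k = m and the moment is the trace of the identity;
      otherwise the induction hypothesis gives 2 (k - m) \<le> N.\<close>
    have R: "cmod (trace_moment ms' (k - m)) \<le> real N"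
    proof (cases ms')
      case Nil
      then show ?thesis using m by (simp add: trace_moment_Nil_0)
    next
      case (Cons x xs)
      then have "cmod (trace_moment ms' (k - m)) \<le> 2 * real (k - m)"
        using m less.prems by (intro less.IH) auto
      also have "\<dots> \<le> real N" using less.prems by simp
      finally show ?thesis .
    qed
    define X where "X = (\<Sum>l\<in>{1..<m}. trace_moment (l # (m - l) # ms') k)"
    define Y where "Y = (\<Sum>(w, l)\<leftarrow>joins m ms'. of_nat w * trace_moment l k)"
    \<comment> \<open>The splitting with l = 0 contains the trace of the identity and returns N
      times the original moment: this is the diagonal term.\<close>
    have "{..<m} = insert 0 {1..<m}" using m by auto
    then have "(\<Sum>l<m. trace_moment (l # (m - l) # ms') k) = of_nat N * trace_moment ms k + X"
      by (simp add: X_def trace_moment_zero_part ms)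
    then have "of_nat N * trace_moment ms k = of_nat k * trace_moment ms' (k - m) - X - Y"
      using loop_equation[OF m(2), of ms'] by (simp add: Y_def algebra_simps)
    then have "real N * cmod (trace_moment ms k) = cmod (of_nat k * trace_moment ms' (k - m) - X - Y)"
      by (metis norm_mult norm_of_nat)
    also have "\<dots> \<le> cmod (of_nat k * trace_moment ms' (k - m)) + cmod X + cmod Y"
      by (meson norm_triangle_ineq4 order_trans add_right_mono)
    also have "\<dots> \<le> real k * real N + (real m - 1) * B + real (sum_list ms') * B"
    proof (intro add_mono)
      show "cmod (of_nat k * trace_moment ms' (k - m)) \<le> real k * real N"
        using R by (simp add: norm_mult mult_left_mono)
      have "cmod X \<le> (\<Sum>l\<in>{1..<m}. B)"
        unfolding X_def using m by (intro sum_norm_le leB) (auto simp: M_def)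
      then show "cmod X \<le> (real m - 1) * B" using m by (simp add: of_nat_diff)
      have "cmod Y \<le> real (\<Sum>(w, l)\<leftarrow>joins m ms'. w) * B"
        unfolding Y_def
      proof (rule norm_weighted_sum_list_le)
        fix w l assume l: "(w, l) \<in> set (joins m ms')"
        show "cmod (trace_moment l k) \<le> B"
          using joins_sum[OF l] joins_pos[OF l m(4)] m by (intro leB) (auto simp: M_def)
      qed
      then show "cmod Y \<le> real (sum_list ms') * B" by (simp add: joins_weight)
    qed
    also have "\<dots> = (real k - 1) * B + real k * real N"
      using m(3) by (auto simp: algebra_simps)
    finally show ?thesis using N by (simp add: field_simps)
  qed
  have "B \<le> ((real k - 1) * B + real k * real N) / real N"
    unfolding B_def[abs_def] by (rule cSUP_least[OF ne]) (use step in \<open>simp add: B_def\<close>)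
  then have "real N * B \<le> (real k - 1) * B + real k * real N" using N by (simp add: field_simps)
  moreover have "(real k - 1) * B \<le> (real N / 2) * B"
    using less.prems B0 by (intro mult_right_mono) auto
  ultimately have "real N * B \<le> real N * (2 * real k)" by (simp add: algebra_simps)
  then have "B \<le> 2 * real k" using N by simp
  then show ?case using leB[of ms] less.prems by (auto simp: M_def)
qed

lemma power_trace_second_moment:
  assumes "1 \<le> k" "2 * k \<le> N"
  shows "(LINT U|\<mu>. (cmod (power_trace k U))\<^sup>2) \<le> 2 * real k"
proof -
  have "trace_moment [k] k = (LINT U|\<mu>. complex_of_real ((cmod (power_trace k U))\<^sup>2))"
    unfolding trace_moment_def by (rule Bochner_Integration.integral_cong[OF refl]) (simp add: complex_norm_square[symmetric])
  also have "\<dots> = complex_of_real (LINT U|\<mu>. (cmod (power_trace k U))\<^sup>2)"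
    by (rule integral_complex_of_real)
  finally have "cmod (trace_moment [k] k) = \<bar>LINT U|\<mu>. (cmod (power_trace k U))\<^sup>2\<bar>" by simp
  then show ?thesis using trace_moment_bound[of k "[k]"] assms by simp
qed

lemma integrable_cmod_power_trace: "integrable \<mu> (\<lambda>U. cmod (power_trace k U))"
  using bdd_meas_integrable[OF bdd_meas_power_trace] by (rule integrable_norm)

text \<open>The inequality x \<le> (1 + x^2) / 2 reduces this to the second moment. A bound linear
  in k, rather than of order sqrt k, affects only the constant in the final exponent.\<close>

lemma power_trace_first_moment:
  assumes "1 \<le> k" "2 * k \<le> N"
  shows "(LINT U|\<mu>. cmod (power_trace k U)) \<le> 1 + real k"
proof -
  have int: "integrable \<mu> (\<lambda>U. (cmod (power_trace k U))\<^sup>2)"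
  proof -
    have "integrable \<mu> (\<lambda>U. cmod (power_trace k U * power_trace k U))"
      by (rule integrable_norm) (intro bdd_meas_integrable bdd_meas_mult bdd_meas_power_trace)
    then show ?thesis by (simp add: norm_mult power2_eq_square)
  qed
  have le: "x \<le> 1 / 2 + x\<^sup>2 / 2" for x :: real
    using sum_squares_bound[of x 1] by simp
  have "(LINT U|\<mu>. cmod (power_trace k U)) \<le> (LINT U|\<mu>. 1 / 2 + (cmod (power_trace k U))\<^sup>2 / 2)"
    by (rule integral_mono[OF integrable_cmod_power_trace]) (use int le in auto)
  also have "\<dots> = 1 / 2 + (LINT U|\<mu>. (cmod (power_trace k U))\<^sup>2) / 2"
    using int prob_space by simp
  also have "\<dots> \<le> 1 + real k" using power_trace_second_moment[OF assms] by simp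
  finally show ?thesis .
qed

end

section \<open>Rigidity of angles with small power sums\<close>

abbreviation grid :: "nat \<Rightarrow> nat \<Rightarrow> real" where
  "grid K j \<equiv> 2 * pi * real j / real K"

text \<open>The Fejer kernel centred at a grid point and scaled to have value 1 there. It acts as a
  smoothed indicator of a neighbourhood of that point, and being a trigonometric polynomial with
  frequencies below \<open>K\<close> in absolute value it is controlled by power sums.\<close>

definition fejer_weight :: "nat \<Rightarrow> nat \<Rightarrow> real \<Rightarrow> real" where
  "fejer_weight K j x = (cmod (\<Sum>k<K. cis (real k * (x - grid K j))))\<^sup>2 / (real K)\<^sup>2"

lemma fejer_weight_nonneg: "fejer_weight K j x \<ge> 0"
  by (simp add: fejer_weight_def)

lemma fejer_weight_expand:
  assumes "K > 0"
  shows "complex_of_real (fejer_weight K j x * (real K)\<^sup>2) =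
    (\<Sum>k<K. \<Sum>l<K. cis (- ((real k - real l) * grid K j)) * cis ((real k - real l) * x))"
proof -
  let ?y = "x - grid K j"
  have "complex_of_real (fejer_weight K j x * (real K)\<^sup>2) = complex_of_real ((cmod (\<Sum>k<K. cis (real k * ?y)))\<^sup>2)"
    using assms by (simp add: fejer_weight_def)
  also have "\<dots> = (\<Sum>k<K. cis (real k * ?y)) * (\<Sum>l<K. cis (- (real l * ?y)))"
    by (simp add: complex_norm_square cis_cnj del: of_real_power)
  also have "\<dots> = (\<Sum>k<K. \<Sum>l<K. cis (- ((real k - real l) * grid K j)) * cis ((real k - real l) * x))"
    unfolding sum_product cis_mult
    by (intro sum.cong refl arg_cong[of _ _ cis]) (simp add: algebra_simps diff_divide_distrib add_divide_distrib)
  finally show ?thesis .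
qed

lemma sum_roots_of_unity:
  assumes "k < K" "l < K"
  shows "(\<Sum>j<K. cis (- ((real k - real l) * grid K j))) = (if k = l then of_nat K else 0)"
proof (cases "k = l")
  case False
  define r where "r = cis (- ((real k - real l) * (2 * pi / real K)))"
  have K: "real K > 0" using assms by simp
  have pow: "cis (- ((real k - real l) * grid K j)) = r ^ j" for j
    unfolding r_def Complex.DeMoivre by (intro arg_cong[of _ _ cis]) (simp add: mult_ac)
  have "r ^ K = cis (2 * pi * (of_int (int l - int k)))"
    unfolding pow[symmetric] using K by (intro arg_cong[of _ _ cis]) (simp add: field_simps)
  then have "r ^ K = 1" by (simp only: cis_multiple_2pi Ints_of_int)
  moreover have "r \<noteq> 1"
  proof
    assume "r = 1"
    then have "cos (- ((real k - real l) * (2 * pi / real K))) = 1"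
      by (simp add: r_def complex_eq_iff)
    then obtain n :: int where "- ((real k - real l) * (2 * pi / real K)) = of_int n * 2 * pi"
      using cos_one_2pi_int by blast
    then have "2 * pi * (real l - real k) = 2 * pi * (of_int n * real K)" using K by (simp add: field_simps)
    then have "real l - real k = of_int n * real K" by (subst (asm) mult_left_cancel) auto
    then have "int l - int k = n * int K" by (metis of_int_diff of_int_eq_iff of_int_mult of_int_of_nat_eq)
    then have "int K dvd int l - int k" by simp
    moreover have "\<bar>int l - int k\<bar> < int K" using assms by auto
    ultimately have "int l - int k = 0" using dvd_imp_le_int[of "int l - int k" "int K"] by linarith
    then show False using False by simp
  qed
  ultimately have "(\<Sum>j<K. r ^ j) = 0" by (simp add: geometric_sum)
  then show ?thesis unfolding pow using False by simp
qed simp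

text \<open>Summing the translates over the grid annihilates every frequency that is not a multiple
  of \<open>K\<close>; only the constant term survives.\<close>

lemma fejer_weight_partition:
  assumes "K > 0"
  shows "(\<Sum>j<K. fejer_weight K j x) = 1"
proof -
  have "complex_of_real ((\<Sum>j<K. fejer_weight K j x) * (real K)\<^sup>2)
      = (\<Sum>j<K. \<Sum>k<K. \<Sum>l<K. cis (- ((real k - real l) * grid K j)) * cis ((real k - real l) * x))"
    unfolding sum_distrib_right of_real_sum by (intro sum.cong refl fejer_weight_expand assms)
  also have "\<dots> = (\<Sum>k<K. \<Sum>l<K. \<Sum>j<K. cis (- ((real k - real l) * grid K j)) * cis ((real k - real l) * x))"
    by (subst sum.swap) (intro sum.cong refl sum.swap)
  also have "\<dots> = (\<Sum>k<K. \<Sum>l<K. if k = l then of_nat K else 0)"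
    unfolding sum_distrib_right[symmetric] by (intro sum.cong refl) (subst sum_roots_of_unity, auto)
  also have "\<dots> = complex_of_real ((real K)\<^sup>2)" by (simp add: power2_eq_square)
  finally have "(\<Sum>j<K. fejer_weight K j x) * (real K)\<^sup>2 = (real K)\<^sup>2" using of_real_eq_iff by blast
  then show ?thesis using assms by simp
qed

definition power_sum :: "nat \<Rightarrow> (nat \<Rightarrow> real) \<Rightarrow> nat \<Rightarrow> complex" where
  "power_sum N \<theta> d = (\<Sum>i<N. cis (real d * \<theta> i))"

definition power_sum_total :: "nat \<Rightarrow> (nat \<Rightarrow> real) \<Rightarrow> nat \<Rightarrow> real" where
  "power_sum_total N \<theta> K = (\<Sum>d\<in>{1..<K}. cmod (power_sum N \<theta> d))"

lemma power_sum_total_nonneg: "power_sum_total N \<theta> K \<ge> 0"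
  by (simp add: power_sum_total_def sum_nonneg)

text \<open>For fixed \<open>k\<close> each frequency d occurs at most twice, as d and as -d, and
  the two power sums are conjugate. Hence the factor 2.\<close>

lemma power_sum_differences:
  assumes "k < K"
  shows "(\<Sum>l\<in>{..<K} - {k}. cmod (\<Sum>i<N. cis ((real k - real l) * \<theta> i))) \<le> 2 * power_sum_total N \<theta> K"
proof -
  have "l \<in> {..<K} - {k} \<longleftrightarrow> l \<in> {..<k} \<union> {k<..<K}" for l
    unfolding Diff_iff Un_iff lessThan_iff greaterThanLessThan_iff singleton_iff using assms by linarith
  then have split: "{..<K} - {k} = {..<k} \<union> {k<..<K}" by (intro Set.set_eqI)
  have "(\<Sum>l\<in>{..<K} - {k}. cmod (\<Sum>i<N. cis ((real k - real l) * \<theta> i)))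
      = (\<Sum>l<k. cmod (\<Sum>i<N. cis ((real k - real l) * \<theta> i))) + (\<Sum>l\<in>{k<..<K}. cmod (\<Sum>i<N. cis ((real k - real l) * \<theta> i)))"
    unfolding split by (intro sum.union_disjoint) auto
  also have "(\<Sum>l<k. cmod (\<Sum>i<N. cis ((real k - real l) * \<theta> i))) = (\<Sum>d\<in>(\<lambda>l. k - l) ` {..<k}. cmod (power_sum N \<theta> d))"
    by (subst sum.reindex) (auto simp: inj_on_def power_sum_def of_nat_diff intro!: sum.cong)
  also have "\<dots> \<le> power_sum_total N \<theta> K"
    unfolding power_sum_total_def using assms by (intro sum_mono2) auto
  also have "(\<Sum>l\<in>{k<..<K}. cmod (\<Sum>i<N. cis ((real k - real l) * \<theta> i))) = (\<Sum>d\<in>(\<lambda>l. l - k) ` {k<..<K}. cmod (power_sum N \<theta> d))"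
  proof (subst sum.reindex)
    show "inj_on (\<lambda>l. l - k) {k<..<K}" by (auto simp: inj_on_def)
    have "cmod (\<Sum>i<N. cis ((real k - real l) * \<theta> i)) = cmod (power_sum N \<theta> (l - k))" if "l \<in> {k<..<K}" for l
    proof -
      have "(\<Sum>i<N. cis ((real k - real l) * \<theta> i)) = cnj (power_sum N \<theta> (l - k))"
        unfolding power_sum_def cnj_sum cis_cnj using that
        by (intro sum.cong refl arg_cong[of _ _ cis]) (auto simp: of_nat_diff algebra_simps)
      then show ?thesis by simp
    qed
    then show "(\<Sum>l\<in>{k<..<K}. cmod (\<Sum>i<N. cis ((real k - real l) * \<theta> i)))
        = sum ((\<lambda>d. cmod (power_sum N \<theta> d)) \<circ> (\<lambda>l. l - k)) {k<..<K}" by simp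
  qed
  also have "\<dots> \<le> power_sum_total N \<theta> K"
    unfolding power_sum_total_def using assms by (intro sum_mono2) auto
  finally show ?thesis by simp
qed

text \<open>In the expansion the \<open>K\<close> diagonal pairs contribute N each, which is the
  equidistributed value. The remaining pairs are bounded row by row by the power sums.\<close>

lemma fejer_mass:
  assumes K: "K > 0"
  shows "\<bar>(\<Sum>i<N. fejer_weight K j (\<theta> i)) - real N / real K\<bar> \<le> 2 * power_sum_total N \<theta> K / real K"
proof -
  let ?e = "\<lambda>k l. cis (- ((real k - real l) * grid K j))"
  let ?s = "\<lambda>k l. \<Sum>i<N. cis ((real k - real l) * \<theta> i)"
  have "complex_of_real ((\<Sum>i<N. fejer_weight K j (\<theta> i)) * (real K)\<^sup>2)
      = (\<Sum>i<N. \<Sum>k<K. \<Sum>l<K. ?e k l * cis ((real k - real l) * \<theta> i))"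
    unfolding sum_distrib_right of_real_sum by (intro sum.cong refl fejer_weight_expand K)
  also have "\<dots> = (\<Sum>k<K. \<Sum>l<K. \<Sum>i<N. ?e k l * cis ((real k - real l) * \<theta> i))"
    by (subst sum.swap) (intro sum.cong refl sum.swap)
  also have "\<dots> = (\<Sum>k<K. \<Sum>l<K. ?e k l * ?s k l)"
    by (simp add: sum_distrib_left)
  also have "\<dots> = (\<Sum>k<K. of_nat N + (\<Sum>l\<in>{..<K} - {k}. ?e k l * ?s k l))"
    by (intro sum.cong refl) (subst sum.remove, auto)
  also have "\<dots> = of_nat (N * K) + (\<Sum>k<K. \<Sum>l\<in>{..<K} - {k}. ?e k l * ?s k l)"
    by (simp add: sum.distrib)
  finally have eq: "complex_of_real ((\<Sum>i<N. fejer_weight K j (\<theta> i)) * (real K)\<^sup>2 - real N * real K)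
      = (\<Sum>k<K. \<Sum>l\<in>{..<K} - {k}. ?e k l * ?s k l)"
    by simp
  have "\<bar>(\<Sum>i<N. fejer_weight K j (\<theta> i)) * (real K)\<^sup>2 - real N * real K\<bar>
      = cmod (\<Sum>k<K. \<Sum>l\<in>{..<K} - {k}. ?e k l * ?s k l)"
    unfolding eq[symmetric] by (rule norm_of_real[symmetric])
  also have "\<dots> \<le> (\<Sum>k<K. 2 * power_sum_total N \<theta> K)"
  proof (rule sum_norm_le)
    fix k assume "k \<in> {..<K}"
    have "cmod (\<Sum>l\<in>{..<K} - {k}. ?e k l * ?s k l) \<le> (\<Sum>l\<in>{..<K} - {k}. cmod (?s k l))"
      by (rule sum_norm_le) (simp add: norm_mult)
    also have "\<dots> \<le> 2 * power_sum_total N \<theta> K"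
      using \<open>k \<in> {..<K}\<close> by (intro power_sum_differences) simp
    finally show "cmod (\<Sum>l\<in>{..<K} - {k}. ?e k l * ?s k l) \<le> 2 * power_sum_total N \<theta> K" .
  qed
  finally have "\<bar>(\<Sum>i<N. fejer_weight K j (\<theta> i)) * (real K)\<^sup>2 - real N * real K\<bar> \<le> real K * (2 * power_sum_total N \<theta> K)"
    by simp
  moreover have "(\<Sum>i<N. fejer_weight K j (\<theta> i)) * (real K)\<^sup>2 - real N * real K
      = (real K)\<^sup>2 * ((\<Sum>i<N. fejer_weight K j (\<theta> i)) - real N / real K)"
    using K by (simp add: power2_eq_square algebra_simps)
  ultimately have "(real K)\<^sup>2 * \<bar>(\<Sum>i<N. fejer_weight K j (\<theta> i)) - real N / real K\<bar> \<le> real K * (2 * power_sum_total N \<theta> K)"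
    by (simp add: abs_mult)
  then show ?thesis using K by (simp add: power2_eq_square field_simps)
qed

text \<open>The two-sided condition says that the distance on the circle is at least
  \<open>\<eta>\<close>. The geometric sum is at most 2 / |r - 1| in modulus, and |r - 1| = 2 sin (y
  / 2) is at least \<eta> / 2.\<close>

lemma fejer_weight_far:
  assumes K: "K > 0" and \<eta>: "0 < \<eta>" "\<eta> \<le> 1"
    and far: "\<eta> \<le> \<bar>x - grid K j\<bar>" "\<bar>x - grid K j\<bar> \<le> 2 * pi - \<eta>"
  shows "fejer_weight K j x \<le> 16 / ((real K)\<^sup>2 * \<eta>\<^sup>2)"
proof -
  define y where "y = \<bar>x - grid K j\<bar>"
  define r where "r = cis (x - grid K j)"
  have cosy: "cos (x - grid K j) = cos y" unfolding y_def by (simp only: cos_abs_real)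
  \<comment> \<open>The sine is smallest at the ends of the admissible range, which are symmetric
    about y = pi. There the mean value theorem applies, with cosine at least 1/2 because \<eta> / 2
    \<le> 1 < pi / 3.\<close>
  have sin: "sin (y / 2) \<ge> \<eta> / 4"
  proof -
    have low: "sin u \<ge> \<eta> / 4" if "\<eta> / 2 \<le> u" "u \<le> pi / 2" for u
    proof -
      have "sin (\<eta> / 2) \<le> sin u" using that \<eta> pi_gt_zero by (intro sin_monotone_2pi_le) auto
      moreover have "\<eta> / 4 \<le> sin (\<eta> / 2)"
      proof -
        let ?h = "\<eta> / 2"
        have h: "0 < ?h" "?h \<le> 1" using \<eta> by auto
        have c: "cos t \<ge> 1 / 2" if "0 \<le> t" "t \<le> ?h" for t
        proof -
          have "cos (pi / 3) \<le> cos t" using that h pi_gt3 by (intro cos_monotone_0_pi_le) auto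
          then show ?thesis by (simp add: cos_60)
        qed
        have "\<exists>t. 0 < t \<and> t < ?h \<and> sin ?h - sin 0 = (?h - 0) * cos t"
          using h by (intro MVT2) (auto intro: DERIV_sin)
        then obtain t where t: "0 < t" "t < ?h" "sin ?h = ?h * cos t" by auto
        have "?h * (1 / 2) \<le> ?h * cos t" using c[of t] t h by (intro mult_left_mono) auto
        then have "?h * (1 / 2) \<le> sin ?h" unfolding t(3) .
        then show ?thesis by simp
      qed
      ultimately show ?thesis by simp
    qed
    show ?thesis
    proof (cases "y \<le> pi")
      case True
      then show ?thesis using far by (intro low) (auto simp: y_def)
    next
      case False
      have "sin (pi - y / 2) \<ge> \<eta> / 4" using False far by (intro low) (auto simp: y_def)
      then show ?thesis by simp
    qed
  qed
  have "(cmod (r - 1))\<^sup>2 = 2 - 2 * cos y"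
  proof -
    have "(cmod (r - 1))\<^sup>2 = (cos (x - grid K j) - 1)\<^sup>2 + (sin (x - grid K j))\<^sup>2"
      by (simp add: cmod_power2 r_def)
    also have "\<dots> = 2 - 2 * cos (x - grid K j)"
      using sin_cos_squared_add[of "x - grid K j"] by (simp add: power2_eq_square algebra_simps)
    finally show ?thesis by (simp add: cosy)
  qed
  also have "\<dots> = 4 * (sin (y / 2))\<^sup>2"
    using cos_double_sin[of "y / 2"] by simp
  also have "\<dots> \<ge> 4 * (\<eta> / 4)\<^sup>2"
    using sin \<eta> by (intro mult_left_mono power_mono) auto
  finally have r1: "(cmod (r - 1))\<^sup>2 \<ge> \<eta>\<^sup>2 / 4" by (simp add: power2_eq_square)
  then have "r \<noteq> 1" using \<eta> by auto
  have sum: "(\<Sum>k<K. cis (real k * (x - grid K j))) = (\<Sum>k<K. r ^ k)"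
    by (simp add: r_def Complex.DeMoivre)
  have "cmod (\<Sum>k<K. r ^ k) * cmod (r - 1) = cmod (r ^ K - 1)"
    using \<open>r \<noteq> 1\<close> by (simp add: geometric_sum norm_divide)
  also have "\<dots> \<le> 2"
    using norm_triangle_ineq4[of "r ^ K" 1] by (simp add: r_def norm_power)
  finally have "(cmod (\<Sum>k<K. r ^ k) * cmod (r - 1))\<^sup>2 \<le> 2\<^sup>2" by (intro power_mono) auto
  then have "(cmod (\<Sum>k<K. r ^ k))\<^sup>2 * (cmod (r - 1))\<^sup>2 \<le> 4" by (simp add: power_mult_distrib)
  moreover have "(cmod (\<Sum>k<K. r ^ k))\<^sup>2 * (\<eta>\<^sup>2 / 4) \<le> (cmod (\<Sum>k<K. r ^ k))\<^sup>2 * (cmod (r - 1))\<^sup>2"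
    using r1 by (intro mult_left_mono) auto
  ultimately have "(cmod (\<Sum>k<K. r ^ k))\<^sup>2 \<le> 16 / \<eta>\<^sup>2"
    using \<eta> by (simp add: field_simps)
  then have "fejer_weight K j x \<le> (16 / \<eta>\<^sup>2) / (real K)\<^sup>2"
    unfolding fejer_weight_def sum by (intro divide_right_mono) auto
  then show ?thesis by (simp add: mult.commute)
qed

section \<open>Counting angles in arcs\<close>

lemma card_nat_interval_le:
  fixes J :: "nat set"
  assumes "finite J" "\<And>j. j \<in> J \<Longrightarrow> u \<le> real j" "\<And>j. j \<in> J \<Longrightarrow> real j \<le> v" "u \<le> v + 1"
  shows "real (card J) \<le> v - u + 1"
proof (cases "J = {}")
  case False
  have "J \<subseteq> {Min J..Max J}" using assms(1) by auto
  then have "card J \<le> card {Min J..Max J}" by (intro card_mono) auto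
  also have "\<dots> = Suc (Max J) - Min J" by simp
  finally have "real (card J) \<le> real (Max J) - real (Min J) + 1"
    using Min_le[OF assms(1) Max_in[OF assms(1) False]] by (simp add: of_nat_diff)
  also have "\<dots> \<le> v - u + 1"
    using assms(2)[OF Min_in[OF assms(1) False]] assms(3)[OF Max_in[OF assms(1) False]] by simp
  finally show ?thesis .
qed (use assms in simp)

text \<open>Every angle distributes a unit mass over the grid points. An angle from \<open>I\<close>
  loses at most K b of it outside \<open>J\<close>, whereas all angles together put only about N / K
  on each grid point of \<open>J\<close>. Comparing the two masses bounds the size of
  \<open>I\<close>.\<close>

lemma arc_count_le:
  assumes K: "K > 0" and I: "I \<subseteq> {..<N}" and J: "J \<subseteq> {..<K}" and b: "b \<ge> 0"
    and far: "\<And>i j. i \<in> I \<Longrightarrow> j \<in> {..<K} - J \<Longrightarrow> fejer_weight K j (\<theta> i) \<le> b"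
  shows "real (card I) \<le> real N * real K * b + real (card J) * real N / real K + 2 * power_sum_total N \<theta> K"
proof -
  have finI: "finite I" and finJ: "finite J" using I J finite_subset by blast+
  have cI: "real (card I) \<le> real N" using card_mono[OF _ I] by simp
  have cJ: "real (card J) \<le> real K" using card_mono[OF _ J] by simp
  have low: "1 - real K * b \<le> (\<Sum>j\<in>J. fejer_weight K j (\<theta> i))" if "i \<in> I" for i
  proof -
    have "1 = (\<Sum>j\<in>J. fejer_weight K j (\<theta> i)) + (\<Sum>j\<in>{..<K} - J. fejer_weight K j (\<theta> i))"
      using fejer_weight_partition[OF K, of "\<theta> i"] J by (simp add: sum.subset_diff)
    moreover have "(\<Sum>j\<in>{..<K} - J. fejer_weight K j (\<theta> i)) \<le> (\<Sum>j\<in>{..<K} - J. b)"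
      by (intro sum_mono far that)
    moreover have "(\<Sum>j\<in>{..<K} - J. b) \<le> real K * b"
      using card_mono[of "{..<K}" "{..<K} - J"] b by (simp add: mult_right_mono)
    ultimately show ?thesis by linarith
  qed
  have "real (card I) * (1 - real K * b) \<le> (\<Sum>i\<in>I. \<Sum>j\<in>J. fejer_weight K j (\<theta> i))"
    using sum_mono[of I "\<lambda>_. 1 - real K * b", OF low] by simp
  also have "\<dots> \<le> (\<Sum>i<N. \<Sum>j\<in>J. fejer_weight K j (\<theta> i))"
    using I by (intro sum_mono2) (auto intro!: sum_nonneg fejer_weight_nonneg)
  also have "\<dots> = (\<Sum>j\<in>J. \<Sum>i<N. fejer_weight K j (\<theta> i))" by (rule sum.swap)
  also have "\<dots> \<le> (\<Sum>j\<in>J. real N / real K + 2 * power_sum_total N \<theta> K / real K)"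
  proof (rule sum_mono)
    fix j assume "j \<in> J"
    show "(\<Sum>i<N. fejer_weight K j (\<theta> i)) \<le> real N / real K + 2 * power_sum_total N \<theta> K / real K"
      using fejer_mass[OF K, where N = N and j = j and \<theta> = \<theta>] by linarith
  qed
  also have "\<dots> = real (card J) * real N / real K + 2 * power_sum_total N \<theta> K * (real (card J) / real K)"
    by (simp add: field_simps)
  also have "\<dots> \<le> real (card J) * real N / real K + 2 * power_sum_total N \<theta> K * 1"
    using cJ K power_sum_total_nonneg[of N \<theta> K] by (intro add_left_mono mult_left_mono) auto
  finally have "real (card I) * (1 - real K * b) \<le> real (card J) * real N / real K + 2 * power_sum_total N \<theta> K" by simp
  moreover have "real (card I) * (real K * b) \<le> real N * (real K * b)"
    using cI b by (intro mult_right_mono) auto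
  ultimately show ?thesis by (simp add: algebra_simps)
qed

text \<open>The terms are, in order, the tails of the kernel, the widening of an arc by
  \<open>\<eta>\<close> at both ends, the rounding to grid points in two intervals, and the
  deviation from equidistribution.\<close>

definition discrepancy_bound :: "nat \<Rightarrow> (nat \<Rightarrow> real) \<Rightarrow> nat \<Rightarrow> real \<Rightarrow> real" where
  "discrepancy_bound N \<theta> K \<eta> = real N * (16 / (real K * \<eta>\<^sup>2) + \<eta> / pi + 2 / real K) + 2 * power_sum_total N \<theta> K"

text \<open>\<open>J1\<close> and \<open>J2\<close> together are the grid points within
  \<open>\<eta>\<close> of an arc of length \<open>y\<close>. There are two sets because the arc has
  an end at the cut of the circle, so its neighbourhood continues on the other side of the
  cut.\<close>

lemma arc_count_discrepancy:
  assumes K: "K > 0" and \<eta>: "0 < \<eta>" "\<eta> \<le> 1" and I: "I \<subseteq> {..<N}" and J: "J1 \<subseteq> {..<K}" "J2 \<subseteq> {..<K}"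
    and far: "\<And>i j. i \<in> I \<Longrightarrow> j < K \<Longrightarrow> j \<notin> J1 \<Longrightarrow> j \<notin> J2 \<Longrightarrow>
      \<eta> \<le> \<bar>\<theta> i - grid K j\<bar> \<and> \<bar>\<theta> i - grid K j\<bar> \<le> 2 * pi - \<eta>"
    and card: "real (card J1) \<le> (y + \<eta>) * real K / (2 * pi) + 1" "real (card J2) \<le> \<eta> * real K / (2 * pi) + 1"
  shows "real (card I) \<le> real N * y / (2 * pi) + discrepancy_bound N \<theta> K \<eta>"
proof -
  have "real (card I) \<le> real N * real K * (16 / ((real K)\<^sup>2 * \<eta>\<^sup>2))
      + real (card (J1 \<union> J2)) * real N / real K + 2 * power_sum_total N \<theta> K"
  proof (rule arc_count_le[OF K I])
    fix i j assume "i \<in> I" "j \<in> {..<K} - (J1 \<union> J2)"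
    then show "fejer_weight K j (\<theta> i) \<le> 16 / ((real K)\<^sup>2 * \<eta>\<^sup>2)"
      using far[of i j] by (intro fejer_weight_far[OF K \<eta>]) auto
  qed (use J in auto)
  moreover have "real N * real K * (16 / ((real K)\<^sup>2 * \<eta>\<^sup>2)) = real N * (16 / (real K * \<eta>\<^sup>2))"
    using K by (simp add: power2_eq_square)
  moreover have "real (card (J1 \<union> J2)) * real N / real K \<le> real N * y / (2 * pi) + real N * (\<eta> / pi + 2 / real K)"
  proof -
    have "real (card (J1 \<union> J2)) \<le> real (card J1) + real (card J2)"
      using card_Un_le[of J1 J2] by linarith
    moreover have "real K * (y / (2 * pi) + \<eta> / pi + 2 / real K)
        = ((y + \<eta>) * real K / (2 * pi) + 1) + (\<eta> * real K / (2 * pi) + 1)"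
      using K by (simp add: field_simps)
    ultimately have c: "real (card (J1 \<union> J2)) \<le> real K * (y / (2 * pi) + \<eta> / pi + 2 / real K)"
      using card by linarith
    have "real (card (J1 \<union> J2)) * real N / real K = real (card (J1 \<union> J2)) * (real N / real K)" by simp
    also have "\<dots> \<le> real K * (y / (2 * pi) + \<eta> / pi + 2 / real K) * (real N / real K)"
      using c by (rule mult_right_mono) simp
    also have "\<dots> = real N * y / (2 * pi) + real N * (\<eta> / pi + 2 / real K)"
      using K by (simp add: field_simps)
    finally show ?thesis .
  qed
  ultimately show ?thesis unfolding discrepancy_bound_def by (simp add: distrib_left)
qed

text \<open>For the arc from 0 to x, the widening below 0 reappears just below 2 pi; those grid
  points form \<open>J2\<close>.\<close>

lemma initial_arc_count:
  assumes K: "K > 0" and \<eta>: "0 < \<eta>" "\<eta> \<le> 1" and \<theta>: "\<And>i. i < N \<Longrightarrow> 0 \<le> \<theta> i \<and> \<theta> i < 2 * pi" and x: "0 \<le> x" "x < 2 * pi"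
  shows "real (card {i. i < N \<and> \<theta> i \<le> x}) \<le> real N * x / (2 * pi) + discrepancy_bound N \<theta> K \<eta>"
proof (rule arc_count_discrepancy[OF K \<eta>])
  let ?J1 = "{j. j < K \<and> grid K j \<le> x + \<eta>}" and ?J2 = "{j. j < K \<and> 2 * pi - \<eta> \<le> grid K j}"
  show "real (card ?J1) \<le> (x + \<eta>) * real K / (2 * pi) + 1"
    using card_nat_interval_le[of ?J1 0 "(x + \<eta>) * real K / (2 * pi)"] x \<eta> K by (auto simp: field_simps)
  have "real (card ?J2) \<le> real K - (2 * pi - \<eta>) * real K / (2 * pi) + 1"
    using \<eta> K by (intro card_nat_interval_le) (auto simp: field_simps)
  then show "real (card ?J2) \<le> \<eta> * real K / (2 * pi) + 1" by (simp add: field_simps)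
  fix i j assume *: "i \<in> {i. i < N \<and> \<theta> i \<le> x}" "j < K" "j \<notin> ?J1" "j \<notin> ?J2"
  then have "\<theta> i \<le> x" "x + \<eta> < grid K j" "grid K j < 2 * pi - \<eta>" "0 \<le> \<theta> i"
    using \<theta>[of i] by auto
  then show "\<eta> \<le> \<bar>\<theta> i - grid K j\<bar> \<and> \<bar>\<theta> i - grid K j\<bar> \<le> 2 * pi - \<eta>" using \<eta> by linarith
qed auto

text \<open>An upper bound for the complementary arc serves as the lower bound for the initial one.
  Here the widening wraps around to the grid points just above 0.\<close>

lemma final_arc_count:
  assumes K: "K > 0" and \<eta>: "0 < \<eta>" "\<eta> \<le> 1" and \<theta>: "\<And>i. i < N \<Longrightarrow> 0 \<le> \<theta> i \<and> \<theta> i < 2 * pi" and x: "0 \<le> x" "x < 2 * pi"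
  shows "real (card {i. i < N \<and> x \<le> \<theta> i}) \<le> real N * (2 * pi - x) / (2 * pi) + discrepancy_bound N \<theta> K \<eta>"
proof (rule arc_count_discrepancy[OF K \<eta>])
  let ?J1 = "{j. j < K \<and> x - \<eta> \<le> grid K j}" and ?J2 = "{j. j < K \<and> grid K j \<le> \<eta>}"
  have "(x - \<eta>) * real K \<le> 2 * pi * real K" using x \<eta> by (intro mult_right_mono) auto
  then have "real (card ?J1) \<le> real K - (x - \<eta>) * real K / (2 * pi) + 1"
    using x \<eta> K by (intro card_nat_interval_le) (auto simp: field_simps)
  then show "real (card ?J1) \<le> (2 * pi - x + \<eta>) * real K / (2 * pi) + 1" by (simp add: field_simps)
  show "real (card ?J2) \<le> \<eta> * real K / (2 * pi) + 1"
    using card_nat_interval_le[of ?J2 0 "\<eta> * real K / (2 * pi)"] \<eta> K by (auto simp: field_simps)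
  fix i j assume *: "i \<in> {i. i < N \<and> x \<le> \<theta> i}" "j < K" "j \<notin> ?J1" "j \<notin> ?J2"
  then have "x \<le> \<theta> i" "grid K j < x - \<eta>" "\<eta> < grid K j" "\<theta> i < 2 * pi"
    using \<theta>[of i] by auto
  then show "\<eta> \<le> \<bar>\<theta> i - grid K j\<bar> \<and> \<bar>\<theta> i - grid K j\<bar> \<le> 2 * pi - \<eta>" using \<eta> by linarith
qed auto

section \<open>Sorted angles and the matching of a spectrum with its square\<close>

lemma sorting_permutation:
  fixes \<theta> :: "nat \<Rightarrow> real"
  obtains p where "p permutes {..<N}" "\<And>i j. i \<le> j \<Longrightarrow> j < N \<Longrightarrow> \<theta> (p i) \<le> \<theta> (p j)"
proof -
  let ?ys = "map \<theta> [0..<N]"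
  have "mset (sort ?ys) = mset ?ys" by simp
  then obtain p where p: "p permutes {..<length ?ys}" "permute_list p ?ys = sort ?ys"
    by (rule mset_eq_permutation)
  have nth: "sort ?ys ! i = \<theta> (p i)" if "i < N" for i
  proof -
    have "p i < N" using permutes_in_image[of p "{..<N}" i] p(1) that by simp
    moreover have "permute_list p ?ys ! i = ?ys ! p i" using p(1) that by (intro permute_list_nth) auto
    ultimately show ?thesis using p(2) by simp
  qed
  show ?thesis
  proof
    show "p permutes {..<N}" using p(1) by simp
    fix i j assume "i \<le> j" "j < N"
    then have "sort ?ys ! i \<le> sort ?ys ! j" by (intro sorted_nth_mono) auto
    then show "\<theta> (p i) \<le> \<theta> (p j)" using \<open>i \<le> j\<close> \<open>j < N\<close> by (simp add: nth)
  qed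
qed

text \<open>At least k + 1 angles are at most the sorted angle with index k, and at least N - k
  angles are no smaller. The bounds for the initial and the final arc confine it from both
  sides.\<close>

lemma sorted_angle_rigidity:
  assumes K: "K > 0" and \<eta>: "0 < \<eta>" "\<eta> \<le> 1" and \<theta>: "\<And>i. i < N \<Longrightarrow> 0 \<le> \<theta> i \<and> \<theta> i < 2 * pi"
    and p: "p permutes {..<N}" "\<And>i j. i \<le> j \<Longrightarrow> j < N \<Longrightarrow> \<theta> (p i) \<le> \<theta> (p j)" and k: "k < N"
  shows "\<bar>\<theta> (p k) - 2 * pi * real k / real N\<bar> \<le> 2 * pi * discrepancy_bound N \<theta> K \<eta> / real N"
proof -
  let ?x = "\<theta> (p k)" and ?\<Delta> = "discrepancy_bound N \<theta> K \<eta>"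
  have N: "real N > 0" using k by simp
  have pk: "p i < N" if "i < N" for i using permutes_in_image[OF p(1)] that by auto
  have inj: "inj_on p A" for A using permutes_inj[OF p(1)] by (rule inj_on_subset) simp
  have x: "0 \<le> ?x" "?x < 2 * pi" using \<theta>[OF pk[OF k]] by auto
  have "p ` {..k} \<subseteq> {i. i < N \<and> \<theta> i \<le> ?x}" using p(2)[OF _ k] pk k by auto
  then have "card (p ` {..k}) \<le> card {i. i < N \<and> \<theta> i \<le> ?x}" by (intro card_mono) auto
  then have "real k + 1 \<le> real (card {i. i < N \<and> \<theta> i \<le> ?x})" by (simp add: card_image[OF inj])
  also have "\<dots> \<le> real N * ?x / (2 * pi) + ?\<Delta>" by (rule initial_arc_count[OF K \<eta> \<theta> x])
  finally have 1: "real k \<le> real N * ?x / (2 * pi) + ?\<Delta>" by simp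
  have "p ` {k..<N} \<subseteq> {i. i < N \<and> ?x \<le> \<theta> i}" using p(2) pk by auto
  then have "card (p ` {k..<N}) \<le> card {i. i < N \<and> ?x \<le> \<theta> i}" by (intro card_mono) auto
  then have "real N - real k \<le> real (card {i. i < N \<and> ?x \<le> \<theta> i})"
    using k by (simp add: card_image[OF inj] of_nat_diff)
  also have "\<dots> \<le> real N * (2 * pi - ?x) / (2 * pi) + ?\<Delta>" by (rule final_arc_count[OF K \<eta> \<theta> x])
  also have "\<dots> = real N - real N * ?x / (2 * pi) + ?\<Delta>" by (simp add: field_simps)
  finally have 2: "real N * ?x / (2 * pi) \<le> real k + ?\<Delta>" by simp
  have dev: "\<bar>real N * ?x / (2 * pi) - real k\<bar> \<le> ?\<Delta>" using 1 2 by linarith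
  have "?x - 2 * pi * real k / real N = (2 * pi / real N) * (real N * ?x / (2 * pi) - real k)"
    using N by (simp add: field_simps)
  then have "\<bar>?x - 2 * pi * real k / real N\<bar> = (2 * pi / real N) * \<bar>real N * ?x / (2 * pi) - real k\<bar>"
    using N by (simp only: abs_mult) simp
  also have "\<dots> \<le> (2 * pi / real N) * ?\<Delta>"
    using dev N by (intro mult_left_mono) auto
  finally show ?thesis by simp
qed

lemma cmod_cis_diff_le: "cmod (cis a - cis b) \<le> \<bar>a - b\<bar>"
proof -
  have "(cmod (cis a - cis b))\<^sup>2 = (cos a - cos b)\<^sup>2 + (sin a - sin b)\<^sup>2"
    by (simp add: cmod_power2)
  also have "\<dots> = 2 - 2 * cos (a - b)"
    using sin_cos_squared_add[of a] sin_cos_squared_add[of b]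
    by (simp add: power2_eq_square cos_diff algebra_simps)
  also have "\<dots> = (2 * sin ((a - b) / 2))\<^sup>2"
  proof -
    have "2 * ((a - b) / 2) = a - b" by simp
    then show ?thesis using cos_double_sin[of "(a - b) / 2"] by (simp only: power_mult_distrib) simp
  qed
  finally have "cmod (cis a - cis b) = \<bar>2 * sin ((a - b) / 2)\<bar>"
    by (metis norm_ge_zero power2_abs power2_eq_imp_eq abs_ge_zero)
  also have "\<dots> \<le> \<bar>a - b\<bar>" using abs_sin_le_one abs_sin_x_le_abs_x[of "(a - b) / 2"] by (simp add: abs_mult)
  finally show ?thesis .
qed

text \<open>Both families of angles, sorted separately, lie near the same grid 2 pi k / N, so the
  triangle inequality matches them. The power sums of the squares are those of the original points
  at even orders.\<close>

theorem square_matching: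
  fixes z :: "nat \<Rightarrow> complex"
  assumes z: "\<And>i. i < N \<Longrightarrow> cmod (z i) = 1" and m: "m > 0"
  obtains p q where "p permutes {..<N}" "q permutes {..<N}"
    "\<And>k. k < N \<Longrightarrow> cmod (z (p k) - (z (q k))\<^sup>2)
       \<le> 2 * pi * (38 / real m + 2 * (\<Sum>d\<in>{1..<m ^ 3}. cmod (\<Sum>i<N. z i ^ d) + cmod (\<Sum>i<N. z i ^ (2 * d))) / real N)"
proof -
  \<comment> \<open>The branch with values in [0, 2 pi) puts the cut of the circle where the arc
    counts place it.\<close>
  define \<theta> where "\<theta> i = Arg2pi (z i)" for i
  define \<phi> where "\<phi> i = Arg2pi ((z i)\<^sup>2)" for i
  let ?\<eta> = "1 / real m" and ?K = "m ^ 3"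
  have \<eta>: "0 < ?\<eta>" "?\<eta> \<le> 1" and K: "?K > 0" using m by auto
  have \<theta>: "0 \<le> \<theta> i \<and> \<theta> i < 2 * pi" "0 \<le> \<phi> i \<and> \<phi> i < 2 * pi" for i
    by (simp_all add: \<theta>_def \<phi>_def Arg2pi_ge_0 Arg2pi_lt_2pi)
  have cis: "cis (\<theta> i) = z i" "cis (\<phi> i) = (z i)\<^sup>2" if "i < N" for i
  proof -
    have "cis (Arg2pi w) = w" if "cmod w = 1" for w
      using complex_norm_eq_1_exp[of w] that by (metis Arg2pi_eq cis_conv_exp mult.commute mult_1 of_real_1)
    then show "cis (\<theta> i) = z i" "cis (\<phi> i) = (z i)\<^sup>2"
      using z[OF that] by (simp_all add: \<theta>_def \<phi>_def norm_power)
  qed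
  obtain p where p: "p permutes {..<N}" "\<And>i j. i \<le> j \<Longrightarrow> j < N \<Longrightarrow> \<theta> (p i) \<le> \<theta> (p j)"
    using sorting_permutation[where \<theta> = \<theta> and N = N] by blast
  obtain q where q: "q permutes {..<N}" "\<And>i j. i \<le> j \<Longrightarrow> j < N \<Longrightarrow> \<phi> (q i) \<le> \<phi> (q j)"
    using sorting_permutation[where \<theta> = \<phi> and N = N] by blast
  have ps: "power_sum N \<theta> d = (\<Sum>i<N. z i ^ d)" "power_sum N \<phi> d = (\<Sum>i<N. z i ^ (2 * d))" for d
  proof -
    have "cis (real d * \<theta> i) = z i ^ d" "cis (real d * \<phi> i) = z i ^ (2 * d)" if "i < N" for i
      by (simp_all only: Complex.DeMoivre[symmetric] cis[OF that] power_mult)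
    then show "power_sum N \<theta> d = (\<Sum>i<N. z i ^ d)" "power_sum N \<phi> d = (\<Sum>i<N. z i ^ (2 * d))"
      by (simp_all add: power_sum_def)
  qed
  define S where "S = (\<Sum>d\<in>{1..<?K}. cmod (\<Sum>i<N. z i ^ d) + cmod (\<Sum>i<N. z i ^ (2 * d)))"
  have S: "power_sum_total N \<theta> ?K + power_sum_total N \<phi> ?K = S"
    by (simp add: power_sum_total_def ps S_def sum.distrib)
  \<comment> \<open>With \<eta> = 1/m and K = m^3 the terms are at most 16/m, 1/m and 2/m; the two
    spectra together give the constant 38.\<close>
  have small: "16 / (real ?K * ?\<eta>\<^sup>2) + ?\<eta> / pi + 2 / real ?K \<le> 19 / real m"
  proof -
    have m1: "real m \<ge> 1" using m by simp
    have "16 / (real ?K * ?\<eta>\<^sup>2) = 16 / real m" using m by (simp add: power2_eq_square power3_eq_cube)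
    moreover have "?\<eta> / pi \<le> ?\<eta> / 1" using m1 pi_gt3 by (intro divide_left_mono) auto
    moreover have "2 / real ?K \<le> 2 / real m"
      using m1 self_le_power[of "real m" 3] by (intro divide_left_mono) auto
    ultimately show ?thesis by simp
  qed
  show ?thesis
  proof
    show "p permutes {..<N}" "q permutes {..<N}" by (fact p(1) q(1))+
    fix k assume k: "k < N"
    then have N: "real N > 0" by simp
    have pq: "p k < N" "q k < N" using permutes_in_image[OF p(1)] permutes_in_image[OF q(1)] k by auto
    have "cmod (z (p k) - (z (q k))\<^sup>2) = cmod (cis (\<theta> (p k)) - cis (\<phi> (q k)))"
      using pq by (simp add: cis)
    also have "\<dots> \<le> \<bar>\<theta> (p k) - \<phi> (q k)\<bar>" by (rule cmod_cis_diff_le)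
    also have "\<dots> \<le> 2 * pi * discrepancy_bound N \<theta> ?K ?\<eta> / real N + 2 * pi * discrepancy_bound N \<phi> ?K ?\<eta> / real N"
      using sorted_angle_rigidity[where \<theta> = \<theta>, OF K \<eta> \<theta>(1) p k]
        sorted_angle_rigidity[where \<theta> = \<phi>, OF K \<eta> \<theta>(2) q k] by linarith
    also have "\<dots> = 2 * pi * (2 * (16 / (real ?K * ?\<eta>\<^sup>2) + ?\<eta> / pi + 2 / real ?K) + 2 * S / real N)"
      unfolding discrepancy_bound_def S[symmetric] using N by (simp add: field_simps)
    also have "\<dots> \<le> 2 * pi * (38 / real m + 2 * S / real N)"
      using small by (intro mult_left_mono add_right_mono) auto
    finally show "cmod (z (p k) - (z (q k))\<^sup>2) \<le> 2 * pi * (38 / real m + 2 * (\<Sum>d\<in>{1..<m ^ 3}. cmod (\<Sum>i<N. z i ^ d) + cmod (\<Sum>i<N. z i ^ (2 * d))) / real N)"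
      unfolding S_def .
  qed
qed

section \<open>The Haar average as a class function\<close>

lemma mat_trace_comm:
  assumes "A \<in> carrier_mat n n" "B \<in> carrier_mat n n"
  shows "mat_trace (A * B) = mat_trace (B * A)"
proof -
  have "mat_trace (A * B) = (\<Sum>i<n. \<Sum>j<n. A $$ (i, j) * B $$ (j, i))"
    using assms by (simp add: mat_trace_def times_index[OF assms] del: index_mult_mat(1))
  also have "\<dots> = (\<Sum>j<n. \<Sum>i<n. B $$ (j, i) * A $$ (i, j))"
    by (subst sum.swap) (simp add: mult.commute)
  also have "\<dots> = mat_trace (B * A)"
    using assms by (simp add: mat_trace_def times_index[OF assms(2,1)] del: index_mult_mat(1))
  finally show ?thesis .
qed

lemma conj_product:
  assumes "Q \<in> unitary_group n" "X \<in> carrier_mat n n" "Y \<in> carrier_mat n n"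
  shows "(Q * X * mat_adjoint Q) * (Q * Y * mat_adjoint Q) = Q * (X * Y) * mat_adjoint Q"
proof -
  note Q = unitary_groupD[OF assms(1)]
  note c = Q(1) mat_adjoint_carrier[OF Q(1)] assms(2,3)
  have YQ: "Y * mat_adjoint Q \<in> carrier_mat n n" using c by (auto intro: mult_carrier_mat[of _ n n])
  have "Q * Y * mat_adjoint Q = Q * (Y * mat_adjoint Q)"
    using c by (intro assoc_mult_mat[of _ n n _ n _ n])
  then have "mat_adjoint Q * (Q * Y * mat_adjoint Q) = (mat_adjoint Q * Q) * (Y * mat_adjoint Q)"
    using c YQ by (simp only: assoc_mult_mat[of _ n n _ n _ n])
  also have "\<dots> = Y * mat_adjoint Q" unfolding Q(2) by (rule left_mult_one_mat[OF YQ])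
  finally have "mat_adjoint Q * (Q * Y * mat_adjoint Q) = Y * mat_adjoint Q" .
  then have "(Q * X) * (mat_adjoint Q * (Q * Y * mat_adjoint Q)) = (Q * X) * (Y * mat_adjoint Q)" by simp
  then show ?thesis
    using c by (simp add: assoc_mult_mat[of _ n n _ n _ n] mult_carrier_mat[of _ n n _ n])
qed

lemma conj_product':
  assumes "W \<in> unitary_group n" "X \<in> carrier_mat n n" "Y \<in> carrier_mat n n"
  shows "(mat_adjoint W * X * W) * (mat_adjoint W * Y * W) = mat_adjoint W * (X * Y) * W"
  using conj_product[OF unitary_group_adjoint[OF assms(1)] assms(2,3)] by simp

lemma diag_of_mult: "diag_of n a * diag_of n b = diag_of n (\<lambda>i. a i * b i)"
proof (rule eq_matI)
  fix i j assume "i < dim_row (diag_of n (\<lambda>i. a i * b i))" "j < dim_col (diag_of n (\<lambda>i. a i * b i))"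
  then have ij: "i < n" "j < n" by (auto simp: diag_of_def)
  have "(diag_of n a * diag_of n b) $$ (i, j) = (\<Sum>k<n. diag_of n a $$ (i, k) * diag_of n b $$ (k, j))"
    by (rule times_index[OF diag_of_carrier diag_of_carrier ij])
  also have "\<dots> = (\<Sum>k<n. if k = i then (if i = j then a i * b i else 0) else 0)"
    using ij by (intro sum.cong refl) (auto simp: diag_of_def)
  finally show "(diag_of n a * diag_of n b) $$ (i, j) = diag_of n (\<lambda>i. a i * b i) $$ (i, j)"
    using ij by (simp add: diag_of_def)
qed (auto simp: diag_of_def)

lemma diag_of_adjoint: "mat_adjoint (diag_of n a) = diag_of n (\<lambda>i. cnj (a i))"
  by (rule eq_matI) (auto simp: diag_of_def)

lemma diag_of_unitary:
  assumes "\<And>i. i < n \<Longrightarrow> cmod (a i) = 1"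
  shows "diag_of n a \<in> unitary_group n"
proof -
  have "cnj (a i) * a i = 1" if "i < n" for i
    using assms[OF that] by (metis complex_norm_square mult.commute of_real_1 one_power2)
  then have "diag_of n (\<lambda>i. cnj (a i) * a i) = 1\<^sub>m n" by (intro eq_matI) (auto simp: diag_of_def)
  then show ?thesis by (simp add: unitary_group_def diag_of_adjoint diag_of_mult)
qed

lemma power_trace_diagonalized:
  assumes Q: "Q \<in> unitary_group n"
  shows "power_trace k (Q * diag_of n z * mat_adjoint Q) = (\<Sum>i<n. z i ^ k)"
proof -
  note c = unitary_groupD[OF Q]
  have pow: "(Q * diag_of n z * mat_adjoint Q) ^\<^sub>m k = Q * diag_of n (\<lambda>i. z i ^ k) * mat_adjoint Q"
  proof (induction k)
    case 0
    have "diag_of n (\<lambda>i. 1) = 1\<^sub>m n" by (rule eq_matI) (auto simp: diag_of_def)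
    then show ?case using c by simp
  next
    case (Suc k)
    then show ?case by (simp add: conj_product[OF Q] diag_of_mult mult.commute)
  qed
  have "mat_trace (Q * diag_of n (\<lambda>i. z i ^ k) * mat_adjoint Q)
      = mat_trace (mat_adjoint Q * (Q * diag_of n (\<lambda>i. z i ^ k)))"
    using c by (intro mat_trace_comm[of _ n]) (auto intro: mult_carrier_mat[of _ n n])
  also have "mat_adjoint Q * (Q * diag_of n (\<lambda>i. z i ^ k)) = diag_of n (\<lambda>i. z i ^ k)"
    using c left_mult_one_mat[OF diag_of_carrier[of n "\<lambda>i. z i ^ k"]]
    by (subst assoc_mult_mat[symmetric, of _ n n _ n _ n]) simp_all
  finally show ?thesis unfolding power_trace_def pow by (simp add: mat_trace_def diag_of_def)
qed

lemma sqn_diag_of_le: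
  assumes "y \<in> carrier_vec n" "\<And>i. i < n \<Longrightarrow> cmod (a i) \<le> \<delta>"
  shows "sqn (diag_of n a *\<^sub>v y) \<le> \<delta>\<^sup>2 * sqn y"
proof -
  have "(diag_of n a *\<^sub>v y) $ i = a i * y $ i" if "i < n" for i
  proof -
    have "(diag_of n a *\<^sub>v y) $ i = (\<Sum>k<n. if k = i then a i * y $ i else 0)"
      unfolding mult_vec_index[OF diag_of_carrier assms(1) that]
      using that by (intro sum.cong) (auto simp: diag_of_def)
    then show ?thesis using that by simp
  qed
  then have "sqn (diag_of n a *\<^sub>v y) = (\<Sum>i<n. (cmod (a i))\<^sup>2 * (cmod (y $ i))\<^sup>2)"
    by (simp add: sqn_def diag_of_def norm_mult power_mult_distrib del: index_mult_mat_vec)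
  also have "\<dots> \<le> (\<Sum>i<n. \<delta>\<^sup>2 * (cmod (y $ i))\<^sup>2)"
    using assms(2) by (intro sum_mono mult_right_mono power_mono) auto
  finally show ?thesis using assms(1) by (simp add: sqn_def sum_distrib_left)
qed

text \<open>Conjugating both diagonal matrices by the same unitary preserves their distance in
  operator norm, which is the largest distance between corresponding eigenvalues.\<close>

lemma conj_diag_near:
  assumes W: "W \<in> unitary_group n" and y: "y \<in> carrier_vec n" and near: "\<And>i. i < n \<Longrightarrow> cmod (a i - b i) \<le> \<delta>"
  shows "sqn ((mat_adjoint W * diag_of n a * W - mat_adjoint W * diag_of n b * W) *\<^sub>v y) \<le> \<delta>\<^sup>2 * sqn y"
proof -
  note c = unitary_groupD(1)[OF W]
  have Wy: "W *\<^sub>v y \<in> carrier_vec n" using c y by simp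
  have app: "(mat_adjoint W * X * W) *\<^sub>v y = mat_adjoint W *\<^sub>v (X *\<^sub>v (W *\<^sub>v y))" if "X \<in> carrier_mat n n" for X
    using c y that Wy by (simp add: assoc_mult_mat_vec[of _ n n _ n] mult_carrier_mat[of _ n n _ n])
  have diff: "diag_of n a - diag_of n b = diag_of n (\<lambda>i. a i - b i)"
    by (rule eq_matI) (auto simp: diag_of_def)
  have "(mat_adjoint W * diag_of n a * W - mat_adjoint W * diag_of n b * W) *\<^sub>v y
      = (mat_adjoint W * diag_of n a * W) *\<^sub>v y - (mat_adjoint W * diag_of n b * W) *\<^sub>v y"
    using c y by (intro minus_mult_distrib_mat_vec[of _ n n]) (auto intro: mult_carrier_mat[of _ n n])
  also have "\<dots> = mat_adjoint W *\<^sub>v (diag_of n a *\<^sub>v (W *\<^sub>v y) - diag_of n b *\<^sub>v (W *\<^sub>v y))"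
    unfolding app[OF diag_of_carrier] using c Wy
    by (intro mult_minus_distrib_mat_vec[symmetric, of _ n n]) (auto intro!: mult_mat_vec_carrier[OF diag_of_carrier])
  also have "diag_of n a *\<^sub>v (W *\<^sub>v y) - diag_of n b *\<^sub>v (W *\<^sub>v y) = diag_of n (\<lambda>i. a i - b i) *\<^sub>v (W *\<^sub>v y)"
    unfolding diff[symmetric] using Wy by (intro minus_mult_distrib_mat_vec[symmetric, of _ n n]) auto
  also have "sqn (mat_adjoint W *\<^sub>v \<dots>) = sqn (diag_of n (\<lambda>i. a i - b i) *\<^sub>v (W *\<^sub>v y))"
    using Wy by (intro sqn_unitary[OF unitary_group_adjoint[OF W]] mult_mat_vec_carrier[OF diag_of_carrier])
  also have "\<dots> \<le> \<delta>\<^sup>2 * sqn (W *\<^sub>v y)" by (rule sqn_diag_of_le[OF Wy near])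
  also have "sqn (W *\<^sub>v y) = sqn y" by (rule sqn_unitary[OF W y])
  finally show ?thesis .
qed

lemma conj_adjoint:
  fixes W X :: "complex mat"
  assumes "W \<in> carrier_mat n n" "X \<in> carrier_mat n n"
  shows "mat_adjoint (mat_adjoint W * X * W) = mat_adjoint W * mat_adjoint X * W"
proof -
  have WX: "mat_adjoint W * X \<in> carrier_mat n n" using assms by (auto intro: mult_carrier_mat[of _ n n])
  have "mat_adjoint (mat_adjoint W * X) = mat_adjoint X * W"
    using assms by (subst mat_adjoint_mult[of _ n n _ n]) auto
  then have "mat_adjoint (mat_adjoint W * X * W) = mat_adjoint W * (mat_adjoint X * W)"
    by (simp add: mat_adjoint_mult[OF WX assms(1)])
  also have "\<dots> = mat_adjoint W * mat_adjoint X * W"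
    using assms by (intro assoc_mult_mat[symmetric, of _ n n _ n _ n]) auto
  finally show ?thesis .
qed

definition permutation_matrix :: "nat \<Rightarrow> (nat \<Rightarrow> nat) \<Rightarrow> complex mat" where
  "permutation_matrix n p = Matrix.mat n n (\<lambda>(i, j). if j = p i then 1 else 0)"

text \<open>Reordering the eigenvalues is itself a unitary conjugation, so a class function cannot
  detect it.\<close>

lemma permutation_matrix_conj:
  assumes p: "p permutes {..<n}"
  shows "permutation_matrix n p * diag_of n z * mat_adjoint (permutation_matrix n p) = diag_of n (z \<circ> p)"
proof (rule eq_matI)
  let ?R = "permutation_matrix n p"
  have R: "?R \<in> carrier_mat n n" by (simp add: permutation_matrix_def)
  fix i j assume "i < dim_row (diag_of n (z \<circ> p))" "j < dim_col (diag_of n (z \<circ> p))"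
  then have ij: "i < n" "j < n" by (auto simp: diag_of_def)
  then have pij: "p i < n" "p j < n" using permutes_in_image[OF p] by auto
  have RD: "(?R * diag_of n z) $$ (i, k) = (if k = p i then z (p i) else 0)" if "k < n" for k
  proof -
    have "(?R * diag_of n z) $$ (i, k) = (\<Sum>l<n. ?R $$ (i, l) * diag_of n z $$ (l, k))"
      by (rule times_index[OF R diag_of_carrier ij(1) that])
    also have "\<dots> = (\<Sum>l<n. if l = p i then (if k = p i then z (p i) else 0) else 0)"
      using ij that by (intro sum.cong refl) (auto simp: permutation_matrix_def diag_of_def)
    finally show ?thesis using pij by simp
  qed
  have "(?R * diag_of n z * mat_adjoint ?R) $$ (i, j) = (\<Sum>k<n. (?R * diag_of n z) $$ (i, k) * mat_adjoint ?R $$ (k, j))"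
    using ij R by (intro times_index[of _ n n _ n]) (auto intro: mult_carrier_mat[of _ n n])
  also have "\<dots> = (\<Sum>k<n. if k = p i then (if p i = p j then z (p i) else 0) else 0)"
  proof (intro sum.cong refl)
    fix k assume "k \<in> {..<n}"
    then have k: "k < n" by simp
    have "mat_adjoint ?R $$ (k, j) = (if k = p j then 1 else 0)"
      using ij k by (subst mat_adjoint_index) (auto simp: permutation_matrix_def)
    then show "(?R * diag_of n z) $$ (i, k) * mat_adjoint ?R $$ (k, j)
        = (if k = p i then (if p i = p j then z (p i) else 0) else 0)"
      unfolding RD[OF k] by simp
  qed
  also have "\<dots> = diag_of n (z \<circ> p) $$ (i, j)"
    using ij pij permutes_inj[OF p] by (auto simp: diag_of_def inj_eq)
  finally show "(?R * diag_of n z * mat_adjoint ?R) $$ (i, j) = diag_of n (z \<circ> p) $$ (i, j)" .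
qed (auto simp: diag_of_def permutation_matrix_def)

lemma permutation_matrix_unitary:
  assumes p: "p permutes {..<n}"
  shows "permutation_matrix n p \<in> unitary_group n"
proof -
  let ?R = "permutation_matrix n p"
  have R: "?R \<in> carrier_mat n n" by (simp add: permutation_matrix_def)
  have one: "diag_of n (\<lambda>_. 1) = 1\<^sub>m n" by (rule eq_matI) (auto simp: diag_of_def)
  have "?R * mat_adjoint ?R = 1\<^sub>m n"
    using permutation_matrix_conj[OF p, of "\<lambda>_. 1"] R by (simp add: one o_def)
  then have "mat_adjoint ?R * ?R = 1\<^sub>m n"
    using mat_mult_left_right_inverse[of ?R n "mat_adjoint ?R"] R by simp
  then show ?thesis using R by (simp add: unitary_group_def)
qed

context haar begin

section \<open>The expected matching distance\<close>

text \<open>The bound of \<open>square_matching\<close> written through traces of powers. In this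
  form it is a measurable function of \<open>U\<close>, although eigenvalues and matching are chosen
  separately for each \<open>U\<close>.\<close>

definition matching_bound :: "nat \<Rightarrow> complex mat \<Rightarrow> real" where
  "matching_bound m U = 2 * pi * (38 / real m +
     2 * (\<Sum>d\<in>{1..<m ^ 3}. cmod (power_trace d U) + cmod (power_trace (2 * d) U)) / real N)"

lemma integrable_matching_bound: "integrable \<mu> (matching_bound m)"
proof -
  define S where "S U = (\<Sum>d\<in>{1..<m ^ 3}. cmod (power_trace d U) + cmod (power_trace (2 * d) U))" for U
  have "integrable \<mu> S" unfolding S_def[abs_def]
    by (intro Bochner_Integration.integrable_sum Bochner_Integration.integrable_add integrable_cmod_power_trace)
  then show ?thesis unfolding matching_bound_def[abs_def] S_def[symmetric] by simp
qed

text \<open>Each of the fewer than m^3 orders d contributes at most (1 + d) + (1 + 2 d) \<le> 5 m^3,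
  and the first assumption on \<open>N\<close> covers the moments of order 2 d. Thus the sum is at
  most 5 m^6, its doubled quotient by N \<ge> m^7 at most 10/m, and 2 pi times 38 + 10 is below 8
  times 48 = 384.\<close>

lemma expected_matching_bound:
  assumes m: "m > 0" and N: "4 * m ^ 3 \<le> N" "m ^ 7 \<le> N"
  shows "(LINT U|\<mu>. matching_bound m U) \<le> 384 / real m"
proof -
  let ?K = "m ^ 3"
  define S where "S U = (\<Sum>d\<in>{1..<?K}. cmod (power_trace d U) + cmod (power_trace (2 * d) U))" for U
  have intS: "integrable \<mu> S" unfolding S_def[abs_def]
    by (intro Bochner_Integration.integrable_sum Bochner_Integration.integrable_add integrable_cmod_power_trace)
  have "(LINT U|\<mu>. S U) = (\<Sum>d\<in>{1..<?K}. (LINT U|\<mu>. cmod (power_trace d U)) + (LINT U|\<mu>. cmod (power_trace (2 * d) U)))"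
    unfolding S_def using integrable_cmod_power_trace by (simp add: Bochner_Integration.integral_sum)
  also have "\<dots> \<le> (\<Sum>d\<in>{1..<?K}. 5 * real ?K)"
  proof (rule sum_mono)
    fix d assume d: "d \<in> {1..<?K}"
    have "(LINT U|\<mu>. cmod (power_trace d U)) \<le> 1 + real d"
      using d N by (intro power_trace_first_moment) auto
    moreover have "(LINT U|\<mu>. cmod (power_trace (2 * d) U)) \<le> 1 + real (2 * d)"
      using d N by (intro power_trace_first_moment) auto
    moreover have "real (d + 1) \<le> real ?K" unfolding of_nat_le_iff using d by simp
    moreover have "1 \<le> real d" using d by simp
    ultimately show "(LINT U|\<mu>. cmod (power_trace d U)) + (LINT U|\<mu>. cmod (power_trace (2 * d) U)) \<le> 5 * real ?K" by simp
  qed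
  also have "\<dots> \<le> real ?K * (5 * real ?K)" by (simp add: mult_right_mono)
  also have "\<dots> = 5 * real m ^ 6"
    using power_add[of "real m" 3 3] by simp
  finally have ES: "(LINT U|\<mu>. S U) \<le> 5 * real m ^ 6" .
  have Npos: "real N > 0" using m N(2) by (metis gr0I le_zero_eq of_nat_0_less_iff power_eq_0_iff)
  have mN: "real m ^ 7 \<le> real N" using N(2) by (metis of_nat_le_iff of_nat_power)
  have "2 * (LINT U|\<mu>. S U) / real N \<le> 2 * (5 * real m ^ 6) / real m ^ 7"
    using ES mN m Npos by (intro frac_le) auto
  also have "\<dots> = 10 / real m" using m by (simp add: field_simps flip: power_Suc)
  finally have "2 * (LINT U|\<mu>. S U) / real N \<le> 10 / real m" .
  moreover have "38 / real m + 10 / real m = 48 / real m" by (simp flip: add_divide_distrib)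
  ultimately have "38 / real m + 2 * (LINT U|\<mu>. S U) / real N \<le> 48 / real m" by linarith
  then have "2 * pi * (38 / real m + 2 * (LINT U|\<mu>. S U) / real N) \<le> 2 * pi * (48 / real m)"
    by (intro mult_left_mono) auto
  moreover have "(LINT U|\<mu>. matching_bound m U) = 2 * pi * (38 / real m + 2 * (LINT U|\<mu>. S U) / real N)"
    unfolding matching_bound_def S_def[symmetric] using intS prob_space by simp
  ultimately have "(LINT U|\<mu>. matching_bound m U) \<le> 2 * pi * (48 / real m)" by (simp only:)
  also have "\<dots> \<le> 2 * 4 * (48 / real m)" using pi_less_4 by (intro mult_right_mono) auto
  finally show ?thesis by simp
qed

end

section \<open>The averaged acceptance probability\<close>

locale haar_query = haar "2 ^ n" \<mu> + valid_query_algorithm n A for n \<mu> A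
begin

lemma measurable_mat_query_op: "measurable_mat \<mu> D D (\<lambda>U. query_op A U d)"
proof -
  have "measurable_mat \<mu> (2 ^ n) (2 ^ n) (\<lambda>U. case d of Forward \<Rightarrow> U | Inverse \<Rightarrow> mat_adjoint U)"
    by (cases d) (use measurable_mat_id measurable_mat_adjoint in auto)
  then show ?thesis unfolding query_op_def total_dim_def by (rule measurable_mat_kronecker)
qed

lemma measurable_mat_fold:
  assumes "valid_rounds Rs" "measurable_mat \<mu> D D \<rho>"
  shows "measurable_mat \<mu> D D (\<lambda>U. fold (run_round n A U) Rs (\<rho> U))"
  using assms
proof (induction Rs arbitrary: \<rho>)
  case (Cons R Rs)
  have K: "K \<in> carrier_mat D D" if "(d, K) \<in> set R" for d K
    using that Cons.prems by (force simp: kraus_complete_def)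
  have "measurable_mat \<mu> D D (\<lambda>U. apply_kraus D (map (\<lambda>K. K U) (map (\<lambda>(d, K) U. query_op A U d * K) R)) (\<rho> U))"
    using K Cons.prems(2)
    by (intro measurable_mat_apply_kraus)
      (auto intro!: measurable_mat_mult[of _ D D] measurable_mat_query_op measurable_mat_const)
  then have "measurable_mat \<mu> D D (\<lambda>U. run_round n A U R (\<rho> U))"
    by (simp add: run_round_def o_def case_prod_unfold)
  then show ?case using Cons by simp
qed simp

lemma accept_prob_measurable: "accept_prob n A \<in> borel_measurable \<mu>"
proof -
  have init: "initial_state D \<in> carrier_mat D D" by (simp add: initial_state_def)
  have "measurable_mat \<mu> D D (\<lambda>U. apply_kraus D (map (\<lambda>K. K U) (map (\<lambda>K U. K) (final_op A)))
      (fold (run_round n A U) (rounds A) (initial_state D)))"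
    using final_carrier
    by (intro measurable_mat_apply_kraus measurable_mat_fold valid_all_rounds measurable_mat_const init)
      (auto intro!: measurable_mat_const)
  then have "measurable_mat \<mu> D D (\<lambda>U. final_state n A U)"
    by (simp add: final_state_def o_def)
  then have meas: "measurable_mat \<mu> D D (\<lambda>U. accept_op A * final_state n A U * mat_adjoint (accept_op A))"
    using accept_carrier by (intro measurable_mat_mult[of _ D D] measurable_mat_const) auto
  show ?thesis
    unfolding accept_prob_def[abs_def]
    by (rule measurable_compose[OF measurable_mat_trace[OF meas]
          borel_measurable_continuous_onI[OF continuous_on_Re[OF continuous_on_id]]])
qed

definition averaged :: "complex mat \<Rightarrow> real" where
  "averaged U = (LINT W|\<mu>. accept_prob n A (mat_adjoint W * U * W))"

lemma integrable_accept_conj: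
  assumes "U \<in> unitary_group (2 ^ n)"
  shows "integrable \<mu> (\<lambda>W. accept_prob n A (mat_adjoint W * U * W))"
proof (rule integrable_const_bound[where B = 1])
  show "AE W in \<mu>. norm (accept_prob n A (mat_adjoint W * U * W)) \<le> 1"
    using assms by (intro AE_I2) (auto intro!: accept_prob_bounded unitary_group_mult unitary_group_adjoint)
  show "(\<lambda>W. accept_prob n A (mat_adjoint W * U * W)) \<in> borel_measurable \<mu>"
    by (rule measurable_compose[OF _ accept_prob_measurable])
      (intro measurable_haar_mult measurable_haar_adjoint measurable_ident_sets[OF refl] measurable_haar_const assms)
qed

lemma averaged_bounded:
  assumes "U \<in> unitary_group (2 ^ n)"
  shows "\<bar>averaged U\<bar> \<le> 1"
proof -
  have b: "\<bar>accept_prob n A (mat_adjoint W * U * W)\<bar> \<le> 1" if "W \<in> space \<mu>" for W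
    using assms that by (auto intro!: accept_prob_bounded unitary_group_mult unitary_group_adjoint)
  have "norm (averaged U) \<le> (LINT W|\<mu>. norm (accept_prob n A (mat_adjoint W * U * W)))"
    unfolding averaged_def by (rule integral_norm_bound)
  also have "\<dots> \<le> 1"
    using integrable_accept_conj[OF assms] b by (intro integral_le_const AE_I2 integrable_norm) auto
  finally show ?thesis by simp
qed

lemma averaged_measurable: "averaged \<in> borel_measurable \<mu>"
  unfolding averaged_def[abs_def]
proof (rule borel_measurable_lebesgue_integral)
  have fst: "fst \<in> measurable (\<mu> \<Otimes>\<^sub>M \<mu>) \<mu>" and snd: "snd \<in> measurable (\<mu> \<Otimes>\<^sub>M \<mu>) \<mu>" by simp_all
  show "(\<lambda>(U, W). accept_prob n A (mat_adjoint W * U * W)) \<in> borel_measurable (\<mu> \<Otimes>\<^sub>M \<mu>)"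
    unfolding case_prod_unfold
    by (rule measurable_compose[OF _ accept_prob_measurable])
      (intro measurable_haar_mult measurable_haar_adjoint fst snd)
qed

lemma averaged_conj:
  assumes "Q \<in> unitary_group (2 ^ n)" "U \<in> unitary_group (2 ^ n)"
  shows "averaged (Q * U * mat_adjoint Q) = averaged U"
  unfolding averaged_def by (rule haar_conj_class_function[OF accept_prob_measurable assms])

lemma averaged_diag_permuted:
  assumes "p permutes {..<2 ^ n}" "\<And>i. i < 2 ^ n \<Longrightarrow> cmod (z i) = 1"
  shows "averaged (diag_of (2 ^ n) (z \<circ> p)) = averaged (diag_of (2 ^ n) z)"
  using averaged_conj[OF permutation_matrix_unitary[OF assms(1)] diag_of_unitary[of "2 ^ n" z]] assms
  by (simp add: permutation_matrix_conj[OF assms(1)])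

text \<open>The hybrid bound holds for each conjugating \<open>W\<close> with the same \<delta>, so
  it survives integration over \<open>W\<close>. Conjugating the eigenvalues leaves their distances
  unchanged, which covers the inverse queries.\<close>

lemma averaged_diag_near:
  assumes a: "\<And>i. i < 2 ^ n \<Longrightarrow> cmod (a i) = 1" and b: "\<And>i. i < 2 ^ n \<Longrightarrow> cmod (b i) = 1"
    and \<delta>: "\<delta> > 0" and near: "\<And>i. i < 2 ^ n \<Longrightarrow> cmod (a i - b i) \<le> \<delta>"
  shows "\<bar>averaged (diag_of (2 ^ n) a) - averaged (diag_of (2 ^ n) b)\<bar> \<le> 2 * \<delta> * num_queries A"
proof -
  let ?a = "diag_of (2 ^ n) a" and ?b = "diag_of (2 ^ n) b"
  have au: "?a \<in> unitary_group (2 ^ n)" and bu: "?b \<in> unitary_group (2 ^ n)"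
    using diag_of_unitary[OF a] diag_of_unitary[OF b] by auto
  have le: "\<bar>accept_prob n A (mat_adjoint W * ?a * W) - accept_prob n A (mat_adjoint W * ?b * W)\<bar> \<le> 2 * \<delta> * num_queries A"
    if W: "W \<in> unitary_group (2 ^ n)" for W
  proof (rule accept_prob_hybrid[OF _ _ \<delta>])
    show "mat_adjoint W * ?a * W \<in> unitary_group (2 ^ n)" "mat_adjoint W * ?b * W \<in> unitary_group (2 ^ n)"
      by (intro unitary_group_mult unitary_group_adjoint W au bu)+
    fix y :: "complex Matrix.vec" assume y: "y \<in> carrier_vec (2 ^ n)"
    show "sqn ((mat_adjoint W * ?a * W - mat_adjoint W * ?b * W) *\<^sub>v y) \<le> \<delta>\<^sup>2 * sqn y"
      by (rule conj_diag_near[OF W y near])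
    have "cmod (cnj (a i) - cnj (b i)) \<le> \<delta>" if "i < 2 ^ n" for i
      using near[OF that] by (metis complex_cnj_diff complex_mod_cnj)
    then show "sqn ((mat_adjoint (mat_adjoint W * ?a * W) - mat_adjoint (mat_adjoint W * ?b * W)) *\<^sub>v y) \<le> \<delta>\<^sup>2 * sqn y"
      unfolding conj_adjoint[OF unitary_groupD(1)[OF W] diag_of_carrier] diag_of_adjoint
      by (rule conj_diag_near[OF W y])
  qed
  have "averaged ?a - averaged ?b = (LINT W|\<mu>. (accept_prob n A (mat_adjoint W * ?a * W) - accept_prob n A (mat_adjoint W * ?b * W)))"
    unfolding averaged_def using integrable_accept_conj[OF au] integrable_accept_conj[OF bu] by simp
  also have "norm \<dots> \<le> (LINT W|\<mu>. norm (accept_prob n A (mat_adjoint W * ?a * W) - accept_prob n A (mat_adjoint W * ?b * W)))"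
    by (rule integral_norm_bound)
  also have "\<dots> \<le> 2 * \<delta> * num_queries A"
    using integrable_accept_conj[OF au] integrable_accept_conj[OF bu] le
    by (intro integral_le_const AE_I2 integrable_norm Bochner_Integration.integrable_diff) auto
  finally show ?thesis by simp
qed

lemma averaged_square_near:
  assumes U: "U \<in> unitary_group (2 ^ n)" and m: "m > 0"
  shows "\<bar>averaged U - averaged (U * U)\<bar> \<le> 2 * matching_bound m U * num_queries A"
proof -
  let ?N = "2 ^ n :: nat"
  obtain Q z where Q: "Q \<in> unitary_group ?N" and z: "\<And>i. i < ?N \<Longrightarrow> cmod (z i) = 1"
    and Ueq: "U = Q * diag_of ?N z * mat_adjoint Q"
    using unitary_diagonalization[OF U] by blast
  define w where "w i = (z i)\<^sup>2" for i
  have w: "cmod (w i) = 1" if "i < ?N" for i using z[OF that] by (simp add: w_def norm_power)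
  have UU: "U * U = Q * diag_of ?N w * mat_adjoint Q"
    unfolding Ueq conj_product[OF Q diag_of_carrier diag_of_carrier] diag_of_mult w_def power2_eq_square ..
  obtain p q where p: "p permutes {..<?N}" and q: "q permutes {..<?N}"
    and pq: "\<And>k. k < ?N \<Longrightarrow> cmod (z (p k) - (z (q k))\<^sup>2)
       \<le> 2 * pi * (38 / real m + 2 * (\<Sum>d\<in>{1..<m ^ 3}. cmod (\<Sum>i<?N. z i ^ d) + cmod (\<Sum>i<?N. z i ^ (2 * d))) / real ?N)"
    using square_matching[of ?N z m] z m by blast
  have gap: "cmod ((z \<circ> p) k - (w \<circ> q) k) \<le> matching_bound m U" if "k < ?N" for k
    using pq[OF that] unfolding matching_bound_def Ueq power_trace_diagonalized[OF Q] by (simp add: w_def)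
  \<comment> \<open>The hybrid bound asks for a strictly positive distance; the summand 38 / m
    provides it even if all traces vanish.\<close>
  have pos: "matching_bound m U > 0"
    using m unfolding matching_bound_def
    by (intro mult_pos_pos add_pos_nonneg divide_nonneg_nonneg mult_nonneg_nonneg sum_nonneg add_nonneg_nonneg) auto
  have pN: "p i < ?N" "q i < ?N" if "i < ?N" for i
    using permutes_in_image[OF p] permutes_in_image[OF q] that by auto
  have "averaged U = averaged (diag_of ?N z)"
    unfolding Ueq by (rule averaged_conj[OF Q]) (rule diag_of_unitary, rule z)
  also have "\<dots> = averaged (diag_of ?N (z \<circ> p))"
    by (rule averaged_diag_permuted[OF p, symmetric]) (rule z)
  finally have "averaged U = averaged (diag_of ?N (z \<circ> p))" .
  moreover have "averaged (U * U) = averaged (diag_of ?N (w \<circ> q))"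
  proof -
    have "averaged (U * U) = averaged (diag_of ?N w)"
      unfolding UU by (rule averaged_conj[OF Q]) (rule diag_of_unitary, rule w)
    also have "\<dots> = averaged (diag_of ?N (w \<circ> q))"
      by (rule averaged_diag_permuted[OF q, symmetric]) (rule w)
    finally show ?thesis .
  qed
  moreover have "\<bar>averaged (diag_of ?N (z \<circ> p)) - averaged (diag_of ?N (w \<circ> q))\<bar> \<le> 2 * matching_bound m U * num_queries A"
    using z w pN by (intro averaged_diag_near pos gap) auto
  ultimately show ?thesis by simp
qed

lemma integral_averaged: "(LINT U|\<mu>. averaged U) = (LINT U|\<mu>. accept_prob n A U)"
  unfolding averaged_def by (rule haar_integral_conj[OF accept_prob_measurable accept_prob_bounded])

lemma square_measurable: "(\<lambda>V. V * V) \<in> measurable \<mu> \<mu>"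
  by (intro measurable_haar_mult measurable_ident_sets[OF refl])

text \<open>Conjugation commutes with squaring. The average of the acceptance probability over
  conjugates of the square is therefore a conjugation average of V \<mapsto>
  \<open>accept_prob n A (V * V)\<close>, to which \<open>haar_integral_conj\<close>
  applies.\<close>

lemma integral_averaged_square:
  "(LINT U|\<mu>. averaged (U * U)) = (LINT U|square_distr \<mu>. accept_prob n A U)"
proof -
  have "(LINT U|\<mu>. averaged (U * U)) = (LINT U|\<mu>. LINT W|\<mu>. accept_prob n A ((mat_adjoint W * U * W) * (mat_adjoint W * U * W)))"
    unfolding averaged_def
  proof (intro Bochner_Integration.integral_cong[OF refl] arg_cong[of _ _ "accept_prob n A"])
    fix U W assume "U \<in> space \<mu>" "W \<in> space \<mu>"
    then show "mat_adjoint W * (U * U) * W = (mat_adjoint W * U * W) * (mat_adjoint W * U * W)"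
      by (subst conj_product') (auto dest: unitary_groupD(1))
  qed
  also have "\<dots> = (LINT V|\<mu>. accept_prob n A (V * V))"
    by (rule haar_integral_conj[where h = "\<lambda>V. accept_prob n A (V * V)" and C = 1])
      (auto intro!: measurable_compose[OF square_measurable accept_prob_measurable] accept_prob_bounded unitary_group_mult)
  also have "\<dots> = (LINT U|square_distr \<mu>. accept_prob n A U)"
    unfolding square_distr_def by (rule integral_distr[symmetric, OF square_measurable accept_prob_measurable])
  finally show ?thesis .
qed

text \<open>Both acceptance probabilities become integrals over the same Haar variable, so their
  difference is bounded by integrating a pointwise estimate; 768 is twice the constant 384 of the
  expected matching bound.\<close>

theorem square_advantage_le:
  assumes m: "m > 0" and N: "4 * m ^ 3 \<le> 2 ^ n" "m ^ 7 \<le> 2 ^ n"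
  shows "\<bar>(LINT U|\<mu>. accept_prob n A U) - (LINT U|square_distr \<mu>. accept_prob n A U)\<bar> \<le> 768 * num_queries A / real m"
proof -
  have i1: "integrable \<mu> averaged"
    by (rule integrable_const_bound[where B = 1]) (auto intro!: AE_I2 averaged_bounded averaged_measurable)
  have i2: "integrable \<mu> (\<lambda>U. averaged (U * U))"
    by (rule integrable_const_bound[where B = 1])
      (auto intro!: AE_I2 averaged_bounded unitary_group_mult measurable_compose[OF square_measurable averaged_measurable])
  have "(LINT U|\<mu>. accept_prob n A U) - (LINT U|square_distr \<mu>. accept_prob n A U) = (LINT U|\<mu>. (averaged U - averaged (U * U)))"
    unfolding integral_averaged[symmetric] integral_averaged_square[symmetric] using i1 i2 by simp
  also have "norm \<dots> \<le> (LINT U|\<mu>. norm (averaged U - averaged (U * U)))"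
    by (rule integral_norm_bound)
  also have "\<dots> \<le> (LINT U|\<mu>. (2 * matching_bound m U * num_queries A))"
    using i1 i2 integrable_matching_bound averaged_square_near[OF _ m]
    by (intro integral_mono integrable_norm Bochner_Integration.integrable_diff) auto
  also have "\<dots> = 2 * (LINT U|\<mu>. matching_bound m U) * num_queries A" by simp
  also have "\<dots> \<le> 2 * (384 / real m) * num_queries A"
    using expected_matching_bound[OF m N] by (intro mult_right_mono mult_left_mono) auto
  finally show ?thesis by simp
qed

end

section \<open>The exponential lower bound\<close>

text \<open>With m close to 2^(n/7), an advantage of at least \<open>\<epsilon>\<close> forces at
  least \<open>\<epsilon> / 768 * m\<close> queries. The exponent 1/8 lies below 1/7, and the gap
  absorbs both the rounding of n / 7 and the constant factor; only the threshold depends on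
  \<open>\<epsilon>\<close>.\<close>

theorem mainTheorem2:
  fixes \<epsilon> :: real
  assumes "\<epsilon> > 0"
  shows "\<exists>c>0. \<exists>n\<^sub>0. \<forall>n\<ge>n\<^sub>0. \<forall>\<mu> A.
    haar_unitary (2 ^ n) \<mu> \<longrightarrow> valid_algorithm n A \<longrightarrow>
    \<bar>(LINT U|\<mu>. accept_prob n A U) - (LINT U|square_distr \<mu>. accept_prob n A U)\<bar> \<ge> \<epsilon> \<longrightarrow>
    real (num_queries A) \<ge> 2 powr (c * real n)"
proof -
  \<comment> \<open>The factor 56 is the reciprocal of 1/7 - 1/8, and the summand 1 pays for
    rounding n / 7 down. The maximum with 7 guarantees that m is at least 2.\<close>
  define n\<^sub>0 where "n\<^sub>0 = max 7 (nat \<lceil>56 * (log 2 (768 / \<epsilon>) + 1)\<rceil>)"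
  have "2 powr (1 / 8 * real n) \<le> real (num_queries A)"
    if n: "n \<ge> n\<^sub>0" and \<mu>: "haar_unitary (2 ^ n) \<mu>" and A: "valid_algorithm n A"
      and adv: "\<bar>(LINT U|\<mu>. accept_prob n A U) - (LINT U|square_distr \<mu>. accept_prob n A U)\<bar> \<ge> \<epsilon>" for n \<mu> A
  proof -
    interpret haar_query n \<mu> A by unfold_locales (fact \<mu> A)+
    define m :: nat where "m = 2 ^ (n div 7)"
    have n7: "n \<ge> 7" using n by (simp add: n\<^sub>0_def)
    have "m ^ 7 = 2 ^ (n div 7 * 7)" by (simp add: m_def power_mult)
    also have "\<dots> \<le> 2 ^ n" by (intro power_increasing) auto
    finally have m7: "m ^ 7 \<le> 2 ^ n" .
    have "1 \<le> n div 7" using n7 by simp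
    then have "(2::nat) ^ 1 \<le> m" unfolding m_def by (intro power_increasing) auto
    then have m2: "m \<ge> 2" by simp
    \<comment> \<open>Here m \<ge> 2 is used: it gives m^4 \<ge> 16, so the other size condition
      follows from m^7 \<le> 2^n.\<close>
    have "4 * m ^ 3 \<le> m ^ 4 * m ^ 3"
      using power_mono[OF m2, of 4] by (intro mult_right_mono) auto
    also have "\<dots> = m ^ 7" by (simp flip: power_add)
    finally have m3: "4 * m ^ 3 \<le> 2 ^ n" using m7 by simp
    have "\<epsilon> \<le> 768 * num_queries A / real m"
      using adv square_advantage_le[OF _ m3 m7] m2 by simp
    then have lower: "\<epsilon> / 768 * real m \<le> real (num_queries A)" using m2 by (simp add: field_simps)
    have "real n / 7 - 1 \<le> real (n div 7)"
    proof -
      have "n \<le> 7 * (n div 7) + 6" by presburger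
      then have "real n \<le> 7 * real (n div 7) + 6" by linarith
      then show ?thesis by simp
    qed
    moreover have "log 2 (768 / \<epsilon>) + 1 \<le> real n / 56"
    proof -
      have "56 * (log 2 (768 / \<epsilon>) + 1) \<le> real n\<^sub>0" unfolding n\<^sub>0_def by linarith
      then show ?thesis using n by simp
    qed
    ultimately have "log 2 (768 / \<epsilon>) + 1 / 8 * real n \<le> real (n div 7)" by simp
    then have "2 powr (log 2 (768 / \<epsilon>) + 1 / 8 * real n) \<le> 2 powr real (n div 7)" by simp
    also have "\<dots> = real m" by (simp add: m_def powr_realpow)
    finally have "768 / \<epsilon> * 2 powr (1 / 8 * real n) \<le> real m"
      using assms by (simp add: powr_add)
    then have "2 powr (1 / 8 * real n) \<le> \<epsilon> / 768 * real m" using assms by (simp add: field_simps)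
    then show ?thesis using lower by simp
  qed
  then show ?thesis by (intro exI[of _ "1 / 8"] conjI exI[of _ n\<^sub>0]) auto
qed

end
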